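(* Let $M$ be a compact, connected smooth curve of finite length in $\mathbb{R}^\nu$, $\nu=2$ or $3$ (either closed or with two end points), with arc length $s$ and curvature $\kappa$. Let $H=-\frac{d^2}{ds^2}+V(s)$ on $L^2(M)$ with $V$ bounded, measurable and real-valued (Dirichlet conditions at the end points if $M$ is not closed), with eigenvalues $\lambda_1<\lambda_2\le\cdots$, normalized real first eigenfunction $u_1$, and $\Gamma:=\lambda_2-\lambda_1$. Then $$\Gamma\le4\int_M\left(\left(\frac{du_1}{ds}\right)^2+\frac{\kappa^2}{4}u_1^2\right)ds .$$ Furthermore, if $H$ is of the form $H_g:=-\frac{d^2}{ds^2}+g\kappa^2$ with $g>0$, then $$\Gamma\le\max\left(4,\frac1g\right)\lambda_1 ,$$ equivalently $$\frac{\lambda_2}{\lambda_1}\le\max\left(5,1+\frac1g\right).$$ For each $0<g\le\frac14$ this last bound is sharp, i.e. the right side cannot be replaced by a smaller constant valid for all such curves $M$.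
   Context: $H$ is the Friedrichs extension from $C_c^\infty(M)$ (smooth functions compactly supported away from the end points, if any), with form domain $W_0^1(M)$, which for a closed curve is $W^1(M)$ (periodic in $s$). Eigenvalues are listed in increasing order with multiplicity. The curvature $\kappa$ is the norm of the second derivative of the position vector with respect to arc length. *)

theory Defs
  imports "HOL-Analysis.Analysis"
begin

section \<open>Curves parametrized by arc length\<close>

datatype curve_type = Closed_Curve | Arc

text \<open>For \<open>S = {0..L}\<close> the derivatives at the end points are one-sided.\<close>

definition smooth_on :: "real set \<Rightarrow> (real \<Rightarrow> 'a::real_normed_vector) \<Rightarrow> bool" where
  "smooth_on S f \<longleftrightarrow>
     (\<exists>D. D 0 = f \<and>
          (\<forall>k::nat. \<forall>t\<in>S. (D k has_vector_derivative D (Suc k) t) (at t within S)))"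

definition curve_dom :: "curve_type \<Rightarrow> real \<Rightarrow> real set" where
  "curve_dom K L = (case K of Closed_Curve \<Rightarrow> UNIV | Arc \<Rightarrow> {0..L})"

text \<open>
  A compact connected smooth curve of length \<open>L\<close> is given by its arc length parametrization
  \<open>\<gamma>\<close>, which for a closed curve is an \<open>L\<close>-periodic function on the line. Curves are immersed,
  that is, they may intersect themselves; curves that do not are \<open>embedded_curve\<close>s.
\<close>

definition smooth_curve :: "curve_type \<Rightarrow> real \<Rightarrow> (real \<Rightarrow> real ^ 'n) \<Rightarrow> bool" where
  "smooth_curve K L \<gamma> \<longleftrightarrow>
     L > 0 \<and>
     smooth_on (curve_dom K L) \<gamma> \<and>
     (\<forall>s\<in>curve_dom K L. norm (vector_derivative \<gamma> (at s within curve_dom K L)) = 1) \<and>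
     (K = Closed_Curve \<longrightarrow> (\<forall>s. \<gamma> (s + L) = \<gamma> s))"

definition embedded_curve :: "curve_type \<Rightarrow> real \<Rightarrow> (real \<Rightarrow> real ^ 'n) \<Rightarrow> bool" where
  "embedded_curve K L \<gamma> \<longleftrightarrow>
     smooth_curve K L \<gamma> \<and>
     inj_on \<gamma> (case K of Closed_Curve \<Rightarrow> {0..<L} | Arc \<Rightarrow> {0..L})"

definition curvature :: "curve_type \<Rightarrow> real \<Rightarrow> (real \<Rightarrow> real ^ 'n) \<Rightarrow> real \<Rightarrow> real" where
  "curvature K L \<gamma> s =
     norm (vector_derivative
             (\<lambda>t. vector_derivative \<gamma> (at t within curve_dom K L))
             (at s within curve_dom K L))"


section \<open>Function spaces on the curve\<close>

text \<open>
  Functions on the curve are functions of the arc length; elements of \<open>L\<^sup>2\<close> are represented by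
  functions, of which only the values almost everywhere on \<open>{0..L}\<close> matter.
\<close>

definition L2 :: "real \<Rightarrow> (real \<Rightarrow> complex) set" where
  "L2 L = {f. f \<in> borel_measurable (lebesgue_on {0..L}) \<and>
              integrable (lebesgue_on {0..L}) (\<lambda>s. (cmod (f s))\<^sup>2)}"

definition L2_tendsto :: "real \<Rightarrow> (nat \<Rightarrow> real \<Rightarrow> complex) \<Rightarrow> (real \<Rightarrow> complex) \<Rightarrow> bool" where
  "L2_tendsto L f g \<longleftrightarrow>
     (\<lambda>n. LINT s|lebesgue_on {0..L}. (cmod (f n s - g s))\<^sup>2) \<longlonglongrightarrow> 0"

text \<open>
  \<open>C\<^sub>c\<^sup>\<infinity>(M)\<close>: smooth functions compactly supported away from the end points, if any. A function
  on a closed curve is a periodic function of \<open>s\<close>.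
\<close>

definition test_functions :: "curve_type \<Rightarrow> real \<Rightarrow> (real \<Rightarrow> complex) set" where
  "test_functions K L =
     {\<phi>. smooth_on UNIV \<phi> \<and>
         (case K of
            Closed_Curve \<Rightarrow> \<forall>s. \<phi> (s + L) = \<phi> s
          | Arc \<Rightarrow> \<exists>a b. 0 < a \<and> b < L \<and> (\<forall>s. s \<notin> {a..b} \<longrightarrow> \<phi> s = 0))}"

text \<open>
  \<open>W01 K L u du\<close>: the function \<open>u\<close> belongs to \<open>W\<^sub>0\<^sup>1(M)\<close>, the closure of \<open>C\<^sub>c\<^sup>\<infinity>(M)\<close> in the norm of
  \<open>W\<^sup>1\<close>, and \<open>du\<close> is (a representative of) its derivative with respect to arc length.
\<close>

definition W01 :: "curve_type \<Rightarrow> real \<Rightarrow> (real \<Rightarrow> complex) \<Rightarrow> (real \<Rightarrow> complex) \<Rightarrow> bool" where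
  "W01 K L u du \<longleftrightarrow>
     u \<in> L2 L \<and> du \<in> L2 L \<and>
     (\<exists>\<phi>. (\<forall>n. \<phi> n \<in> test_functions K L) \<and>
          L2_tendsto L \<phi> u \<and>
          L2_tendsto L (\<lambda>n s. vector_derivative (\<phi> n) (at s)) du)"


section \<open>The Schroedinger operator and its eigenvalues\<close>

text \<open>
  The graph of the Friedrichs extension \<open>H\<close> of \<open>-d\<^sup>2/ds\<^sup>2 + V\<close> from \<open>C\<^sub>c\<^sup>\<infinity>(M)\<close>, for bounded \<open>V\<close>:
  \<open>u\<close> is in the domain and \<open>H u = w\<close>. This is the operator associated with the closure of the
  quadratic form of \<open>-d\<^sup>2/ds\<^sup>2 + V\<close> on \<open>C\<^sub>c\<^sup>\<infinity>(M)\<close>; as \<open>V\<close> is bounded, the form norm is equivalent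
  to the norm of \<open>W\<^sup>1\<close>, and the form domain is \<open>W\<^sub>0\<^sup>1(M)\<close>.
\<close>

definition schrodinger_graph ::
  "curve_type \<Rightarrow> real \<Rightarrow> (real \<Rightarrow> real) \<Rightarrow> (real \<Rightarrow> complex) \<Rightarrow> (real \<Rightarrow> complex) \<Rightarrow> bool" where
  "schrodinger_graph K L V u w \<longleftrightarrow>
     w \<in> L2 L \<and>
     (\<exists>du. W01 K L u du \<and>
       (\<forall>v dv. W01 K L v dv \<longrightarrow>
          (LINT s|lebesgue_on {0..L}.
              du s * cnj (dv s) + complex_of_real (V s) * u s * cnj (v s))
          = (LINT s|lebesgue_on {0..L}. w s * cnj (v s))))"

definition eigenspace ::
  "curve_type \<Rightarrow> real \<Rightarrow> (real \<Rightarrow> real) \<Rightarrow> real \<Rightarrow> (real \<Rightarrow> complex) set" where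
  "eigenspace K L V \<mu> = {u. schrodinger_graph K L V u (\<lambda>s. complex_of_real \<mu> * u s)}"

text \<open>The complex dimension is \<open>m\<close>, where functions equal almost everywhere are identified.\<close>

definition has_L2_dim :: "real \<Rightarrow> (real \<Rightarrow> complex) set \<Rightarrow> nat \<Rightarrow> bool" where
  "has_L2_dim L E m \<longleftrightarrow>
     (\<exists>f. (\<forall>i<m. f i \<in> E) \<and>
          (\<forall>c. (AE s in lebesgue_on {0..L}. (\<Sum>i<m. c i * f i s) = 0) \<longrightarrow> (\<forall>i<m. c i = 0)) \<and>
          (\<forall>u\<in>E. \<exists>c. AE s in lebesgue_on {0..L}. u s = (\<Sum>i<m. c i * f i s)))"

text \<open>
  \<open>lam 1 \<le> lam 2 \<le> \<dots>\<close> lists the eigenvalues in increasing order with multiplicity. The value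
  \<open>lam 0\<close> plays no role. A \<open>\<mu>\<close> that is not an eigenvalue has eigenspace of dimension \<open>0\<close> and
  so does not occur in the list.
\<close>

definition eigenvalue_list ::
  "curve_type \<Rightarrow> real \<Rightarrow> (real \<Rightarrow> real) \<Rightarrow> (nat \<Rightarrow> real) \<Rightarrow> bool" where
  "eigenvalue_list K L V lam \<longleftrightarrow>
     mono_on {1..} lam \<and>
     (\<forall>\<mu>. finite {k. 1 \<le> k \<and> lam k = \<mu>} \<and>
          has_L2_dim L (eigenspace K L V \<mu>) (card {k. 1 \<le> k \<and> lam k = \<mu>}))"

end

(*
  Let u be a normalized first eigenfunction and let G be a coordinate of the position vector, shifted
  so that G u is orthogonal to u. The variational principle for the second eigenvalue and the
  commutator identity q(G u) - lam 1 |G u|^2 = |G' u|^2 give Gamma |G u|^2 <= |G' u|^2. Integration by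
  parts gives Re <G u, w> = - |G' u|^2 for w = G'' u + 2 G' u', so expanding
  0 <= |Gamma G u + w|^2 yields Gamma |G' u|^2 <= |w|^2. Summed over the coordinates, with a unit
  tangent vector orthogonal to its derivative, this is Gamma <= 4 |u'|^2 + |kappa u|^2, and for the
  potential g kappa^2 the right side is at most max 4 (1/g) times the energy lam 1 of u.
  For a circle of radius 1 the eigenvalues are g, 1 + g, 1 + g, ..., so the bound is attained for
  g <= 1/4.
*)

theory Submission
  imports Defs "HOL-Complex_Analysis.Great_Picard"
begin

section \<open>Square integrable functions\<close>

text \<open>\<open>eigenvalue_list\<close> records only values and the dimensions of weak
  eigenspaces, so no min-max formula comes with it. The bound for \<open>lam 2\<close> is obtained
  directly: the form attains its minimum over the normalized functions orthogonal to
  \<open>u\<close>, the minimizer is an eigenfunction, its value therefore occurs in the list, and a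
  dimension count places it at index 2 or later. This costs some analysis of \<open>W01\<close>:
  completeness of L2, a compact embedding, closedness, uniqueness of the derivative. The second
  obstacle is regularity. As V is merely bounded and measurable, all estimates stay at the level of
  the form. The function w = G'' u + 2 G' u' is the commutator of d^2/ds^2 with G applied to u, yet
  it contains no second derivative of u; the commutator identity is the weak equation tested with
  G^2 u. Dividing by \<open>lam 1\<close> requires \<open>lam 1 > 0\<close>, which the same
  integration by parts supplies. The circle needs its whole list of eigenvalues with multiplicities,
  hence completeness of the exponentials.\<close>

abbreviation (input) arc_measure :: "real \<Rightarrow> real measure" where
  "arc_measure L \<equiv> lebesgue_on {0..L}"

definition ip :: "real \<Rightarrow> (real \<Rightarrow> complex) \<Rightarrow> (real \<Rightarrow> complex) \<Rightarrow> complex" where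
  "ip L f g = (LINT s|arc_measure L. f s * cnj (g s))"

text \<open>The square is kept because energies are quadratic; the triangle inequality then takes
  the form of \<open>nsq_triangle\<close>, with constants 2.\<close>

definition nsq :: "real \<Rightarrow> (real \<Rightarrow> complex) \<Rightarrow> real" where
  "nsq L f = (LINT s|arc_measure L. (cmod (f s))\<^sup>2)"

lemma finite_measure_arc: "finite_measure (arc_measure L)"
  by (intro finite_measureI) (cases "0 \<le> L"; simp add: emeasure_restrict_space)

lemma integrable_bounded_arc:
  fixes f :: "real \<Rightarrow> 'b::{banach, second_countable_topology}"
  assumes "f \<in> borel_measurable (arc_measure L)" "\<And>s. s \<in> {0..L} \<Longrightarrow> norm (f s) \<le> B"
  shows "integrable (arc_measure L) f"
proof -
  interpret finite_measure "arc_measure L" by (rule finite_measure_arc)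
  show ?thesis
    by (rule integrable_const_bound[of _ B]) (use assms in \<open>auto intro!: AE_I2\<close>)
qed

lemma L2_D:
  assumes "f \<in> L2 L"
  shows "f \<in> borel_measurable (arc_measure L)" "integrable (arc_measure L) (\<lambda>s. (cmod (f s))\<^sup>2)"
  using assms by (auto simp: L2_def)

lemma L2_mult_integrable:
  assumes "f \<in> L2 L" "g \<in> L2 L"
  shows "integrable (arc_measure L) (\<lambda>s. f s * g s)"
proof (rule Bochner_Integration.integrable_bound)
  show "integrable (arc_measure L) (\<lambda>s. (cmod (f s))\<^sup>2 + (cmod (g s))\<^sup>2)"
    using L2_D[OF assms(1)] L2_D[OF assms(2)] by auto
  show "(\<lambda>s. f s * g s) \<in> borel_measurable (arc_measure L)"
    using L2_D[OF assms(1)] L2_D[OF assms(2)] by auto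
  have "norm (a * b) \<le> norm ((cmod a)\<^sup>2 + (cmod b)\<^sup>2)" for a b :: complex
    using sum_squares_bound[of "cmod a" "cmod b"] mult_nonneg_nonneg[of "cmod a" "cmod b"]
    by (simp add: norm_mult del: mult_nonneg_nonneg)
  then show "AE s in arc_measure L. norm (f s * g s) \<le> norm ((cmod (f s))\<^sup>2 + (cmod (g s))\<^sup>2)"
    by simp
qed

lemma L2_bounded_mult:
  assumes "f \<in> L2 L" "b \<in> borel_measurable (arc_measure L)" "\<And>s. s \<in> {0..L} \<Longrightarrow> cmod (b s) \<le> B"
  shows "(\<lambda>s. b s * f s) \<in> L2 L"
proof -
  have "integrable (arc_measure L) (\<lambda>s. (cmod (b s * f s))\<^sup>2)"
  proof (rule Bochner_Integration.integrable_bound)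
    show "integrable (arc_measure L) (\<lambda>s. B\<^sup>2 * (cmod (f s))\<^sup>2)"
      using L2_D[OF assms(1)] by simp
    show "(\<lambda>s. (cmod (b s * f s))\<^sup>2) \<in> borel_measurable (arc_measure L)"
      using assms L2_D[OF assms(1)] by auto
    have "(cmod (b s))\<^sup>2 * (cmod (f s))\<^sup>2 \<le> B\<^sup>2 * (cmod (f s))\<^sup>2" if "s \<in> {0..L}" for s
      using assms(3)[OF that] by (intro mult_right_mono power_mono) auto
    then show "AE s in arc_measure L. norm ((cmod (b s * f s))\<^sup>2) \<le> norm (B\<^sup>2 * (cmod (f s))\<^sup>2)"
      by (intro AE_I2) (simp add: norm_mult power_mult_distrib)
  qed
  then show ?thesis
    using assms L2_D[OF assms(1)] by (auto simp: L2_def)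
qed

lemma L2_cmult [simp, intro]: "f \<in> L2 L \<Longrightarrow> (\<lambda>s. c * f s) \<in> L2 L"
  by (rule L2_bounded_mult[where B="cmod c"]) auto

lemma borel_measurable_cnj [measurable (raw)]:
  assumes "f \<in> borel_measurable M"
  shows "(\<lambda>s. cnj (f s)) \<in> borel_measurable M"
  by (rule measurable_compose[OF assms])
    (intro borel_measurable_continuous_onI continuous_on_cnj continuous_on_id)

lemma L2_cnj [simp, intro]: "f \<in> L2 L \<Longrightarrow> (\<lambda>s. cnj (f s)) \<in> L2 L"
  by (auto simp: L2_def intro: borel_measurable_cnj)

lemma L2_add [simp, intro]:
  assumes "f \<in> L2 L" "g \<in> L2 L"
  shows "(\<lambda>s. f s + g s) \<in> L2 L"
proof -
  have "integrable (arc_measure L) (\<lambda>s. (cmod (f s + g s))\<^sup>2)"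
  proof (rule Bochner_Integration.integrable_bound)
    show "integrable (arc_measure L) (\<lambda>s. 2 * (cmod (f s))\<^sup>2 + 2 * (cmod (g s))\<^sup>2)"
      using L2_D[OF assms(1)] L2_D[OF assms(2)] by simp
    show "(\<lambda>s. (cmod (f s + g s))\<^sup>2) \<in> borel_measurable (arc_measure L)"
      using L2_D[OF assms(1)] L2_D[OF assms(2)] by auto
    have "(cmod (a + b))\<^sup>2 \<le> 2 * (cmod a)\<^sup>2 + 2 * (cmod b)\<^sup>2" for a b
      using power_mono[OF norm_triangle_ineq[of a b], of 2] sum_squares_bound[of "cmod a" "cmod b"]
      by (simp add: power2_sum)
    then show "AE s in arc_measure L.
        norm ((cmod (f s + g s))\<^sup>2) \<le> norm (2 * (cmod (f s))\<^sup>2 + 2 * (cmod (g s))\<^sup>2)"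
      by simp
  qed
  then show ?thesis
    using L2_D[OF assms(1)] L2_D[OF assms(2)] by (auto simp: L2_def)
qed

lemma L2_uminus [simp, intro]: "f \<in> L2 L \<Longrightarrow> (\<lambda>s. - f s) \<in> L2 L"
  by (auto simp: L2_def)

lemma L2_diff [simp, intro]: "f \<in> L2 L \<Longrightarrow> g \<in> L2 L \<Longrightarrow> (\<lambda>s. f s - g s) \<in> L2 L"
  using L2_add[of f L "\<lambda>s. - g s"] by simp

lemma L2_zero [simp]: "(\<lambda>s. 0) \<in> L2 L"
  by (auto simp: L2_def)

lemma L2_continuous:
  assumes "continuous_on {0..L} f"
  shows "f \<in> L2 L"
proof -
  have m: "f \<in> borel_measurable (arc_measure L)"
    using assms by (intro continuous_imp_measurable_on_sets_lebesgue) auto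
  obtain B where B: "\<And>s. s \<in> {0..L} \<Longrightarrow> cmod (f s) \<le> B"
    using compact_imp_bounded[OF compact_continuous_image[OF assms compact_Icc]]
    unfolding bounded_iff by blast
  have "integrable (arc_measure L) (\<lambda>s. (cmod (f s))\<^sup>2)"
    by (rule integrable_bounded_arc[where B="B\<^sup>2"]) (use m B in \<open>auto intro: power_mono\<close>)
  then show ?thesis using m by (auto simp: L2_def)
qed

lemma nsq_nonneg [simp]: "0 \<le> nsq L f"
  by (simp add: nsq_def)

lemma ip_integrable: "f \<in> L2 L \<Longrightarrow> g \<in> L2 L \<Longrightarrow> integrable (arc_measure L) (\<lambda>s. f s * cnj (g s))"
  by (intro L2_mult_integrable L2_cnj)

lemma ip_add_left: "f \<in> L2 L \<Longrightarrow> g \<in> L2 L \<Longrightarrow> h \<in> L2 L \<Longrightarrow>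
    ip L (\<lambda>s. f s + g s) h = ip L f h + ip L g h"
  unfolding ip_def by (simp add: distrib_right ip_integrable)

lemma ip_cmult_left [simp]: "ip L (\<lambda>s. c * f s) h = c * ip L f h"
  unfolding ip_def by (simp add: mult.assoc)

lemma ip_cnj: "ip L f g = cnj (ip L g f)"
  unfolding ip_def Bochner_Integration.integral_cnj[symmetric] by (simp add: mult.commute)

lemma ip_add_right: "f \<in> L2 L \<Longrightarrow> g \<in> L2 L \<Longrightarrow> h \<in> L2 L \<Longrightarrow>
    ip L h (\<lambda>s. f s + g s) = ip L h f + ip L h g"
  by (subst (1 2 3) ip_cnj) (simp add: ip_add_left)

lemma ip_cmult_right [simp]: "ip L h (\<lambda>s. c * f s) = cnj c * ip L h f"
  by (subst (1 2) ip_cnj) simp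

lemma ip_diff_left: "f \<in> L2 L \<Longrightarrow> g \<in> L2 L \<Longrightarrow> h \<in> L2 L \<Longrightarrow>
    ip L (\<lambda>s. f s - g s) h = ip L f h - ip L g h"
  unfolding ip_def by (simp add: left_diff_distrib ip_integrable)

lemma ip_diff_right: "f \<in> L2 L \<Longrightarrow> g \<in> L2 L \<Longrightarrow> h \<in> L2 L \<Longrightarrow>
    ip L h (\<lambda>s. f s - g s) = ip L h f - ip L h g"
  by (subst (1 2 3) ip_cnj) (simp add: ip_diff_left)

lemma ip_self: "ip L f f = of_real (nsq L f)"
  unfolding ip_def nsq_def integral_complex_of_real[symmetric] by (simp add: complex_norm_square del: of_real_power)

lemma nsq_eq_ip: "nsq L f = Re (ip L f f)"
  by (simp add: ip_self)

lemma Re_ip_sym: "Re (ip L f g) = Re (ip L g f)"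
  by (subst ip_cnj) simp

lemma nsq_add:
  assumes "f \<in> L2 L" "g \<in> L2 L"
  shows "nsq L (\<lambda>s. f s + g s) = nsq L f + nsq L g + 2 * Re (ip L f g)"
  using assms Re_ip_sym[of L g f] by (simp add: nsq_eq_ip ip_add_left ip_add_right)

lemma nsq_cmult [simp]: "nsq L (\<lambda>s. c * f s) = (cmod c)\<^sup>2 * nsq L f"
  by (simp add: nsq_def norm_mult power_mult_distrib)

lemma nsq_diff:
  assumes "f \<in> L2 L" "g \<in> L2 L"
  shows "nsq L (\<lambda>s. f s - g s) = nsq L f + nsq L g - 2 * Re (ip L f g)"
  using assms Re_ip_sym[of L g f] by (simp add: nsq_eq_ip ip_diff_left ip_diff_right)

lemma nsq_parallelogram:
  assumes "f \<in> L2 L" "g \<in> L2 L"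
  shows "nsq L (\<lambda>s. f s + g s) + nsq L (\<lambda>s. f s - g s) = 2 * nsq L f + 2 * nsq L g"
  using assms by (simp add: nsq_add nsq_diff)

lemma nsq_add_le:
  assumes "f \<in> L2 L" "g \<in> L2 L"
  shows "nsq L (\<lambda>s. f s + g s) \<le> 2 * nsq L f + 2 * nsq L g"
  using nsq_parallelogram[OF assms] nsq_nonneg[of L "\<lambda>s. f s - g s"] by linarith

lemma nsq_minus_commute: "nsq L (\<lambda>s. f s - g s) = nsq L (\<lambda>s. g s - f s)"
  by (simp add: nsq_def norm_minus_commute)

lemma nsq_triangle:
  assumes "f \<in> L2 L" "g \<in> L2 L" "h \<in> L2 L"
  shows "nsq L (\<lambda>s. f s - h s) \<le> 2 * nsq L (\<lambda>s. f s - g s) + 2 * nsq L (\<lambda>s. g s - h s)"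
  using nsq_add_le[of "\<lambda>s. f s - g s" L "\<lambda>s. g s - h s"] assms by simp

text \<open>The sign of a discriminant. The degenerate case \<open>c = 0\<close> is included because
  the leading coefficient may vanish both in the Cauchy-Schwarz inequality and in the first
  variation at a minimizer.\<close>

lemma quadratic_nonneg_imp:
  fixes a b c :: real
  assumes "\<And>t. 0 \<le> a + t * b + t\<^sup>2 * c" "0 \<le> c"
  shows "b\<^sup>2 \<le> 4 * a * c"
proof (cases "c = 0")
  case True
  have "b = 0"
  proof (rule ccontr)
    assume "b \<noteq> 0"
    \<comment> \<open>At this point the linear function \<open>a + t * b\<close> takes the value
      -1.\<close>
    then show False using assms(1)[of "(- 1 - a) / b"] True by simp
  qed
  then show ?thesis using True by simp
next
  case False
  then have "c > 0" using assms by simp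
  \<comment> \<open>The value at the vertex of the parabola, multiplied by
    \<open>4 * c\<close>.\<close>
  have "0 \<le> 4 * c * (a + (- b / (2 * c)) * b + (- b / (2 * c))\<^sup>2 * c)"
    using \<open>c > 0\<close> assms(1)[of "- b / (2 * c)"] by (intro mult_nonneg_nonneg) linarith+
  also have "\<dots> = 4 * a * c - b\<^sup>2"
    using \<open>c > 0\<close> by (simp add: divide_simps) (simp add: power2_eq_square algebra_simps)
  finally show ?thesis by simp
qed

lemma ip_Cauchy_Schwarz:
  assumes "f \<in> L2 L" "g \<in> L2 L"
  shows "(cmod (ip L f g))\<^sup>2 \<le> nsq L f * nsq L g"
proof -
  \<comment> \<open>A factor of modulus 1 turns the inner product into its absolute value, so that a
    quadratic in a real variable suffices.\<close>
  obtain c where c: "cmod c = 1" "c * ip L f g = of_real (cmod (ip L f g))"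
  proof (cases "ip L f g = 0")
    case False
    have "cnj (ip L f g) / cmod (ip L f g) * ip L f g = (ip L f g * cnj (ip L f g)) / cmod (ip L f g)"
      by (simp add: mult.commute)
    also have "\<dots> = cmod (ip L f g)"
      using False by (subst complex_norm_square[symmetric]) (simp add: power2_eq_square)
    finally show ?thesis
      using False that[of "cnj (ip L f g) / cmod (ip L f g)"] by (simp add: norm_divide)
  qed (use that[of 1] in simp)
  define F where "F = (\<lambda>s. c * f s)"
  have F: "F \<in> L2 L" using assms by (auto simp: F_def)
  have ipF: "ip L F g = of_real (cmod (ip L f g))" and nF: "nsq L F = nsq L f"
    using c by (simp_all add: F_def)
  have "0 \<le> nsq L F + t * (2 * cmod (ip L f g)) + t\<^sup>2 * nsq L g" for t :: real
    using nsq_nonneg[of L "\<lambda>s. F s + complex_of_real t * g s"] F assms ipF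
    by (subst (asm) nsq_add) (auto simp: algebra_simps)
  from quadratic_nonneg_imp[OF this] show ?thesis by (simp add: power_mult_distrib nF)
qed

lemma ip_le: "f \<in> L2 L \<Longrightarrow> g \<in> L2 L \<Longrightarrow> cmod (ip L f g) \<le> sqrt (nsq L f) * sqrt (nsq L g)"
  using real_sqrt_le_mono[OF ip_Cauchy_Schwarz] by (simp add: real_sqrt_mult)

section \<open>Convergence and completeness in L2\<close>

lemma L2_tendsto_iff: "L2_tendsto L f g \<longleftrightarrow> (\<lambda>n. nsq L (\<lambda>s. f n s - g s)) \<longlonglongrightarrow> 0"
  by (simp add: L2_tendsto_def nsq_def)

lemma L2_tendsto_ip:
  assumes "L2_tendsto L f F" "L2_tendsto L g G" "\<And>n. f n \<in> L2 L" "\<And>n. g n \<in> L2 L"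
    and "F \<in> L2 L" "G \<in> L2 L"
  shows "(\<lambda>n. ip L (f n) (g n)) \<longlonglongrightarrow> ip L F G"
proof -
  let ?df = "\<lambda>n s. f n s - F s" and ?dg = "\<lambda>n s. g n s - G s"
  have eq: "ip L (f n) (g n) - ip L F G = ip L (?df n) G + ip L F (?dg n) + ip L (?df n) (?dg n)" for n
    using assms by (simp add: ip_diff_left ip_diff_right)
  have lim: "(\<lambda>n. sqrt (nsq L (?df n)) * sqrt (nsq L G) + sqrt (nsq L F) * sqrt (nsq L (?dg n))
      + sqrt (nsq L (?df n)) * sqrt (nsq L (?dg n))) \<longlonglongrightarrow>
      sqrt 0 * sqrt (nsq L G) + sqrt (nsq L F) * sqrt 0 + sqrt 0 * sqrt 0"
    using assms(1,2) unfolding L2_tendsto_iff by (intro tendsto_intros)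
  have "(\<lambda>n. ip L (f n) (g n) - ip L F G) \<longlonglongrightarrow> 0"
  proof (rule Lim_null_comparison)
    show "\<forall>\<^sub>F n in sequentially. norm (ip L (f n) (g n) - ip L F G) \<le>
        sqrt (nsq L (?df n)) * sqrt (nsq L G) + sqrt (nsq L F) * sqrt (nsq L (?dg n))
      + sqrt (nsq L (?df n)) * sqrt (nsq L (?dg n))"
      unfolding eq
      by (intro always_eventually allI order.trans[OF norm_triangle_ineq] add_mono ip_le)
        (use assms in auto)
  qed (use lim in simp)
  then show ?thesis by (simp add: LIM_zero_iff)
qed

lemma L2_tendsto_nsq:
  assumes "L2_tendsto L f F" "\<And>n. f n \<in> L2 L" "F \<in> L2 L"
  shows "(\<lambda>n. nsq L (f n)) \<longlonglongrightarrow> nsq L F"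
  using tendsto_Re[OF L2_tendsto_ip[OF assms(1,1,2,2,3,3)]] by (simp add: ip_self)

lemma L2_tendsto_add:
  assumes "L2_tendsto L f F" "L2_tendsto L g G" "\<And>n. f n \<in> L2 L" "\<And>n. g n \<in> L2 L"
    and "F \<in> L2 L" "G \<in> L2 L"
  shows "L2_tendsto L (\<lambda>n s. f n s + g n s) (\<lambda>s. F s + G s)"
  unfolding L2_tendsto_iff
proof (rule Lim_null_comparison)
  show "(\<lambda>n. 2 * nsq L (\<lambda>s. f n s - F s) + 2 * nsq L (\<lambda>s. g n s - G s)) \<longlonglongrightarrow> 0"
    using tendsto_add[OF tendsto_mult_left[of _ 0 _ 2] tendsto_mult_left[of _ 0 _ 2]] assms(1,2)
    unfolding L2_tendsto_iff by fastforce
  have "nsq L (\<lambda>s. f n s + g n s - (F s + G s)) \<le>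
      2 * nsq L (\<lambda>s. f n s - F s) + 2 * nsq L (\<lambda>s. g n s - G s)" for n
    using nsq_add_le[of "\<lambda>s. f n s - F s" L "\<lambda>s. g n s - G s"] assms
    by (simp add: algebra_simps)
  then show "\<forall>\<^sub>F n in sequentially. norm (nsq L (\<lambda>s. f n s + g n s - (F s + G s))) \<le>
      2 * nsq L (\<lambda>s. f n s - F s) + 2 * nsq L (\<lambda>s. g n s - G s)"
    by simp
qed

lemma nsq_bounded_mult_le:
  assumes "f \<in> L2 L" "b \<in> borel_measurable (arc_measure L)" "\<And>s. s \<in> {0..L} \<Longrightarrow> cmod (b s) \<le> B"
  shows "nsq L (\<lambda>s. b s * f s) \<le> B\<^sup>2 * nsq L f"
proof -
  have "nsq L (\<lambda>s. b s * f s) \<le> (LINT s|arc_measure L. B\<^sup>2 * (cmod (f s))\<^sup>2)"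
    unfolding nsq_def
  proof (rule integral_mono)
    show "integrable (arc_measure L) (\<lambda>s. (cmod (b s * f s))\<^sup>2)"
      using L2_D[OF L2_bounded_mult[OF assms]] by auto
    show "integrable (arc_measure L) (\<lambda>s. B\<^sup>2 * (cmod (f s))\<^sup>2)"
      using L2_D[OF assms(1)] by auto
    show "(cmod (b s * f s))\<^sup>2 \<le> B\<^sup>2 * (cmod (f s))\<^sup>2" if "s \<in> space (arc_measure L)" for s
      using assms(3)[of s] that unfolding norm_mult power_mult_distrib
      by (intro mult_right_mono power_mono) auto
  qed
  then show ?thesis by (simp add: nsq_def)
qed

lemma L2_tendsto_mult:
  assumes "L2_tendsto L f F" "\<And>n. f n \<in> L2 L" "F \<in> L2 L"
    and "b \<in> borel_measurable (arc_measure L)" "\<And>s. s \<in> {0..L} \<Longrightarrow> cmod (b s) \<le> B"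
  shows "L2_tendsto L (\<lambda>n s. b s * f n s) (\<lambda>s. b s * F s)"
  unfolding L2_tendsto_iff
proof (rule Lim_null_comparison)
  show "(\<lambda>n. B\<^sup>2 * nsq L (\<lambda>s. f n s - F s)) \<longlonglongrightarrow> 0"
    using assms(1) unfolding L2_tendsto_iff by (intro tendsto_mult_right_zero)
  have "nsq L (\<lambda>s. b s * f n s - b s * F s) \<le> B\<^sup>2 * nsq L (\<lambda>s. f n s - F s)" for n
    using nsq_bounded_mult_le[of "\<lambda>s. f n s - F s" L b B] assms by (simp add: right_diff_distrib)
  then show "\<forall>\<^sub>F n in sequentially. norm (nsq L (\<lambda>s. b s * f n s - b s * F s)) \<le>
      B\<^sup>2 * nsq L (\<lambda>s. f n s - F s)"
    by simp
qed

lemma L2_tendsto_cmult: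
  assumes "L2_tendsto L f F" "\<And>n. f n \<in> L2 L" "F \<in> L2 L"
  shows "L2_tendsto L (\<lambda>n s. c * f n s) (\<lambda>s. c * F s)"
  using L2_tendsto_mult[OF assms, of "\<lambda>_. c" "cmod c"] by simp

lemma nsq_eq_0_iff:
  assumes "f \<in> L2 L"
  shows "nsq L f = 0 \<longleftrightarrow> (AE s in arc_measure L. f s = 0)"
  unfolding nsq_def using L2_D[OF assms] by (subst integral_nonneg_eq_0_iff_AE) auto

lemma ip_cong_AE:
  assumes "AE s in arc_measure L. f s = f' s" "AE s in arc_measure L. g s = g' s"
    "f \<in> borel_measurable (arc_measure L)" "f' \<in> borel_measurable (arc_measure L)"
    "g \<in> borel_measurable (arc_measure L)" "g' \<in> borel_measurable (arc_measure L)"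
  shows "ip L f g = ip L f' g'"
  unfolding ip_def by (rule integral_cong_AE) (use assms in auto)

text \<open>Riesz-Fischer. On a space of finite measure the L2 norm controls the L1 norm, so a
  subsequence converges almost everywhere to a candidate \<open>F\<close>; Fatou's lemma carries the
  Cauchy estimate over to \<open>F\<close>.\<close>

lemma L2_complete:
  assumes f: "\<And>n. f n \<in> L2 L"
    and Cauchy: "\<And>e. e > 0 \<Longrightarrow> \<exists>N. \<forall>m\<ge>N. \<forall>n\<ge>N. nsq L (\<lambda>s. f m s - f n s) < e"
  obtains F where "F \<in> L2 L" "L2_tendsto L f F"
proof -
  let ?M = "arc_measure L"
  interpret finite_measure ?M by (rule finite_measure_arc)
  have one: "(\<lambda>s. 1) \<in> L2 L" by (rule L2_continuous) auto
  have int: "integrable ?M (\<lambda>s. cmod (g s))" if "g \<in> L2 L" for g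
    using L2_mult_integrable[OF that one] by auto
  have L1_le: "(LINT s|?M. cmod (g s)) \<le> sqrt (nsq L g) * sqrt (nsq L (\<lambda>s. 1))" if "g \<in> L2 L" for g
  proof -
    have g: "(\<lambda>s. complex_of_real (cmod (g s))) \<in> L2 L"
      using L2_D[OF that] by (auto simp: L2_def)
    have "ip L (\<lambda>s. complex_of_real (cmod (g s))) (\<lambda>s. 1) = of_real (LINT s|?M. cmod (g s))"
      by (simp add: ip_def)
    then show ?thesis
      using ip_le[OF g one] by (simp add: nsq_def)
  qed
  obtain r where r: "strict_mono r" "AE s in ?M. Cauchy (\<lambda>i. f (r i) s)"
  proof (rule cauchy_L1_AE_cauchy_subseq[of ?M f])
    show "integrable ?M (f n)" for n
      using L2_mult_integrable[OF f one] by simp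
    fix e :: real assume "e > 0"
    \<comment> \<open>The summand 1 keeps \<open>C\<close> positive even if the constant function 1
      has norm 0.\<close>
    define C where "C = 1 + sqrt (nsq L (\<lambda>s. 1))"
    have C: "C > 0" using real_sqrt_ge_zero[OF nsq_nonneg, of L "\<lambda>s. 1"] unfolding C_def by linarith
    obtain N where N: "\<forall>m\<ge>N. \<forall>n\<ge>N. nsq L (\<lambda>s. f m s - f n s) < (e / C)\<^sup>2"
      using Cauchy[of "(e / C)\<^sup>2"] \<open>e > 0\<close> C by auto
    have "(LINT s|?M. norm (f i s - f j s)) < e" if "i \<ge> N" "j \<ge> N" for i j
    proof -
      have "sqrt (nsq L (\<lambda>s. f i s - f j s)) < e / C"
        using N that C \<open>e > 0\<close> by (auto intro!: real_less_lsqrt)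
      then have "sqrt (nsq L (\<lambda>s. f i s - f j s)) * C < e"
        using C by (simp add: field_simps)
      moreover have "sqrt (nsq L (\<lambda>s. f i s - f j s)) * sqrt (nsq L (\<lambda>s. 1))
          \<le> sqrt (nsq L (\<lambda>s. f i s - f j s)) * C"
        by (intro mult_left_mono) (auto simp: C_def)
      ultimately show ?thesis
        using L1_le[of "\<lambda>s. f i s - f j s"] f by auto
    qed
    then show "\<exists>N. \<forall>i\<ge>N. \<forall>j\<ge>N. (LINT s|?M. norm (f i s - f j s)) < e" by blast
  qed auto
  define F where "F = (\<lambda>s. lim (\<lambda>i. f (r i) s))"
  have fm [measurable]: "f n \<in> borel_measurable ?M" for n
    using L2_D[OF f] by auto
  have Fm [measurable]: "F \<in> borel_measurable ?M"
    unfolding F_def by (rule borel_measurable_lim_metric) measurable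
  have lim: "AE s in ?M. (\<lambda>i. f (r i) s) \<longlonglongrightarrow> F s"
    using r(2) by eventually_elim (simp add: F_def Cauchy_convergent_iff convergent_LIMSEQ_iff)
  have nn: "(\<integral>\<^sup>+s. (cmod (f n s - F s))\<^sup>2 \<partial>?M) \<le> ennreal e"
    if n: "\<forall>m\<ge>N. nsq L (\<lambda>s. f n s - f m s) < e" for n e N
  proof -
    have "(\<integral>\<^sup>+s. (cmod (f n s - F s))\<^sup>2 \<partial>?M) =
        (\<integral>\<^sup>+s. liminf (\<lambda>i. ennreal ((cmod (f n s - f (r i) s))\<^sup>2)) \<partial>?M)"
    proof (rule nn_integral_cong_AE)
      show "AE s in ?M. ennreal ((cmod (f n s - F s))\<^sup>2) =
          liminf (\<lambda>i. ennreal ((cmod (f n s - f (r i) s))\<^sup>2))"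
        using lim
      proof eventually_elim
        case (elim s)
        have "(\<lambda>i. ennreal ((cmod (f n s - f (r i) s))\<^sup>2)) \<longlonglongrightarrow> ennreal ((cmod (f n s - F s))\<^sup>2)"
          by (intro tendsto_ennrealI tendsto_intros elim)
        then show ?case by (rule lim_imp_Liminf[OF sequentially_bot, symmetric])
      qed
    qed
    \<comment> \<open>Fatou's lemma along the subsequence, with \<open>n\<close> fixed.\<close>
    also have "\<dots> \<le> liminf (\<lambda>i. (\<integral>\<^sup>+s. (cmod (f n s - f (r i) s))\<^sup>2 \<partial>?M))"
      by (rule nn_integral_liminf) measurable
    also have "\<dots> \<le> liminf (\<lambda>i. ennreal e)"
    proof (rule Liminf_mono, unfold eventually_sequentially, intro exI[of _ N] allI impI)
      fix i assume "N \<le> i"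
      then have "nsq L (\<lambda>s. f n s - f (r i) s) < e"
        using n seq_suble[OF r(1), of i] by auto
      moreover have "(\<integral>\<^sup>+s. (cmod (f n s - f (r i) s))\<^sup>2 \<partial>?M) = ennreal (nsq L (\<lambda>s. f n s - f (r i) s))"
        unfolding nsq_def using L2_D[OF L2_diff[OF f f]] by (intro nn_integral_eq_integral) auto
      ultimately show "(\<integral>\<^sup>+s. (cmod (f n s - f (r i) s))\<^sup>2 \<partial>?M) \<le> ennreal e"
        by (simp add: ennreal_leI)
    qed
    finally show ?thesis by (simp add: Liminf_const)
  qed
  have key: "(\<lambda>s. f n s - F s) \<in> L2 L \<and> nsq L (\<lambda>s. f n s - F s) \<le> e"
    if "\<forall>m\<ge>N. nsq L (\<lambda>s. f n s - f m s) < e" "e > 0" for n e N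
  proof -
    note * = nn[OF that(1)]
    have int: "integrable ?M (\<lambda>s. (cmod (f n s - F s))\<^sup>2)"
      using * by (intro integrableI_bounded) (auto intro: le_less_trans)
    have "ennreal (nsq L (\<lambda>s. f n s - F s)) \<le> ennreal e"
      unfolding nsq_def using * int by (subst nn_integral_eq_integral[symmetric]) auto
    then show ?thesis using int that(2) by (simp add: L2_def)
  qed
  obtain N where "\<forall>m\<ge>N. nsq L (\<lambda>s. f N s - f m s) < 1"
    using Cauchy[of 1] by auto
  then have F: "F \<in> L2 L"
    using L2_diff[OF f[of N] conjunct1[OF key[of N N 1]]] by simp
  have "(\<lambda>n. nsq L (\<lambda>s. f n s - F s)) \<longlonglongrightarrow> 0"
  proof (rule LIMSEQ_I)
    fix e :: real assume "e > 0"
    then obtain N where N: "\<forall>m\<ge>N. \<forall>n\<ge>N. nsq L (\<lambda>s. f m s - f n s) < e / 2"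
      using Cauchy[of "e / 2"] by auto
    have "nsq L (\<lambda>s. f n s - F s) \<le> e / 2" if "n \<ge> N" for n
      using key[of N n "e / 2"] N that \<open>e > 0\<close> by auto
    then show "\<exists>N. \<forall>n\<ge>N. norm (nsq L (\<lambda>s. f n s - F s) - 0) < e"
      using \<open>e > 0\<close> by (intro exI[of _ N]) fastforce
  qed
  then show ?thesis using that F by (simp add: L2_tendsto_iff)
qed

section \<open>Smooth functions and the form domain\<close>

text \<open>Nontriviality of this filter, also at the end points of an arc, is what makes the
  derivative within the domain unique.\<close>

lemma at_within_curve_dom:
  assumes "L > 0" "t \<in> curve_dom K L"
  shows "at t within curve_dom K L \<noteq> bot"
proof (cases K)
  case Arc
  then have "t islimpt {0..L}" using assms by (simp add: curve_dom_def islimpt_Icc)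
  then show ?thesis using Arc by (simp add: curve_dom_def trivial_limit_within)
qed (simp add: curve_dom_def)

lemma Icc_subset_curve_dom: "{0..L} \<subseteq> curve_dom K L"
  by (cases K) (auto simp: curve_dom_def)

text \<open>\<open>D k\<close> is the \<open>k\<close>-th derivative of \<open>D 0\<close>.\<close>

definition jet :: "curve_type \<Rightarrow> real \<Rightarrow> (nat \<Rightarrow> real \<Rightarrow> 'a::real_normed_vector) \<Rightarrow> bool" where
  "jet K L D \<longleftrightarrow>
     (\<forall>k. \<forall>t\<in>curve_dom K L. (D k has_vector_derivative D (Suc k) t) (at t within curve_dom K L)) \<and>
     (K = Closed_Curve \<longrightarrow> (\<forall>k s. D k (s + L) = D k s))"

lemma jet_deriv:
  "jet K L D \<Longrightarrow> t \<in> curve_dom K L \<Longrightarrow>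
    (D k has_vector_derivative D (Suc k) t) (at t within curve_dom K L)"
  by (simp add: jet_def)

lemma jet_continuous: "jet K L D \<Longrightarrow> continuous_on {0..L} (D k)"
  using Icc_subset_curve_dom[of L K]
  by (meson continuous_on_eq_continuous_within continuous_on_subset has_vector_derivative_continuous
      jet_deriv)

lemma periodic_derivative:
  fixes f :: "real \<Rightarrow> 'a::real_normed_vector"
  assumes "\<And>s. f (s + L) = f s" "\<And>s. (f has_vector_derivative f' s) (at s)"
  shows "f' (s + L) = f' s"
proof -
  have "((f \<circ> (\<lambda>s. s + L)) has_vector_derivative 1 *\<^sub>R f' (s + L)) (at s)"
    by (rule vector_diff_chain_at) (auto intro!: derivative_eq_intros assms(2))
  moreover have "f \<circ> (\<lambda>s. s + L) = f" using assms(1) by auto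
  ultimately show ?thesis
    using vector_derivative_unique_at[OF assms(2)] by auto
qed

text \<open>Periodicity passes from a function to its derivative, so it has to be checked for
  \<open>D 0\<close> only.\<close>

lemma jetI:
  assumes "\<And>k t. t \<in> curve_dom K L \<Longrightarrow>
      (D k has_vector_derivative D (Suc k) t) (at t within curve_dom K L)"
    and "\<And>s. K = Closed_Curve \<Longrightarrow> D 0 (s + L) = D 0 s"
  shows "jet K L D"
proof -
  have "D k (s + L) = D k s" if "K = Closed_Curve" for k s
  proof (induction k arbitrary: s)
    case (Suc k)
    show ?case
      by (rule periodic_derivative[of "D k"]) (use that Suc assms(1) in \<open>auto simp: curve_dom_def\<close>)
  qed (simp add: assms(2) that)
  then show ?thesis using assms by (auto simp: jet_def)
qed

text \<open>A function is smooth if it belongs to a set that contains a derivative of each of its members;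
  with finite sums of products this gives the smoothness of a product without the Leibniz formula.\<close>

inductive_set sums_of :: "(real \<Rightarrow> 'a::real_normed_vector) set \<Rightarrow> (real \<Rightarrow> 'a) set"
  for A where
  base: "p \<in> A \<Longrightarrow> p \<in> sums_of A"
| add: "p \<in> sums_of A \<Longrightarrow> q \<in> sums_of A \<Longrightarrow> (\<lambda>s. p s + q s) \<in> sums_of A"

lemma smooth_on_sums_of:
  assumes A: "\<And>p. p \<in> A \<Longrightarrow> \<exists>q\<in>sums_of A. \<forall>t\<in>S. (p has_vector_derivative q t) (at t within S)"
    and "f \<in> A"
  shows "smooth_on S f"
proof -
  have *: "\<exists>q\<in>sums_of A. \<forall>t\<in>S. (p has_vector_derivative q t) (at t within S)"
    if "p \<in> sums_of A" for p
    using that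
  proof induction
    case (add p q)
    then obtain p' q' where "p' \<in> sums_of A" "\<forall>t\<in>S. (p has_vector_derivative p' t) (at t within S)"
      "q' \<in> sums_of A" "\<forall>t\<in>S. (q has_vector_derivative q' t) (at t within S)"
      by auto
    then show ?case
      by (intro bexI[of _ "\<lambda>s. p' s + q' s"])
        (auto intro!: has_vector_derivative_add sums_of.add)
  qed (rule A)
  \<comment> \<open>A choice of derivatives that stays inside \<open>sums_of A\<close>; its iterates
    form the sequence that \<open>smooth_on\<close> asks for.\<close>
  then obtain d where d: "\<And>p. p \<in> sums_of A \<Longrightarrow> d p \<in> sums_of A"
    "\<And>p t. p \<in> sums_of A \<Longrightarrow> t \<in> S \<Longrightarrow> (p has_vector_derivative d p t) (at t within S)"
    by metis
  have mem: "(d ^^ k) f \<in> sums_of A" for k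
    by (induction k) (auto intro: d sums_of.base assms(2))
  show ?thesis
    unfolding smooth_on_def by (rule exI[of _ "\<lambda>k. (d ^^ k) f"]) (auto intro: d(2)[OF mem])
qed

abbreviation (input) dt :: "(real \<Rightarrow> 'a::real_normed_vector) \<Rightarrow> real \<Rightarrow> 'a" where
  "dt f \<equiv> (\<lambda>s. vector_derivative f (at s))"

lemma smooth_on_UNIV_jet:
  assumes "smooth_on UNIV f"
  obtains D where "D 0 = f" "D 1 = dt f" "\<And>k t. (D k has_vector_derivative D (Suc k) t) (at t)"
proof -
  obtain D where D: "D 0 = f" "\<And>k t. (D k has_vector_derivative D (Suc k) t) (at t)"
    using assms by (auto simp: smooth_on_def)
  moreover have "D 1 = dt f"
    using D(2)[of 0] by (auto simp: D(1) fun_eq_iff intro!: vector_derivative_at[symmetric])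
  ultimately show ?thesis using that by blast
qed

lemma smooth_on_UNIV_deriv:
  "smooth_on UNIV f \<Longrightarrow> (f has_vector_derivative dt f t) (at t)"
  by (metis smooth_on_UNIV_jet One_nat_def)

lemma smooth_on_UNIV_dt: "smooth_on UNIV f \<Longrightarrow> smooth_on UNIV (dt f)"
proof (elim smooth_on_UNIV_jet)
  fix D assume "D 1 = dt f" "\<And>k t. (D k has_vector_derivative D (Suc k) t) (at t)"
  then show "smooth_on UNIV (dt f)"
    unfolding smooth_on_def by (intro exI[of _ "\<lambda>k. D (Suc k)"]) auto
qed

lemma smooth_on_add: "smooth_on S f \<Longrightarrow> smooth_on S g \<Longrightarrow> smooth_on S (\<lambda>s. f s + g s)"
  unfolding smooth_on_def
proof (elim exE conjE)
  fix D E assume "D 0 = f" "\<forall>k. \<forall>t\<in>S. (D k has_vector_derivative D (Suc k) t) (at t within S)"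
    "E 0 = g" "\<forall>k. \<forall>t\<in>S. (E k has_vector_derivative E (Suc k) t) (at t within S)"
  then show "\<exists>D. D 0 = (\<lambda>s. f s + g s) \<and>
      (\<forall>k. \<forall>t\<in>S. (D k has_vector_derivative D (Suc k) t) (at t within S))"
    by (intro exI[of _ "\<lambda>k s. D k s + E k s"]) (auto intro!: has_vector_derivative_add)
qed

lemma smooth_on_cmult:
  fixes f :: "real \<Rightarrow> complex"
  shows "smooth_on S f \<Longrightarrow> smooth_on S (\<lambda>s. c * f s)"
  unfolding smooth_on_def
proof (elim exE conjE)
  fix D assume "D 0 = f" "\<forall>k. \<forall>t\<in>S. (D k has_vector_derivative D (Suc k) t) (at t within S)"
  then show "\<exists>D. D 0 = (\<lambda>s. c * f s) \<and>
      (\<forall>k. \<forall>t\<in>S. (D k has_vector_derivative D (Suc k) t) (at t within S))"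
    by (intro exI[of _ "\<lambda>k s. c * D k s"])
      (auto intro!: has_vector_derivative_mult_right)
qed

section \<open>Test functions\<close>

lemma test_smooth: "\<phi> \<in> test_functions K L \<Longrightarrow> smooth_on UNIV \<phi>"
  by (simp add: test_functions_def)

lemma test_deriv: "\<phi> \<in> test_functions K L \<Longrightarrow> (\<phi> has_vector_derivative dt \<phi> t) (at t)"
  by (intro smooth_on_UNIV_deriv test_smooth)

text \<open>The form in which both kinds of boundary condition enter integration by parts: the end
  values agree, by periodicity or because both are 0.\<close>

lemma test_boundary:
  assumes "\<phi> \<in> test_functions K L"
  shows "\<phi> L = \<phi> 0"
proof (cases K)
  case Closed_Curve
  then have "\<forall>s. \<phi> (s + L) = \<phi> s" using assms by (simp add: test_functions_def)
  from this[rule_format, of 0] show ?thesis by simp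
qed (use assms in \<open>auto simp: test_functions_def\<close>)

lemma zero_outside_derivative:
  fixes f :: "real \<Rightarrow> 'a::real_normed_vector"
  assumes "\<And>s. s \<notin> {a..b} \<Longrightarrow> f s = 0" "s \<notin> {a..b}"
  shows "(f has_vector_derivative 0) (at s)"
proof (rule has_vector_derivative_transform_within_open[OF _ _ assms(2)[folded Compl_iff]])
  show "((\<lambda>s. 0) has_vector_derivative 0) (at s)" by simp
  show "open (- {a..b})" by (intro open_Compl) auto
qed (use assms in auto)

lemma test_dt:
  assumes "\<phi> \<in> test_functions K L"
  shows "dt \<phi> \<in> test_functions K L"
proof (cases K)
  case Closed_Curve
  then have per: "\<phi> (s + L) = \<phi> s" for s
    using assms by (simp add: test_functions_def)
  have "dt \<phi> (s + L) = dt \<phi> s" for s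
    by (rule periodic_derivative[of \<phi>, OF per test_deriv[OF assms]])
  then show ?thesis
    using smooth_on_UNIV_dt[OF test_smooth[OF assms]] Closed_Curve
    by (simp add: test_functions_def)
next
  case Arc
  then obtain a b where ab: "0 < a" "b < L" "\<And>s. s \<notin> {a..b} \<Longrightarrow> \<phi> s = 0"
    using assms by (auto simp: test_functions_def)
  have "dt \<phi> s = 0" if "s \<notin> {a..b}" for s
    by (rule vector_derivative_at, rule zero_outside_derivative[OF ab(3) that])
  then have "\<exists>a b. 0 < a \<and> b < L \<and> (\<forall>s. s \<notin> {a..b} \<longrightarrow> dt \<phi> s = 0)"
    using ab(1,2) by (intro exI[of _ a] exI[of _ b]) simp
  then show ?thesis
    using smooth_on_UNIV_dt[OF test_smooth[OF assms]]
    unfolding test_functions_def mem_Collect_eq Arc curve_type.case by (rule conjI[rotated])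
qed

lemma test_continuous: "\<phi> \<in> test_functions K L \<Longrightarrow> continuous_on S \<phi>"
  by (intro continuous_at_imp_continuous_on ballI has_vector_derivative_continuous[OF test_deriv])

lemma test_L2: "\<phi> \<in> test_functions K L \<Longrightarrow> \<phi> \<in> L2 L"
  by (intro L2_continuous test_continuous)

lemma test_add:
  assumes "\<phi> \<in> test_functions K L" "\<psi> \<in> test_functions K L"
  shows "(\<lambda>s. \<phi> s + \<psi> s) \<in> test_functions K L"
proof (cases K)
  case Arc
  then obtain a b where ab: "0 < a" "b < L" "\<And>s. s \<notin> {a..b} \<Longrightarrow> \<phi> s = 0"
    using assms(1) by (auto simp: test_functions_def)
  from Arc obtain a' b' where ab': "0 < a'" "b' < L" "\<And>s. s \<notin> {a'..b'} \<Longrightarrow> \<psi> s = 0"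
    using assms(2) by (auto simp: test_functions_def)
  have "0 < min a a'" "max b b' < L" using ab(1,2) ab'(1,2) by auto
  moreover have "\<phi> s + \<psi> s = 0" if "s \<notin> {min a a'..max b b'}" for s
    using ab(3)[of s] ab'(3)[of s] that by (auto simp: not_le)
  ultimately have "\<exists>a b. 0 < a \<and> b < L \<and> (\<forall>s. s \<notin> {a..b} \<longrightarrow> \<phi> s + \<psi> s = 0)"
    by (intro exI[of _ "min a a'"] exI[of _ "max b b'"]) simp
  then show ?thesis
    using smooth_on_add[OF test_smooth[OF assms(1)] test_smooth[OF assms(2)]]
    unfolding test_functions_def mem_Collect_eq Arc curve_type.case by (rule conjI[rotated])
qed (use assms in \<open>simp add: test_functions_def smooth_on_add\<close>)

lemma test_cmult: "\<phi> \<in> test_functions K L \<Longrightarrow> (\<lambda>s. c * \<phi> s) \<in> test_functions K L"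
  unfolding test_functions_def
  by (cases K) (simp_all add: smooth_on_cmult, metis mult_zero_right)

lemma product_derivative_outside:
  assumes "\<And>s. s \<notin> {a..b} \<Longrightarrow> \<phi> s = 0" "t \<notin> {a..b}"
  shows "((\<lambda>s. complex_of_real (G s) * \<phi> s) has_vector_derivative 0) (at t)"
  by (rule zero_outside_derivative[OF _ assms(2)]) (simp add: assms(1))

lemma of_real_deriv:
  "(f has_vector_derivative f') F \<Longrightarrow>
    ((\<lambda>s. complex_of_real (f s)) has_vector_derivative of_real f') F"
  by (rule bounded_linear.has_vector_derivative[OF bounded_linear_of_real])

text \<open>On an arc, \<open>G k\<close> has one-sided derivatives at the end points and arbitrary
  values outside \<open>{0..L}\<close>. The product is still differentiable on the whole line: the
  support of \<open>\<phi>\<close> lies in the interior, where the derivative of \<open>G k\<close>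
  is two-sided, and off the support the product is locally 0.\<close>

lemma test_mult_deriv:
  assumes G: "jet K L G" and \<phi>: "\<phi> \<in> test_functions K L"
  shows "((\<lambda>s. of_real (G k s) * \<phi> s) has_vector_derivative
            of_real (G (Suc k) t) * \<phi> t + of_real (G k t) * dt \<phi> t) (at t)"
proof (cases K)
  case Closed_Curve
  then have "(G k has_vector_derivative G (Suc k) t) (at t)"
    using jet_deriv[OF G, of t] by (simp add: curve_dom_def)
  then have "((\<lambda>s. complex_of_real (G k s)) has_vector_derivative of_real (G (Suc k) t)) (at t)"
    by (rule of_real_deriv)
  from has_vector_derivative_mult[OF this test_deriv[OF \<phi>]] show ?thesis
    by (simp add: add.commute)
next
  case Arc
  then obtain a b where ab: "0 < a" "b < L" "\<And>s. s \<notin> {a..b} \<Longrightarrow> \<phi> s = 0"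
    using \<phi> by (auto simp: test_functions_def)
  show ?thesis
  proof (cases "t \<in> {a..b}")
    case True
    then have t: "t \<in> interior {0..L}" "t \<in> {0..L}" using ab by auto
    have "(G k has_vector_derivative G (Suc k) t) (at t)"
      using jet_deriv[OF G, of t k] t at_within_interior[OF t(1)] Arc
      by (simp add: curve_dom_def)
    then have "((\<lambda>s. complex_of_real (G k s)) has_vector_derivative of_real (G (Suc k) t)) (at t)"
      by (rule of_real_deriv)
    from has_vector_derivative_mult[OF this test_deriv[OF \<phi>]] show ?thesis
      by (simp add: add.commute)
  next
    case False
    then have "dt \<phi> t = 0"
      using zero_outside_derivative[OF ab(3) False] by (auto intro: vector_derivative_at)
    moreover have "((\<lambda>s. complex_of_real (G k s) * \<phi> s) has_vector_derivative 0) (at t)"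
      by (rule product_derivative_outside[OF ab(3) False])
    ultimately show ?thesis using ab(3)[OF False] by (simp only: mult_zero_right add_0_right)
  qed
qed

lemma test_mult:
  assumes G: "jet K L G" and \<phi>: "\<phi> \<in> test_functions K L"
  shows "(\<lambda>s. of_real (G 0 s) * \<phi> s) \<in> test_functions K L"
proof -
  \<comment> \<open>Products of any derivative of \<open>G 0\<close> with any test function: by the
    product rule, a member has a derivative that is the sum of two members.\<close>
  define A where "A = {(\<lambda>s. complex_of_real (G i s) * \<psi> s) | i \<psi>. \<psi> \<in> test_functions K L}"
  have AI: "(\<lambda>s. complex_of_real (G i s) * \<psi> s) \<in> A" if "\<psi> \<in> test_functions K L" for i \<psi>
    using that unfolding A_def by blast
  have "smooth_on UNIV (\<lambda>s. complex_of_real (G 0 s) * \<phi> s)"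
  proof (rule smooth_on_sums_of[of A])
    fix p assume "p \<in> A"
    then obtain i \<psi> where p: "p = (\<lambda>s. complex_of_real (G i s) * \<psi> s)"
      and \<psi>: "\<psi> \<in> test_functions K L" by (auto simp: A_def)
    have "(\<lambda>s. complex_of_real (G (Suc i) s) * \<psi> s) \<in> A" "(\<lambda>s. complex_of_real (G i s) * dt \<psi> s) \<in> A"
      using AI[OF \<psi>] AI[OF test_dt[OF \<psi>]] by auto
    then show "\<exists>q\<in>sums_of A. \<forall>t\<in>UNIV. (p has_vector_derivative q t) (at t within UNIV)"
      using test_mult_deriv[OF G \<psi>, of i] unfolding p
      by (intro bexI[where x="\<lambda>t. complex_of_real (G (Suc i) t) * \<psi> t + complex_of_real (G i t) * dt \<psi> t"]
          sums_of.add sums_of.base) auto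
  qed (use AI[OF \<phi>] in auto)
  moreover have "G 0 (s + L) = G 0 s" if "K = Closed_Curve" for s
    using G that by (simp add: jet_def)
  ultimately show ?thesis
  proof (cases K)
    case Arc
    then obtain a b where "0 < a" "b < L" "\<And>s. s \<notin> {a..b} \<Longrightarrow> \<phi> s = 0"
      using \<phi> by (auto simp: test_functions_def)
    then have "\<exists>a b. 0 < a \<and> b < L \<and> (\<forall>s. s \<notin> {a..b} \<longrightarrow> complex_of_real (G 0 s) * \<phi> s = 0)"
      by (metis mult_zero_right)
    with \<open>smooth_on UNIV _\<close> show ?thesis
      unfolding test_functions_def mem_Collect_eq Arc curve_type.case by (rule conjI)
  qed (use \<phi> in \<open>simp add: test_functions_def\<close>)
qed

section \<open>The form domain as a closure of the test functions\<close>

lemma W01_L2: "W01 K L u du \<Longrightarrow> u \<in> L2 L" "W01 K L u du \<Longrightarrow> du \<in> L2 L"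
  by (auto simp: W01_def)

lemma W01_approx:
  "W01 K L u du \<Longrightarrow> \<exists>\<phi>. (\<forall>n. \<phi> n \<in> test_functions K L) \<and> L2_tendsto L \<phi> u \<and>
      L2_tendsto L (\<lambda>n. dt (\<phi> n)) du"
  by (auto simp: W01_def)

lemma W01I:
  assumes "u \<in> L2 L" "du \<in> L2 L" "\<And>n. \<phi> n \<in> test_functions K L" "L2_tendsto L \<phi> u"
    "L2_tendsto L (\<lambda>n. dt (\<phi> n)) du"
  shows "W01 K L u du"
  using assms by (auto simp: W01_def)

lemma W01_test: "\<phi> \<in> test_functions K L \<Longrightarrow> W01 K L \<phi> (dt \<phi>)"
  by (rule W01I[where \<phi>="\<lambda>_. \<phi>"]) (simp_all add: test_L2 test_L2[OF test_dt] L2_tendsto_def)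

lemma W01_add:
  assumes "W01 K L u du" "W01 K L v dv"
  shows "W01 K L (\<lambda>s. u s + v s) (\<lambda>s. du s + dv s)"
proof -
  obtain \<phi> where \<phi>: "\<And>n. \<phi> n \<in> test_functions K L" "L2_tendsto L \<phi> u" "L2_tendsto L (\<lambda>n. dt (\<phi> n)) du"
    using W01_approx[OF assms(1)] by blast
  obtain \<psi> where \<psi>: "\<And>n. \<psi> n \<in> test_functions K L" "L2_tendsto L \<psi> v" "L2_tendsto L (\<lambda>n. dt (\<psi> n)) dv"
    using W01_approx[OF assms(2)] by blast
  have dt: "dt (\<lambda>s. \<phi> n s + \<psi> n s) = (\<lambda>s. dt (\<phi> n) s + dt (\<psi> n) s)" for n
    by (intro ext vector_derivative_at has_vector_derivative_add test_deriv[OF \<phi>(1)] test_deriv[OF \<psi>(1)])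
  show ?thesis
  proof (rule W01I[where \<phi>="\<lambda>n s. \<phi> n s + \<psi> n s"])
    show "L2_tendsto L (\<lambda>n s. \<phi> n s + \<psi> n s) (\<lambda>s. u s + v s)"
      by (rule L2_tendsto_add[OF \<phi>(2) \<psi>(2)]) (use assms \<phi> \<psi> in \<open>auto intro: W01_L2 test_L2\<close>)
    show "L2_tendsto L (\<lambda>n. dt (\<lambda>s. \<phi> n s + \<psi> n s)) (\<lambda>s. du s + dv s)"
      unfolding dt by (rule L2_tendsto_add[OF \<phi>(3) \<psi>(3)])
        (use assms test_dt[OF \<phi>(1)] test_dt[OF \<psi>(1)] in \<open>auto intro: W01_L2 test_L2\<close>)
  qed (use assms \<phi> \<psi> in \<open>auto intro: W01_L2 test_add\<close>)
qed

lemma W01_cmult: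
  assumes "W01 K L u du"
  shows "W01 K L (\<lambda>s. c * u s) (\<lambda>s. c * du s)"
proof -
  obtain \<phi> where \<phi>: "\<And>n. \<phi> n \<in> test_functions K L" "L2_tendsto L \<phi> u" "L2_tendsto L (\<lambda>n. dt (\<phi> n)) du"
    using W01_approx[OF assms(1)] by blast
  have dt: "dt (\<lambda>s. c * \<phi> n s) = (\<lambda>s. c * dt (\<phi> n) s)" for n
    by (intro ext vector_derivative_at has_vector_derivative_mult_right test_deriv[OF \<phi>(1)])
  show ?thesis
  proof (rule W01I[where \<phi>="\<lambda>n s. c * \<phi> n s"])
    show "L2_tendsto L (\<lambda>n s. c * \<phi> n s) (\<lambda>s. c * u s)"
      by (rule L2_tendsto_cmult[OF \<phi>(2)]) (use assms \<phi> in \<open>auto intro: W01_L2 test_L2\<close>)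
    show "L2_tendsto L (\<lambda>n. dt (\<lambda>s. c * \<phi> n s)) (\<lambda>s. c * du s)"
      unfolding dt by (rule L2_tendsto_cmult[OF \<phi>(3)])
        (use assms test_dt[OF \<phi>(1)] in \<open>auto intro: W01_L2 test_L2\<close>)
  qed (use assms \<phi> in \<open>auto intro: W01_L2 test_cmult\<close>)
qed

lemma W01_diff:
  assumes "W01 K L u du" "W01 K L v dv"
  shows "W01 K L (\<lambda>s. u s - v s) (\<lambda>s. du s - dv s)"
  using W01_add[OF assms(1) W01_cmult[OF assms(2), of "-1"]] by simp

lemma jet_bounded:
  fixes G :: "nat \<Rightarrow> real \<Rightarrow> real"
  assumes "jet K L G"
  shows "\<exists>B. (\<forall>s\<in>{0..L}. cmod (of_real (G k s)) \<le> B) \<and>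
    (\<lambda>s. complex_of_real (G k s)) \<in> borel_measurable (arc_measure L)"
proof -
  have c: "continuous_on {0..L} (\<lambda>s. complex_of_real (G k s))"
    by (intro continuous_on_of_real jet_continuous[OF assms])
  then obtain B where "\<And>s. s \<in> {0..L} \<Longrightarrow> cmod (of_real (G k s)) \<le> B"
    using compact_imp_bounded[OF compact_continuous_image[OF c compact_Icc]]
    unfolding bounded_iff by blast
  moreover have "(\<lambda>s. complex_of_real (G k s)) \<in> borel_measurable (arc_measure L)"
    using c by (rule L2_D[OF L2_continuous])
  ultimately show ?thesis by blast
qed

lemma L2_jet_mult:
  assumes "jet K L G" "f \<in> L2 L"
  shows "(\<lambda>s. complex_of_real (G k s) * f s) \<in> L2 L"
proof -
  obtain B where "\<And>s. s \<in> {0..L} \<Longrightarrow> cmod (of_real (G k s)) \<le> B"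
    "(\<lambda>s. complex_of_real (G k s)) \<in> borel_measurable (arc_measure L)"
    using jet_bounded[OF assms(1), of k] by blast
  then show ?thesis by (intro L2_bounded_mult[OF assms(2)]) auto
qed

lemma L2_tendsto_jet_mult:
  assumes "jet K L G" "L2_tendsto L f F" "\<And>n. f n \<in> L2 L" "F \<in> L2 L"
  shows "L2_tendsto L (\<lambda>n s. complex_of_real (G k s) * f n s) (\<lambda>s. complex_of_real (G k s) * F s)"
proof -
  obtain B where "\<And>s. s \<in> {0..L} \<Longrightarrow> cmod (of_real (G k s)) \<le> B"
    "(\<lambda>s. complex_of_real (G k s)) \<in> borel_measurable (arc_measure L)"
    using jet_bounded[OF assms(1), of k] by blast
  then show ?thesis by (intro L2_tendsto_mult[OF assms(2-4)]) auto
qed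

lemma W01_mult:
  assumes G: "jet K L G" and u: "W01 K L u du"
  shows "W01 K L (\<lambda>s. of_real (G 0 s) * u s) (\<lambda>s. of_real (G 1 s) * u s + of_real (G 0 s) * du s)"
proof -
  obtain \<phi> where \<phi>: "\<And>n. \<phi> n \<in> test_functions K L" "L2_tendsto L \<phi> u" "L2_tendsto L (\<lambda>n. dt (\<phi> n)) du"
    using W01_approx[OF u] by blast
  have dt: "dt (\<lambda>s. of_real (G 0 s) * \<phi> n s) =
      (\<lambda>s. of_real (G 1 s) * \<phi> n s + of_real (G 0 s) * dt (\<phi> n) s)" for n
    unfolding One_nat_def by (intro ext vector_derivative_at test_mult_deriv[OF G \<phi>(1)])
  have L2: "\<phi> n \<in> L2 L" "dt (\<phi> n) \<in> L2 L" "u \<in> L2 L" "du \<in> L2 L" for n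
    using \<phi>(1) u by (auto intro: test_L2 test_dt W01_L2)
  show ?thesis
  proof (rule W01I[where \<phi>="\<lambda>n s. of_real (G 0 s) * \<phi> n s"])
    show "L2_tendsto L (\<lambda>n s. of_real (G 0 s) * \<phi> n s) (\<lambda>s. of_real (G 0 s) * u s)"
      by (rule L2_tendsto_jet_mult[OF G \<phi>(2)]) (use L2 in auto)
    show "L2_tendsto L (\<lambda>n. dt (\<lambda>s. of_real (G 0 s) * \<phi> n s))
        (\<lambda>s. of_real (G 1 s) * u s + of_real (G 0 s) * du s)"
      unfolding dt
      by (intro L2_tendsto_add L2_tendsto_jet_mult[OF G] L2_jet_mult[OF G] \<phi> L2)
  qed (intro L2_add L2_jet_mult[OF G] L2 test_mult[OF G] \<phi>)+
qed

lemma arc_integral_eq: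
  fixes f :: "real \<Rightarrow> complex"
  assumes "integrable (arc_measure L) f" "(f has_integral I) {0..L}"
  shows "(LINT s|arc_measure L. f s) = I"
  using assms by (subst lebesgue_integral_eq_integral) (auto intro: integral_unique)

lemma test_parts:
  assumes \<phi>: "\<phi> \<in> test_functions K L" and \<psi>: "\<psi> \<in> test_functions K L" and L: "0 \<le> L"
  shows "ip L (dt \<phi>) \<psi> = - ip L \<phi> (dt \<psi>)"
proof -
  let ?f = "\<lambda>s. \<phi> s * cnj (dt \<psi> s) + dt \<phi> s * cnj (\<psi> s)"
  note int = ip_integrable[OF test_L2[OF \<phi>] test_L2[OF test_dt[OF \<psi>]]]
    ip_integrable[OF test_L2[OF test_dt[OF \<phi>]] test_L2[OF \<psi>]]
  have "((\<lambda>s. \<phi> s * cnj (\<psi> s)) has_vector_derivative ?f s) (at s within {0..L})" for s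
    using \<phi> \<psi> by (intro has_vector_derivative_mult has_vector_derivative_cnj
        has_vector_derivative_at_within[OF test_deriv])
  then have "(?f has_integral \<phi> L * cnj (\<psi> L) - \<phi> 0 * cnj (\<psi> 0)) {0..L}"
    by (intro fundamental_theorem_of_calculus L)
  then have "(?f has_integral 0) {0..L}"
    using test_boundary[OF \<phi>] test_boundary[OF \<psi>] by simp
  then have "(LINT s|arc_measure L. ?f s) = 0"
    by (intro arc_integral_eq Bochner_Integration.integrable_add int)
  then show ?thesis
    by (simp add: ip_def int add_eq_0_iff)
qed

text \<open>Both sides are continuous under L2 convergence of functions and derivatives, so the
  identity passes from test functions, whose boundary terms cancel, to the closure.\<close>

lemma W01_parts:
  assumes f: "W01 K L f df" and h: "W01 K L h dh" and L: "0 \<le> L"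
  shows "ip L df h = - ip L f dh"
proof -
  obtain \<phi> where \<phi>: "\<And>n. \<phi> n \<in> test_functions K L" "L2_tendsto L \<phi> f" "L2_tendsto L (\<lambda>n. dt (\<phi> n)) df"
    using W01_approx[OF f] by blast
  obtain \<psi> where \<psi>: "\<And>n. \<psi> n \<in> test_functions K L" "L2_tendsto L \<psi> h" "L2_tendsto L (\<lambda>n. dt (\<psi> n)) dh"
    using W01_approx[OF h] by blast
  note L2 = test_L2[OF \<phi>(1)] test_L2[OF \<psi>(1)] test_L2[OF test_dt[OF \<phi>(1)]] test_L2[OF test_dt[OF \<psi>(1)]]
    W01_L2[OF f] W01_L2[OF h]
  have "(\<lambda>n. ip L (dt (\<phi> n)) (\<psi> n)) \<longlonglongrightarrow> ip L df h"
    by (intro L2_tendsto_ip \<phi> \<psi> L2)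
  moreover have "(\<lambda>n. - ip L (\<phi> n) (dt (\<psi> n))) \<longlonglongrightarrow> - ip L f dh"
    by (intro tendsto_minus L2_tendsto_ip \<phi> \<psi> L2)
  ultimately show ?thesis
    by (simp add: test_parts[OF \<phi>(1) \<psi>(1) L] LIMSEQ_unique)
qed

text \<open>The derivative is closable: a derivative \<open>?d\<close> of the zero function is
  orthogonal to all test functions by integration by parts, and the functions
  \<open>dt (\<phi> n)\<close>, which are test functions, converge to it. This matters because
  \<open>schrodinger_graph\<close> only asserts that some derivative exists, while later statements
  name one.\<close>

lemma W01_derivative_unique:
  assumes u: "W01 K L u d1" "W01 K L u d2" and L: "0 \<le> L"
  shows "AE s in arc_measure L. d1 s = d2 s"
proof -
  let ?d = "\<lambda>s. d1 s - d2 s"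
  have W: "W01 K L (\<lambda>s. 0) ?d"
    using W01_diff[OF u] by simp
  obtain \<phi> where \<phi>: "\<And>n. \<phi> n \<in> test_functions K L" "L2_tendsto L (\<lambda>n. dt (\<phi> n)) ?d"
    using W01_approx[OF W] by blast
  have d: "?d \<in> L2 L" using W by (rule W01_L2)
  have "dt (\<phi> n) \<in> L2 L" for n
    by (rule test_L2[OF test_dt[OF \<phi>(1)]])
  then have "(\<lambda>n. ip L ?d (dt (\<phi> n))) \<longlonglongrightarrow> ip L ?d ?d"
    by (intro L2_tendsto_ip \<phi> d) (simp add: L2_tendsto_def)
  moreover have "ip L ?d (dt (\<phi> n)) = 0" for n
    using W01_parts[OF W W01_test[OF test_dt[OF \<phi>(1)]] L, of n] by (simp add: ip_def)
  ultimately have "ip L ?d ?d = 0"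
    by (simp add: LIMSEQ_const_iff)
  then have "nsq L ?d = 0" by (simp add: ip_self)
  then show ?thesis using nsq_eq_0_iff[OF d] by simp
qed

lemma W01_approx_within:
  assumes "W01 K L u du" "e > 0"
  shows "\<exists>\<phi>. \<phi> \<in> test_functions K L \<and> nsq L (\<lambda>s. \<phi> s - u s) < e \<and> nsq L (\<lambda>s. dt \<phi> s - du s) < e"
proof -
  obtain \<phi> where \<phi>: "\<And>n. \<phi> n \<in> test_functions K L" "L2_tendsto L \<phi> u"
    "L2_tendsto L (\<lambda>n. dt (\<phi> n)) du"
    using W01_approx[OF assms(1)] by blast
  have "\<forall>\<^sub>F k in sequentially. nsq L (\<lambda>s. \<phi> k s - u s) < e"
    using \<phi>(2) assms(2) unfolding L2_tendsto_iff by (rule order_tendstoD)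
  moreover have "\<forall>\<^sub>F k in sequentially. nsq L (\<lambda>s. dt (\<phi> k) s - du s) < e"
    using \<phi>(3) assms(2) unfolding L2_tendsto_iff by (rule order_tendstoD)
  ultimately have "\<forall>\<^sub>F k in sequentially. nsq L (\<lambda>s. \<phi> k s - u s) < e \<and>
      nsq L (\<lambda>s. dt (\<phi> k) s - du s) < e"
    by (rule eventually_conj)
  then obtain k where "nsq L (\<lambda>s. \<phi> k s - u s) < e" "nsq L (\<lambda>s. dt (\<phi> k) s - du s) < e"
    by (auto simp: eventually_sequentially)
  then show ?thesis using \<phi>(1) by blast
qed

lemma W01_approx_seq:
  assumes "\<And>n. W01 K L (u n) (du n)"
  shows "\<exists>\<phi>. \<forall>n. \<phi> n \<in> test_functions K L \<and> nsq L (\<lambda>s. \<phi> n s - u n s) < 1 / Suc n \<and>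
      nsq L (\<lambda>s. dt (\<phi> n) s - du n s) < 1 / Suc n"
  by (intro choice allI W01_approx_within assms) simp

lemma L2_tendsto_close:
  assumes "\<And>n. nsq L (\<lambda>s. f n s - g n s) < 1 / Suc n" "L2_tendsto L g F"
    "\<And>n. f n \<in> L2 L" "\<And>n. g n \<in> L2 L" "F \<in> L2 L"
  shows "L2_tendsto L f F"
  unfolding L2_tendsto_iff
proof (rule Lim_null_comparison)
  have "nsq L (\<lambda>s. f n s - F s) \<le> 2 * (1 / Suc n) + 2 * nsq L (\<lambda>s. g n s - F s)" for n
    using nsq_triangle[OF assms(3,4,5), of n n] assms(1)[of n] by linarith
  then show "\<forall>\<^sub>F n in sequentially. norm (nsq L (\<lambda>s. f n s - F s)) \<le>
      2 * (1 / Suc n) + 2 * nsq L (\<lambda>s. g n s - F s)" by simp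
  have "(\<lambda>n. 2 * (1 / Suc n) + 2 * nsq L (\<lambda>s. g n s - F s)) \<longlonglongrightarrow> 2 * 0 + 2 * 0"
    by (intro tendsto_intros LIMSEQ_Suc[OF lim_1_over_n]) (use assms(2) in \<open>simp add: L2_tendsto_iff\<close>)
  then show "(\<lambda>n. 2 * (1 / Suc n) + 2 * nsq L (\<lambda>s. g n s - F s)) \<longlonglongrightarrow> 0" by simp
qed

text \<open>A diagonal argument: each \<open>u n\<close> is replaced by a test function that is
  within \<open>1 / Suc n\<close> of it, together with the derivative.\<close>

lemma W01_closed:
  assumes W: "\<And>n. W01 K L (u n) (du n)" and u: "L2_tendsto L u U" "U \<in> L2 L"
    and du: "L2_tendsto L du dU" "dU \<in> L2 L"
  shows "W01 K L U dU"
proof -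
  obtain \<phi> where \<phi>: "\<And>n. \<phi> n \<in> test_functions K L" "\<And>n. nsq L (\<lambda>s. \<phi> n s - u n s) < 1 / Suc n"
      "\<And>n. nsq L (\<lambda>s. dt (\<phi> n) s - du n s) < 1 / Suc n"
    using W01_approx_seq[of K L u du, OF W] by blast
  show ?thesis
  proof (rule W01I[of _ _ _ \<phi>])
    show "L2_tendsto L \<phi> U"
      by (rule L2_tendsto_close[OF \<phi>(2) u(1)]) (use \<phi>(1) W u in \<open>auto intro: test_L2 W01_L2\<close>)
    show "L2_tendsto L (\<lambda>n. dt (\<phi> n)) dU"
      by (rule L2_tendsto_close[OF \<phi>(3) du(1)]) (use \<phi>(1) W du in \<open>auto intro: test_L2 test_dt W01_L2\<close>)
  qed (use u du \<phi> in auto)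
qed

section \<open>Pointwise estimates and the compact embedding into L2\<close>

text \<open>Cauchy-Schwarz for the integral of \<open>dt \<phi>\<close> against the indicator
  function of the interval between the two points.\<close>

lemma test_Hoelder:
  assumes \<phi>: "\<phi> \<in> test_functions K L" and xy: "x \<in> {0..L}" "y \<in> {0..L}"
  shows "(cmod (\<phi> x - \<phi> y))\<^sup>2 \<le> nsq L (dt \<phi>) * \<bar>x - y\<bar>"
  using xy
proof (induction x y rule: linorder_wlog)
  case (sym a b)
  then show ?case by (simp add: norm_minus_commute abs_minus_commute)
next
  case (le a b)
  let ?i = "\<lambda>s. of_real (indicator {a..b} s) :: complex"
  have i: "?i \<in> L2 L"
  proof -
    have m [measurable]: "?i \<in> borel_measurable (arc_measure L)"
      by (intro measurable_restrict_space1 measurable_compose[OF _ borel_measurable_of_real]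
          borel_measurable_indicator) auto
    have "(\<lambda>s. (cmod (?i s))\<^sup>2) \<in> borel_measurable (arc_measure L)" by measurable
    then have "integrable (arc_measure L) (\<lambda>s. (cmod (?i s))\<^sup>2)"
      by (rule integrable_bounded_arc[where B=1]) (simp split: split_indicator)
    then show ?thesis using m by (simp add: L2_def)
  qed
  note d = test_L2[OF test_dt[OF \<phi>]]
  have "(dt \<phi> has_integral \<phi> b - \<phi> a) {a..b}"
    by (intro fundamental_theorem_of_calculus has_vector_derivative_at_within[OF test_deriv[OF \<phi>]] le)
  then have "((\<lambda>s. if s \<in> {a..b} then dt \<phi> s else 0) has_integral \<phi> b - \<phi> a) {0..L}"
    using le by (subst has_integral_restrict) auto
  moreover have "(\<lambda>s. if s \<in> {a..b} then dt \<phi> s else 0) = (\<lambda>s. dt \<phi> s * cnj (?i s))"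
    by (auto simp: indicator_def)
  ultimately have "((\<lambda>s. dt \<phi> s * cnj (?i s)) has_integral \<phi> b - \<phi> a) {0..L}" by simp
  then have "ip L (dt \<phi>) ?i = \<phi> b - \<phi> a"
    unfolding ip_def by (intro arc_integral_eq ip_integrable d i)
  moreover have "nsq L ?i = b - a"
  proof -
    have "nsq L ?i = (LINT s|arc_measure L. indicator {a..b} s)"
      unfolding nsq_def by (intro Bochner_Integration.integral_cong) (auto simp: indicator_def)
    also have "\<dots> = measure (arc_measure L) {a..b}"
      using le by (simp add: Bochner_Integration.integral_indicator space_restrict_space Int_absorb2)
    also have "\<dots> = b - a"
      using le by (subst measure_restrict_space) auto
    finally show ?thesis .
  qed
  ultimately show ?case
    using ip_Cauchy_Schwarz[OF d i] le by (simp add: norm_minus_commute)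
qed

text \<open>The Hoelder bound compares \<open>\<phi> x\<close> with \<open>\<phi> y\<close>, and
  averaging over \<open>y\<close> brings in the L2 norm. An average replaces a zero of
  \<open>\<phi>\<close>, since a function on a closed curve need not vanish anywhere.\<close>

lemma test_sup_bound:
  assumes \<phi>: "\<phi> \<in> test_functions K L" and x: "x \<in> {0..L}" and L: "0 < L"
  shows "(cmod (\<phi> x))\<^sup>2 \<le> 2 / L * nsq L \<phi> + 2 * L * nsq L (dt \<phi>)"
proof -
  interpret finite_measure "arc_measure L" by (rule finite_measure_arc)
  have *: "(cmod (\<phi> x))\<^sup>2 - 2 * L * nsq L (dt \<phi>) \<le> 2 * (cmod (\<phi> y))\<^sup>2" if y: "y \<in> {0..L}" for y
  proof -
    have "(cmod (\<phi> x - \<phi> y))\<^sup>2 \<le> nsq L (dt \<phi>) * L"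
      using x y by (intro order.trans[OF test_Hoelder[OF \<phi> x y]] mult_left_mono) auto
    moreover have "cmod (\<phi> x) \<le> cmod (\<phi> y) + cmod (\<phi> x - \<phi> y)"
      using norm_triangle_ineq[of "\<phi> y" "\<phi> x - \<phi> y"] by simp
    then have "(cmod (\<phi> x))\<^sup>2 \<le> (cmod (\<phi> y) + cmod (\<phi> x - \<phi> y))\<^sup>2" by (intro power_mono) auto
    then have "(cmod (\<phi> x))\<^sup>2 \<le> 2 * (cmod (\<phi> y))\<^sup>2 + 2 * (cmod (\<phi> x - \<phi> y))\<^sup>2"
      using sum_squares_bound[of "cmod (\<phi> y)" "cmod (\<phi> x - \<phi> y)"] by (simp add: power2_sum)
    ultimately show ?thesis by (simp add: mult_ac)
  qed
  have "(LINT y|arc_measure L. (cmod (\<phi> x))\<^sup>2 - 2 * L * nsq L (dt \<phi>))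
      \<le> (LINT y|arc_measure L. 2 * (cmod (\<phi> y))\<^sup>2)"
    using L2_D[OF test_L2[OF \<phi>]] * by (intro integral_mono) auto
  then have "L * ((cmod (\<phi> x))\<^sup>2 - 2 * L * nsq L (dt \<phi>)) \<le> 2 * nsq L \<phi>"
    using L by (simp add: nsq_def measure_restrict_space)
  then show ?thesis using L by (simp add: field_simps)
qed

lemma L2_tendsto_uniform:
  assumes "\<And>n. f n \<in> L2 L" "g \<in> L2 L" "0 < L"
    and unif: "\<And>e. 0 < e \<Longrightarrow> \<exists>N. \<forall>n x. n \<ge> N \<and> x \<in> {0..L} \<longrightarrow> cmod (f n x - g x) < e"
  shows "L2_tendsto L f g"
  unfolding L2_tendsto_iff
proof (rule LIMSEQ_I)
  interpret finite_measure "arc_measure L" by (rule finite_measure_arc)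
  fix e :: real assume e: "0 < e"
  define d where "d = sqrt (e / (2 * L))"
  have d: "d > 0" "d\<^sup>2 * L = e / 2" using e \<open>0 < L\<close> by (auto simp: d_def)
  obtain N where N: "\<And>n x. n \<ge> N \<Longrightarrow> x \<in> {0..L} \<Longrightarrow> cmod (f n x - g x) < d"
    using unif[OF d(1)] by blast
  have "nsq L (\<lambda>s. f n s - g s) < e" if "n \<ge> N" for n
  proof -
    have "nsq L (\<lambda>s. f n s - g s) \<le> (LINT s|arc_measure L. d\<^sup>2)"
      unfolding nsq_def
    proof (rule integral_mono)
      show "integrable (arc_measure L) (\<lambda>s. (cmod (f n s - g s))\<^sup>2)"
        by (rule L2_D[OF L2_diff[OF assms(1,2)]])
      show "(cmod (f n s - g s))\<^sup>2 \<le> d\<^sup>2" if "s \<in> space (arc_measure L)" for s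
        using N[OF \<open>n \<ge> N\<close>, of s] that by (intro power_mono) auto
    qed simp
    also have "\<dots> = d\<^sup>2 * L" using \<open>0 < L\<close> by (simp add: measure_restrict_space)
    finally show ?thesis using d(2) e by linarith
  qed
  then show "\<exists>N. \<forall>n\<ge>N. norm (nsq L (\<lambda>s. f n s - g s) - 0) < e" by auto
qed

text \<open>Rellich's theorem in one dimension. Elements of \<open>W01\<close> are determined only
  almost everywhere, so Arzela-Ascoli is applied to nearby test functions: they are uniformly
  bounded by \<open>test_sup_bound\<close> and equicontinuous by \<open>test_Hoelder\<close>, and
  the approximation error tends to 0.\<close>

lemma W01_compact:
  assumes W: "\<And>n::nat. W01 K L (u n) (du n)" and C: "\<And>n. nsq L (u n) \<le> C" "\<And>n. nsq L (du n) \<le> C"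
    and L: "0 < L"
  shows "\<exists>r U. strict_mono r \<and> U \<in> L2 L \<and> L2_tendsto L (\<lambda>n. u (r n)) U"
proof -
  obtain \<phi> where \<phi>: "\<And>n. \<phi> n \<in> test_functions K L" "\<And>n. nsq L (\<lambda>s. \<phi> n s - u n s) < 1 / Suc n"
      "\<And>n. nsq L (\<lambda>s. dt (\<phi> n) s - du n s) < 1 / Suc n"
    using W01_approx_seq[of K L u du, OF W] by blast
  \<comment> \<open>From \<open>nsq_add_le\<close>, with an approximation error of at most 1 and
    norms of at most \<open>C\<close>.\<close>
  define E where "E = 2 + 2 * C"
  have bound: "nsq L f \<le> E" if "nsq L (\<lambda>s. f s - g s) < 1 / Suc n" "nsq L g \<le> C" "f \<in> L2 L" "g \<in> L2 L"
    for f g and n :: nat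
  proof -
    have "1 / real (Suc n) \<le> 1" by simp
    moreover have "nsq L f \<le> 2 * nsq L (\<lambda>s. f s - g s) + 2 * nsq L g"
      using nsq_add_le[of "\<lambda>s. f s - g s" L g] that by simp
    ultimately show ?thesis using that(1,2) unfolding E_def by linarith
  qed
  have L2: "u n \<in> L2 L" "du n \<in> L2 L" "\<phi> n \<in> L2 L" "dt (\<phi> n) \<in> L2 L" for n
    by (rule W01_L2[OF W] test_L2[OF \<phi>(1)] test_L2[OF test_dt[OF \<phi>(1)]])+
  have E: "nsq L (\<phi> n) \<le> E" "nsq L (dt (\<phi> n)) \<le> E" for n
    using bound[OF \<phi>(2) C(1) L2(3,1)] bound[OF \<phi>(3) C(2) L2(4,2)] by auto
  have "E \<ge> 0" using E(1)[of 0] nsq_nonneg[of L "\<phi> 0"] by linarith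
  define M where "M = sqrt (2 / L * E + 2 * L * E)"
  have M: "cmod (\<phi> n x) \<le> M" if "x \<in> {0..L}" for n x
    unfolding M_def
  proof (rule real_le_rsqrt)
    have "2 / L * nsq L (\<phi> n) + 2 * L * nsq L (dt (\<phi> n)) \<le> 2 / L * E + 2 * L * E"
      using L E by (intro add_mono mult_left_mono) auto
    then show "(cmod (\<phi> n x))\<^sup>2 \<le> 2 / L * E + 2 * L * E"
      using test_sup_bound[OF \<phi>(1) that L, of n] by linarith
  qed
  obtain g k where g: "continuous_on {0..L} g" and k: "strict_mono (k :: nat \<Rightarrow> nat)"
    and unif: "\<And>e. 0 < e \<Longrightarrow> \<exists>N. \<forall>n x. n \<ge> N \<and> x \<in> {0..L} \<longrightarrow> norm (\<phi> (k n) x - g x) < e"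
  proof (rule Arzela_Ascoli[of "{0..L}" \<phi> M])
    fix x e :: real assume x: "x \<in> {0..L}" and e: "0 < e"
    \<comment> \<open>The radius for equicontinuity: it gives \<open>E * d < e^2\<close>, and the 1
      in the denominator covers \<open>E = 0\<close>.\<close>
    define d where "d = e\<^sup>2 / (E + 1)"
    have d: "d > 0" "E * d < e\<^sup>2"
      using e \<open>E \<ge> 0\<close> by (auto simp: d_def field_simps)
    have "cmod (\<phi> n x - \<phi> n y) < e" if "y \<in> {0..L}" "norm (x - y) < d" for n y
    proof (rule power_less_imp_less_base[where n=2])
      have "(cmod (\<phi> n x - \<phi> n y))\<^sup>2 \<le> nsq L (dt (\<phi> n)) * \<bar>x - y\<bar>"
        by (rule test_Hoelder[OF \<phi>(1) x that(1)])
      also have "\<dots> \<le> E * d"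
        using E(2) \<open>E \<ge> 0\<close> that by (intro mult_mono) auto
      finally show "(cmod (\<phi> n x - \<phi> n y))\<^sup>2 < e\<^sup>2" using d by linarith
    qed (use e in simp)
    then show "\<exists>d>0. \<forall>n y. y \<in> {0..L} \<and> norm (x - y) < d \<longrightarrow> norm (\<phi> n x - \<phi> n y) < e"
      using d(1) by blast
  qed (use M in auto)
  have g2: "g \<in> L2 L" by (rule L2_continuous[OF g])
  have lim: "L2_tendsto L (\<lambda>n. \<phi> (k n)) g"
    by (rule L2_tendsto_uniform[OF L2(3) g2 L unif])
  have "nsq L (\<lambda>s. u (k n) s - \<phi> (k n) s) < 1 / Suc n" for n
  proof -
    have "1 / real (Suc (k n)) \<le> 1 / Suc n"
      using seq_suble[OF k, of n] by (intro divide_left_mono) auto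
    then show ?thesis
      using \<phi>(2)[of "k n"] nsq_minus_commute[of L "u (k n)" "\<phi> (k n)"] by linarith
  qed
  then have "L2_tendsto L (\<lambda>n. u (k n)) g"
    by (rule L2_tendsto_close[OF _ lim L2(1,3) g2])
  then show ?thesis using k g2 by blast
qed

section \<open>The variational principle for the second eigenvalue\<close>

locale schroedinger =
  fixes K :: curve_type and L :: real and V :: "real \<Rightarrow> real" and B :: real
  assumes L: "0 < L" and V_measurable: "V \<in> borel_measurable (arc_measure L)"
    and V_bound: "\<And>s. s \<in> {0..L} \<Longrightarrow> \<bar>V s\<bar> \<le> B"
begin

definition Vm :: "(real \<Rightarrow> complex) \<Rightarrow> real \<Rightarrow> complex" where
  "Vm f s = complex_of_real (V s) * f s"

text \<open>Derivatives are separate arguments because an element of \<open>W01\<close> comes with a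
  chosen representative of its derivative.\<close>

definition form :: "(real \<Rightarrow> complex) \<Rightarrow> (real \<Rightarrow> complex) \<Rightarrow> (real \<Rightarrow> complex) \<Rightarrow> (real \<Rightarrow> complex) \<Rightarrow> complex" where
  "form f df h dh = ip L df dh + ip L (Vm f) h"

definition energy :: "(real \<Rightarrow> complex) \<Rightarrow> (real \<Rightarrow> complex) \<Rightarrow> real" where
  "energy f df = Re (form f df f df)"

lemma B_nonneg: "0 \<le> B"
  using V_bound[of 0] L by auto

lemma V_measurable': "(\<lambda>s. complex_of_real (V s)) \<in> borel_measurable (arc_measure L)"
  using V_measurable by measurable

lemma V_bound': "s \<in> {0..L} \<Longrightarrow> cmod (complex_of_real (V s)) \<le> B"
  using V_bound by simp

lemma Vm_L2 [simp]: "f \<in> L2 L \<Longrightarrow> Vm f \<in> L2 L"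
  unfolding Vm_def by (rule L2_bounded_mult[OF _ V_measurable' V_bound'])

lemma Vm_add: "Vm (\<lambda>s. f s + g s) = (\<lambda>s. Vm f s + Vm g s)"
  by (auto simp: Vm_def algebra_simps)

lemma Vm_cmult: "Vm (\<lambda>s. c * f s) = (\<lambda>s. c * Vm f s)"
  by (auto simp: Vm_def algebra_simps)

lemma ip_Vm: "ip L (Vm f) g = ip L f (Vm g)"
  by (simp add: ip_def Vm_def mult_ac)

lemma Vm_tendsto:
  "L2_tendsto L f F \<Longrightarrow> (\<And>n. f n \<in> L2 L) \<Longrightarrow> F \<in> L2 L \<Longrightarrow> L2_tendsto L (\<lambda>n. Vm (f n)) (Vm F)"
  unfolding Vm_def by (rule L2_tendsto_mult[OF _ _ _ V_measurable' V_bound'])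

lemma form_sym: "form h dh f df = cnj (form f df h dh)"
proof -
  have "ip L (Vm h) f = cnj (ip L (Vm f) h)"
    unfolding ip_Vm[of h] by (rule ip_cnj)
  then show ?thesis
    unfolding form_def complex_cnj_add by (metis ip_cnj)
qed

lemma form_eq:
  assumes "W01 K L f df" "W01 K L h dh"
  shows "form f df h dh = (LINT s|arc_measure L.
      df s * cnj (dh s) + complex_of_real (V s) * f s * cnj (h s))"
  using ip_integrable[OF W01_L2(2)[OF assms(1)] W01_L2(2)[OF assms(2)]]
    ip_integrable[OF Vm_L2[OF W01_L2(1)[OF assms(1)]] W01_L2(1)[OF assms(2)]]
  unfolding form_def ip_def Vm_def by simp

lemma eigenspace_iff:
  "u \<in> eigenspace K L V \<mu> \<longleftrightarrow>
    (\<exists>du. W01 K L u du \<and> (\<forall>v dv. W01 K L v dv \<longrightarrow> form u du v dv = \<mu> * ip L u v))"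
proof -
  have "(LINT s|arc_measure L. complex_of_real \<mu> * u s * cnj (v s)) = \<mu> * ip L u v" for v
    by (simp add: ip_def mult.assoc)
  then show ?thesis
    unfolding eigenspace_def schrodinger_graph_def mem_Collect_eq
    by (auto simp: form_eq dest: W01_L2)
qed

lemma form_add_left:
  assumes "W01 K L f df" "W01 K L g dg" "W01 K L h dh"
  shows "form (\<lambda>s. f s + g s) (\<lambda>s. df s + dg s) h dh = form f df h dh + form g dg h dh"
  using assms[THEN W01_L2(1)] assms[THEN W01_L2(2)] by (simp add: form_def Vm_add ip_add_left)

lemma form_add_right:
  assumes "W01 K L f df" "W01 K L g dg" "W01 K L h dh"
  shows "form h dh (\<lambda>s. f s + g s) (\<lambda>s. df s + dg s) = form h dh f df + form h dh g dg"
  using assms[THEN W01_L2(1)] assms[THEN W01_L2(2)] by (simp add: form_def ip_add_right)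

lemma form_cmult_left: "form (\<lambda>s. c * f s) (\<lambda>s. c * df s) h dh = c * form f df h dh"
  by (simp add: form_def Vm_cmult distrib_left)

lemma form_cmult_right: "form h dh (\<lambda>s. c * f s) (\<lambda>s. c * df s) = cnj c * form h dh f df"
  by (simp add: form_def distrib_left)

lemma energy_eq: "energy f df = nsq L df + Re (ip L (Vm f) f)"
  by (simp add: energy_def form_def ip_self)

lemma energy_add:
  assumes "W01 K L f df" "W01 K L g dg"
  shows "energy (\<lambda>s. f s + g s) (\<lambda>s. df s + dg s) = energy f df + energy g dg + 2 * Re (form f df g dg)"
proof -
  have W: "W01 K L (\<lambda>s. f s + g s) (\<lambda>s. df s + dg s)" by (rule W01_add[OF assms])
  show ?thesis
    unfolding energy_def form_add_left[OF assms W] form_add_right[OF assms assms(1)]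
      form_add_right[OF assms assms(2)]
    by (simp add: form_sym[of g dg f df])
qed

lemma energy_cmult: "energy (\<lambda>s. c * f s) (\<lambda>s. c * df s) = (cmod c)\<^sup>2 * energy f df"
proof -
  have Re_of_real_mult: "Re (of_real a * z) = a * Re z" for a z by simp
  have "form (\<lambda>s. c * f s) (\<lambda>s. c * df s) (\<lambda>s. c * f s) (\<lambda>s. c * df s) =
      of_real ((cmod c)\<^sup>2) * form f df f df"
    by (simp only: form_cmult_left form_cmult_right complex_norm_square mult.assoc)
  then show ?thesis by (simp only: energy_def Re_of_real_mult)
qed

lemma energy_parallelogram:
  assumes "W01 K L f df" "W01 K L g dg"
  shows "energy (\<lambda>s. f s + g s) (\<lambda>s. df s + dg s) + energy (\<lambda>s. f s - g s) (\<lambda>s. df s - dg s)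
    = 2 * energy f df + 2 * energy g dg"
  using energy_add[OF assms] energy_add[OF assms(1) W01_cmult[OF assms(2), of "-1"]]
    energy_cmult[of "-1" g dg] form_cmult_right[of f df "-1" g dg] by simp

text \<open>By Cauchy-Schwarz the potential contributes at least \<open>- B * nsq L f\<close>. So
  the form is bounded below, and bounds on energy and norm control the derivative, which is the
  coercivity that the direct method requires.\<close>

lemma energy_lower:
  assumes "f \<in> L2 L"
  shows "nsq L df - B * nsq L f \<le> energy f df"
proof -
  have "nsq L (Vm f) \<le> B\<^sup>2 * nsq L f"
    unfolding Vm_def by (rule nsq_bounded_mult_le[OF assms V_measurable' V_bound'])
  then have "sqrt (nsq L (Vm f)) \<le> B * sqrt (nsq L f)"
    using B_nonneg by (metis real_sqrt_le_mono real_sqrt_mult real_sqrt_unique)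
  then have "sqrt (nsq L (Vm f)) * sqrt (nsq L f) \<le> (B * sqrt (nsq L f)) * sqrt (nsq L f)"
    by (intro mult_right_mono) auto
  then have "cmod (ip L (Vm f) f) \<le> B * nsq L f"
    using ip_le[OF Vm_L2[OF assms] assms] by (simp add: mult.assoc)
  then show ?thesis
    using abs_Re_le_cmod[of "ip L (Vm f) f"] unfolding energy_eq by linarith
qed

lemma energy_nonneg_of_null:
  assumes "f \<in> L2 L" "nsq L f = 0"
  shows "0 \<le> energy f df"
  using energy_lower[OF assms(1), of df] assms(2) nsq_nonneg[of L df] by (simp del: nsq_nonneg)

end

context schroedinger
begin

text \<open>The direct method: a minimizing sequence converges in \<open>L\<^sup>2\<close> along a subsequence by compactness,
  and the parallelogram identity for the form makes its derivatives a Cauchy sequence.\<close>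

lemma minimizer_exists:
  assumes u: "u \<in> L2 L" and f0: "W01 K L f0 df0" "ip L f0 u = 0" "nsq L f0 = 1"
  shows "\<exists>F dF. W01 K L F dF \<and> ip L F u = 0 \<and> nsq L F = 1 \<and>
    (\<forall>h dh. W01 K L h dh \<and> ip L h u = 0 \<longrightarrow> energy F dF * nsq L h \<le> energy h dh)"
proof -
  define S where "S = {(f, df). W01 K L f df \<and> ip L f u = 0 \<and> nsq L f = 1}"
  define \<mu> where "\<mu> = (INF p\<in>S. energy (fst p) (snd p))"
  have S0: "(f0, df0) \<in> S" using f0 by (simp add: S_def)
  have low: "nsq L (snd p) - B \<le> energy (fst p) (snd p)" if "p \<in> S" for p
    using that energy_lower[of "fst p" "snd p"] by (auto simp: S_def dest: W01_L2(1))
  have bdd: "bdd_below ((\<lambda>p. energy (fst p) (snd p)) ` S)"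
  proof (rule bdd_belowI2[of _ "- B"])
    fix p assume "p \<in> S"
    then show "- B \<le> energy (fst p) (snd p)" using low[of p] nsq_nonneg[of L "snd p"] by linarith
  qed
  \<comment> \<open>Scaling extends the infimum over normalized functions to every admissible
    \<open>h\<close>; null functions cannot be normalized and are treated apart.\<close>
  have ge: "\<mu> * nsq L h \<le> energy h dh" if h: "W01 K L h dh" "ip L h u = 0" for h dh
  proof (cases "nsq L h = 0")
    case True
    then show ?thesis using energy_nonneg_of_null[OF W01_L2(1)[OF h(1)]] by simp
  next
    case False
    then have pos: "nsq L h > 0" using nsq_nonneg[of L h] by linarith
    define c where "c = complex_of_real (1 / sqrt (nsq L h))"
    have c: "(cmod c)\<^sup>2 = 1 / nsq L h"
      using pos by (simp add: c_def norm_divide power_divide)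
    have "((\<lambda>s. c * h s), (\<lambda>s. c * dh s)) \<in> S"
      using W01_cmult[OF h(1), of c] h(2) c pos by (simp add: S_def)
    from cINF_lower[OF bdd this] have "\<mu> \<le> energy h dh / nsq L h"
      by (simp add: \<mu>_def energy_cmult c)
    then show ?thesis using pos by (simp add: field_simps)
  qed
  have "\<exists>p. p \<in> S \<and> energy (fst p) (snd p) < \<mu> + 1 / Suc n" for n :: nat
  proof -
    have "(INF p\<in>S. energy (fst p) (snd p)) < \<mu> + 1 / Suc n"
      unfolding \<mu>_def[symmetric] by simp
    moreover have "S \<noteq> {}" using S0 by blast
    ultimately have "\<exists>p\<in>S. energy (fst p) (snd p) < \<mu> + 1 / Suc n"
      using bdd by (subst (asm) cINF_less_iff)
    then show ?thesis by blast
  qed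
  then have "\<exists>p. \<forall>n::nat. p n \<in> S \<and> energy (fst (p n)) (snd (p n)) < \<mu> + 1 / Suc n"
    by (intro choice allI)
  then obtain p where p: "\<And>n::nat. p n \<in> S" "\<And>n::nat. energy (fst (p n)) (snd (p n)) < \<mu> + 1 / Suc n"
    by blast
  define f where "f n = fst (p n)" for n
  define df where "df n = snd (p n)" for n
  have f: "W01 K L (f n) (df n)" "ip L (f n) u = 0" "nsq L (f n) = 1" for n
    using p(1)[of n] by (simp_all add: S_def f_def df_def split_beta)
  have fL2: "f n \<in> L2 L" "df n \<in> L2 L" for n
    by (rule W01_L2[OF f(1)])+
  have e_lim: "(\<lambda>n. energy (f n) (df n)) \<longlonglongrightarrow> \<mu>"
  proof (rule tendsto_sandwich)
    show "\<forall>\<^sub>F n in sequentially. \<mu> \<le> energy (f n) (df n)"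
      using ge[OF f(1,2)] f(3) by simp
    show "\<forall>\<^sub>F n in sequentially. energy (f n) (df n) \<le> \<mu> + 1 / Suc n"
      unfolding f_def df_def by (intro always_eventually allI less_imp_le p(2))
    show "(\<lambda>n. \<mu> + 1 / Suc n) \<longlonglongrightarrow> \<mu>"
      using tendsto_add[OF tendsto_const LIMSEQ_Suc[OF lim_1_over_n], of \<mu>] by simp
  qed simp
  \<comment> \<open>For a normalized function the squared norm of the derivative is at most the
    energy plus \<open>B\<close>, and the energies here are at most
    \<open>\<mu> + 1\<close>.\<close>
  define C where "C = \<bar>\<mu>\<bar> + 2 + B"
  have C: "nsq L (f n) \<le> C" "nsq L (df n) \<le> C" for n
  proof -
    have "1 / real (Suc n) \<le> 1" by simp
    then show "nsq L (f n) \<le> C" "nsq L (df n) \<le> C"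
      using low[OF p(1), of n] p(2)[of n] B_nonneg f(3)[of n]
      unfolding f_def df_def C_def by linarith+
  qed
  obtain r F where r: "strict_mono r" and F: "F \<in> L2 L" "L2_tendsto L (\<lambda>n. f (r n)) F"
    using W01_compact[of K L f df C, OF f(1) C L] by blast
  have e_lim': "(\<lambda>n. energy (f (r n)) (df (r n))) \<longlonglongrightarrow> \<mu>"
    using LIMSEQ_subseq_LIMSEQ[OF e_lim r] by (simp add: o_def)
  \<comment> \<open>The sum of two members of the sequence is again orthogonal to \<open>u\<close>,
    so its energy is at least \<open>\<mu>\<close> times its squared norm. The parallelogram
    identities for norm and form then leave little energy for the difference.\<close>
  have diff: "nsq L (\<lambda>s. df m s - df n s) \<le> 2 * (energy (f m) (df m) - \<mu>) + 2 * (energy (f n) (df n) - \<mu>)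
      + \<bar>\<mu> + B\<bar> * nsq L (\<lambda>s. f m s - f n s)" for m n
  proof -
    have W: "W01 K L (\<lambda>s. f m s + f n s) (\<lambda>s. df m s + df n s)"
      by (rule W01_add[OF f(1) f(1)])
    have "ip L (\<lambda>s. f m s + f n s) u = 0"
      using fL2 u f(2) by (simp add: ip_add_left)
    from ge[OF W this]
    have "\<mu> * nsq L (\<lambda>s. f m s + f n s) \<le> energy (\<lambda>s. f m s + f n s) (\<lambda>s. df m s + df n s)" .
    moreover have "nsq L (\<lambda>s. f m s + f n s) = 4 - nsq L (\<lambda>s. f m s - f n s)"
      using nsq_parallelogram[OF fL2(1) fL2(1), of m n] f(3)[of m] f(3)[of n] by simp
    ultimately have "\<mu> * (4 - nsq L (\<lambda>s. f m s - f n s)) \<le>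
        energy (\<lambda>s. f m s + f n s) (\<lambda>s. df m s + df n s)" by simp
    then have "energy (\<lambda>s. f m s - f n s) (\<lambda>s. df m s - df n s) \<le>
        2 * (energy (f m) (df m) - \<mu>) + 2 * (energy (f n) (df n) - \<mu>) + \<mu> * nsq L (\<lambda>s. f m s - f n s)"
      using energy_parallelogram[OF f(1) f(1), of m n] by (simp add: algebra_simps)
    moreover have "nsq L (\<lambda>s. df m s - df n s) - B * nsq L (\<lambda>s. f m s - f n s) \<le>
        energy (\<lambda>s. f m s - f n s) (\<lambda>s. df m s - df n s)"
      by (intro energy_lower L2_diff fL2)
    moreover have "(\<mu> + B) * nsq L (\<lambda>s. f m s - f n s) \<le> \<bar>\<mu> + B\<bar> * nsq L (\<lambda>s. f m s - f n s)"
      by (intro mult_right_mono) auto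
    ultimately show ?thesis by (simp add: algebra_simps)
  qed
  obtain dF where dF: "dF \<in> L2 L" "L2_tendsto L (\<lambda>n. df (r n)) dF"
  proof (rule L2_complete[of "\<lambda>n. df (r n)" L])
    fix e :: real assume e: "e > 0"
    \<comment> \<open>The bound \<open>diff\<close> is split into a contribution of each index, so
      that smallness of a single sequence suffices.\<close>
    define a where "a n = 2 * (energy (f (r n)) (df (r n)) - \<mu>) +
      \<bar>\<mu> + B\<bar> * (2 * nsq L (\<lambda>s. f (r n) s - F s))" for n
    have "a \<longlonglongrightarrow> 2 * (\<mu> - \<mu>) + \<bar>\<mu> + B\<bar> * (2 * 0)"
      unfolding a_def by (intro tendsto_intros e_lim' F(2)[unfolded L2_tendsto_iff])
    then have "\<forall>\<^sub>F n in sequentially. a n < e / 2"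
      using e by (intro order_tendstoD) auto
    then obtain N where N: "\<And>n. n \<ge> N \<Longrightarrow> a n < e / 2"
      by (auto simp: eventually_sequentially)
    have "nsq L (\<lambda>s. df (r m) s - df (r n) s) < e" if "m \<ge> N" "n \<ge> N" for m n
    proof -
      have "nsq L (\<lambda>s. f (r m) s - f (r n) s) \<le>
          2 * nsq L (\<lambda>s. f (r m) s - F s) + 2 * nsq L (\<lambda>s. f (r n) s - F s)"
        using nsq_triangle[OF fL2(1) F(1) fL2(1), of "r m" "r n"] nsq_minus_commute[of L F "f (r n)"]
        by simp
      then have "\<bar>\<mu> + B\<bar> * nsq L (\<lambda>s. f (r m) s - f (r n) s) \<le> \<bar>\<mu> + B\<bar> *
          (2 * nsq L (\<lambda>s. f (r m) s - F s) + 2 * nsq L (\<lambda>s. f (r n) s - F s))"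
        by (intro mult_left_mono) auto
      then have "nsq L (\<lambda>s. df (r m) s - df (r n) s) \<le> a m + a n"
        using diff[of "r m" "r n"] unfolding a_def distrib_left by linarith
      then show ?thesis using N[OF that(1)] N[OF that(2)] by linarith
    qed
    then show "\<exists>N. \<forall>m\<ge>N. \<forall>n\<ge>N. nsq L (\<lambda>s. df (r m) s - df (r n) s) < e" by blast
  qed (use fL2 in auto)
  have W: "W01 K L F dF"
    by (rule W01_closed[of K L "\<lambda>n. f (r n)" "\<lambda>n. df (r n)", OF f(1) F(2,1) dF(2,1)])
  have orth: "ip L F u = 0"
  proof -
    have "(\<lambda>n. ip L (f (r n)) u) \<longlonglongrightarrow> ip L F u"
      by (intro L2_tendsto_ip F fL2 u) (simp add: L2_tendsto_def)
    then show ?thesis by (simp add: f(2) LIMSEQ_const_iff)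
  qed
  have norm: "nsq L F = 1"
    using L2_tendsto_nsq[of L "\<lambda>n. f (r n)", OF F(2) fL2(1) F(1)] by (simp add: f(3) LIMSEQ_const_iff)
  have "(\<lambda>n. energy (f (r n)) (df (r n))) \<longlonglongrightarrow> energy F dF"
    unfolding energy_eq
    by (intro tendsto_add tendsto_Re L2_tendsto_nsq L2_tendsto_ip Vm_tendsto Vm_L2 F dF fL2)
  then have "energy F dF = \<mu>"
    using e_lim' by (rule LIMSEQ_unique)
  then show ?thesis using W orth norm ge by (intro exI[of _ F] exI[of _ dF]) simp
qed

section \<open>The minimum as an eigenvalue in the list\<close>

text \<open>First variation. At \<open>F + t * g\<close> the energy minus \<open>\<mu>\<close> times
  the squared norm equals \<open>t * b + t^2 * c\<close>, without constant term because
  \<open>F\<close> is normalized with energy \<open>\<mu>\<close>. Nonnegativity for all real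
  \<open>t\<close> forces \<open>b = 0\<close>.\<close>

lemma minimizer_weak_equation:
  assumes F: "W01 K L F dF" "ip L F u = 0" "nsq L F = 1" and u: "u \<in> L2 L"
    and ge: "\<And>h dh. W01 K L h dh \<Longrightarrow> ip L h u = 0 \<Longrightarrow> energy F dF * nsq L h \<le> energy h dh"
    and h: "W01 K L h dh" "ip L h u = 0"
  shows "form F dF h dh = energy F dF * ip L F h"
proof -
  define \<mu> where "\<mu> = energy F dF"
  have Re0: "Re (form F dF g dg - \<mu> * ip L F g) = 0" if g: "W01 K L g dg" "ip L g u = 0" for g dg
  proof -
    define b where "b = 2 * Re (form F dF g dg - \<mu> * ip L F g)"
    define c where "c = energy g dg - \<mu> * nsq L g"
    have "0 \<le> 0 + t * b + t\<^sup>2 * c" for t :: real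
    proof -
      note Wt = W01_cmult[OF g(1), of "complex_of_real t"]
      have L2: "F \<in> L2 L" "g \<in> L2 L" by (rule W01_L2(1)[OF F(1)], rule W01_L2(1)[OF g(1)])
      have "ip L (\<lambda>s. F s + of_real t * g s) u = 0"
        using F(2) g(2) L2 u by (simp add: ip_add_left L2_cmult)
      from ge[OF W01_add[OF F(1) Wt] this]
      show ?thesis
        unfolding energy_add[OF F(1) Wt] nsq_add[OF L2(1) L2_cmult[OF L2(2)]] energy_cmult
          form_cmult_right b_def c_def \<mu>_def[symmetric] nsq_cmult ip_cmult_right F(3)
        by (simp add: algebra_simps)
    qed
    moreover have "0 \<le> c" using ge[OF g] by (simp add: c_def \<mu>_def)
    ultimately have "b\<^sup>2 \<le> 4 * 0 * c" by (rule quadratic_nonneg_imp)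
    then show ?thesis by (simp add: b_def)
  qed
  \<comment> \<open>Real \<open>t\<close> reaches only the real part; the direction
    \<open>\<i> * h\<close> supplies the imaginary part.\<close>
  have "Im (form F dF h dh - \<mu> * ip L F h) = 0"
    using Re0[OF W01_cmult[OF h(1), of \<i>]] h(2) by (simp add: form_cmult_right algebra_simps)
  with Re0[OF h] have "form F dF h dh - \<mu> * ip L F h = 0"
    by (simp add: complex_eq_iff)
  then show ?thesis by (simp add: \<mu>_def)
qed

text \<open>The constraint leaves no Lagrange multiplier. Any \<open>v\<close> is a function
  orthogonal to \<open>u\<close> plus a multiple of \<open>u\<close>, and the form of
  \<open>F\<close> against \<open>u\<close> is 0, because \<open>u\<close> solves its own eigenvalue
  equation and is orthogonal to \<open>F\<close>.\<close>

lemma minimizer_eigenfunction: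
  assumes F: "W01 K L F dF" "ip L F u = 0" "nsq L F = 1"
    and ge: "\<And>h dh. W01 K L h dh \<Longrightarrow> ip L h u = 0 \<Longrightarrow> energy F dF * nsq L h \<le> energy h dh"
    and u: "u \<in> eigenspace K L V \<mu>0" "nsq L u = 1"
  shows "F \<in> eigenspace K L V (energy F dF)"
proof -
  obtain du where du: "W01 K L u du" "\<And>v dv. W01 K L v dv \<Longrightarrow> form u du v dv = \<mu>0 * ip L u v"
    using u(1) by (auto simp: eigenspace_iff)
  note uL2 = W01_L2(1)[OF du(1)]
  have Fu: "form F dF u du = 0"
    using form_sym[of F dF u du] du(2)[OF F(1)] F(2) ip_cnj[of L u F] by simp
  have "form F dF v dv = energy F dF * ip L F v" if v: "W01 K L v dv" for v dv
  proof -
    define c where "c = ip L v u"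
    define h where "h = (\<lambda>s. v s + - c * u s)"
    define dh where "dh = (\<lambda>s. dv s + - c * du s)"
    note Wc = W01_cmult[OF du(1), of "- c"]
    have W: "W01 K L h dh" unfolding h_def dh_def by (rule W01_add[OF v Wc])
    have "ip L h u = 0"
      using W01_L2(1)[OF v] uL2 u(2) L2_cmult[OF uL2, of "- c"] ip_cmult_left[of L "- c" u u]
      unfolding h_def by (simp only: ip_add_left ip_self) (simp add: c_def)
    from minimizer_weak_equation[OF F uL2 ge W this]
    have "form F dF h dh = energy F dF * ip L F h" by simp
    moreover have "form F dF h dh = form F dF v dv"
      using form_add_right[OF v Wc F(1)] Fu form_cmult_right[of F dF "- c" u du]
      by (simp add: h_def dh_def)
    moreover have "ip L F h = ip L F v"
      using ip_add_right[OF W01_L2(1)[OF v] L2_cmult[OF uL2, of "- c"] W01_L2(1)[OF F(1)]] F(2)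
        ip_cmult_right[of L F "- c" u] by (simp add: h_def)
    ultimately show ?thesis by simp
  qed
  then show ?thesis using F(1) by (auto simp: eigenspace_iff)
qed

text \<open>A value missing from the list has an eigenspace of dimension 0, whose members vanish
  almost everywhere.\<close>

lemma eigenvalue_in_list:
  assumes list: "eigenvalue_list K L V lam" and F: "F \<in> eigenspace K L V \<mu>" "nsq L F = 1"
  shows "\<exists>k\<ge>1. lam k = \<mu>"
proof (rule ccontr)
  assume "\<not> ?thesis"
  then have "{k. 1 \<le> k \<and> lam k = \<mu>} = {}" by auto
  moreover have "has_L2_dim L (eigenspace K L V \<mu>) (card {k. 1 \<le> k \<and> lam k = \<mu>})"
    using list unfolding eigenvalue_list_def by blast
  ultimately have "has_L2_dim L (eigenspace K L V \<mu>) 0" by (simp only: card.empty)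
  then have "AE s in arc_measure L. F s = 0"
    using F(1) by (auto simp: has_L2_dim_def)
  moreover have "F \<in> L2 L" using F(1) by (auto simp: eigenspace_iff dest: W01_L2)
  ultimately show False using nsq_eq_0_iff[of F L] F(2) by simp
qed

text \<open>If \<open>\<mu>\<close> occurred at index 1 only, it would be \<open>lam 1\<close> with
  a one-dimensional eigenspace, which has no room for the orthonormal pair \<open>u\<close>,
  \<open>F\<close>. So it occurs at some index from 2 on, and monotonicity of the list
  applies.\<close>

lemma orthogonal_eigenvalue_ge:
  assumes list: "eigenvalue_list K L V lam"
    and u: "u \<in> eigenspace K L V (lam 1)" "nsq L u = 1"
    and F: "F \<in> eigenspace K L V \<mu>" "nsq L F = 1" "ip L F u = 0"
  shows "lam 2 \<le> \<mu>"
proof (cases "\<exists>k\<ge>2. lam k = \<mu>")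
  case True
  then obtain k where "k \<ge> 2" "lam k = \<mu>" by blast
  moreover have "mono_on {1..} lam" using list by (simp add: eigenvalue_list_def)
  ultimately show ?thesis by (auto simp: mono_on_def)
next
  case False
  obtain k where k: "k \<ge> 1" "lam k = \<mu>"
    using eigenvalue_in_list[OF list F(1,2)] by blast
  then have \<mu>: "lam 1 = \<mu>" using False by (cases "k = 1") auto
  have "{k. 1 \<le> k \<and> lam k = lam 1} = {1}"
  proof (intro equalityI subsetI)
    fix k assume "k \<in> {k. 1 \<le> k \<and> lam k = lam 1}"
    then show "k \<in> {1}" using False \<mu> by (cases "k \<ge> 2") auto
  qed simp
  moreover have "has_L2_dim L (eigenspace K L V (lam 1)) (card {k. 1 \<le> k \<and> lam k = lam 1})"
    using list unfolding eigenvalue_list_def by blast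
  ultimately have "has_L2_dim L (eigenspace K L V (lam 1)) 1" by simp
  then obtain f :: "nat \<Rightarrow> real \<Rightarrow> complex" where f0:
    "\<forall>w\<in>eigenspace K L V (lam 1). \<exists>c. AE s in arc_measure L. w s = (\<Sum>i<1. c i * f i s)"
    unfolding has_L2_dim_def by blast
  have f: "\<exists>c. AE s in arc_measure L. w s = c * f 0 s" if w: "w \<in> eigenspace K L V (lam 1)" for w
    using bspec[OF f0 w] by auto
  obtain c where c: "AE s in arc_measure L. u s = c * f 0 s" using f[OF u(1)] by blast
  obtain d where d: "AE s in arc_measure L. F s = d * f 0 s" using f[of F] F(1) \<mu> by auto
  have L2: "u \<in> L2 L" "F \<in> L2 L" using u(1) F(1) by (auto simp: eigenspace_iff dest: W01_L2)
  \<comment> \<open>\<open>u\<close> and \<open>F\<close> are \<open>c\<close> and \<open>d\<close>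
    times the same function, so this combination vanishes. By orthonormality its squared norm is
    \<open>|c|^2 + |d|^2\<close>, hence \<open>c = 0\<close> and \<open>u\<close> would be
    null.\<close>
  have "AE s in arc_measure L. c * F s - d * u s = 0"
    using c d by eventually_elim simp
  then have z: "nsq L (\<lambda>s. c * F s - d * u s) = 0"
    using nsq_eq_0_iff[of "\<lambda>s. c * F s - d * u s" L] L2 by auto
  have "nsq L (\<lambda>s. c * F s - d * u s) = (cmod c)\<^sup>2 + (cmod d)\<^sup>2"
    using nsq_diff[OF L2_cmult[OF L2(2)] L2_cmult[OF L2(1)], of c d] u(2) F(2,3) by simp
  then have "c = 0" using z by (simp add: sum_power2_eq_zero_iff)
  then have "AE s in arc_measure L. u s = 0" using c by simp
  then show ?thesis using nsq_eq_0_iff[OF L2(1)] u(2) by simp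
qed

text \<open>The half of the min-max principle that bounds \<open>lam 2\<close> from above. The
  minimum of the form over normalized functions orthogonal to \<open>u\<close> belongs to an
  eigenfunction orthogonal to \<open>u\<close>, and such an eigenvalue is at least
  \<open>lam 2\<close>.\<close>

theorem second_eigenvalue_le:
  assumes list: "eigenvalue_list K L V lam"
    and u: "u \<in> eigenspace K L V (lam 1)" "nsq L u = 1"
    and f: "W01 K L f df" "ip L f u = 0"
  shows "lam 2 * nsq L f \<le> energy f df"
proof (cases "nsq L f = 0")
  case True
  then show ?thesis using energy_nonneg_of_null[OF W01_L2(1)[OF f(1)]] by simp
next
  case False
  then have pos: "nsq L f > 0" using nsq_nonneg[of L f] by linarith
  define c where "c = complex_of_real (1 / sqrt (nsq L f))"
  have c: "(cmod c)\<^sup>2 = 1 / nsq L f"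
    using pos by (simp add: c_def norm_divide power_divide)
  have uL2: "u \<in> L2 L" using u(1) by (auto simp: eigenspace_iff dest: W01_L2)
  have "ip L (\<lambda>s. c * f s) u = 0" "nsq L (\<lambda>s. c * f s) = 1" using f(2) c pos by simp_all
  then obtain F dF where F: "W01 K L F dF" "ip L F u = 0" "nsq L F = 1"
    and ge: "\<And>h dh. W01 K L h dh \<Longrightarrow> ip L h u = 0 \<Longrightarrow> energy F dF * nsq L h \<le> energy h dh"
    using minimizer_exists[OF uL2 W01_cmult[OF f(1), of c]] by blast
  have "lam 2 \<le> energy F dF"
    using minimizer_eigenfunction[OF F ge u] F by (intro orthogonal_eigenvalue_ge[OF list u])
  then have "lam 2 * nsq L f \<le> energy F dF * nsq L f"
    by (intro mult_right_mono) auto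
  also have "\<dots> \<le> energy f df" by (rule ge[OF f])
  finally show ?thesis .
qed

end

section \<open>Multiplication by the coordinate functions\<close>

definition jmult :: "(nat \<Rightarrow> real \<Rightarrow> real) \<Rightarrow> nat \<Rightarrow> (real \<Rightarrow> complex) \<Rightarrow> real \<Rightarrow> complex" where
  "jmult G k f s = complex_of_real (G k s) * f s"

lemma jmult_L2: "jet K L G \<Longrightarrow> f \<in> L2 L \<Longrightarrow> jmult G k f \<in> L2 L"
  unfolding jmult_def by (rule L2_jet_mult)

lemma jmult_swap: "ip L (jmult G k f) h = ip L f (jmult G k h)"
  by (simp add: ip_def jmult_def mult_ac)

lemma jmult_commute: "jmult G j (jmult G k f) = jmult G k (jmult G j f)"
  by (auto simp: jmult_def mult_ac)

lemma jmult_add: "jmult G k (\<lambda>s. f s + h s) = (\<lambda>s. jmult G k f s + jmult G k h s)"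
  by (auto simp: jmult_def algebra_simps)

lemma W01_jmult:
  assumes "jet K L G" "W01 K L u du"
  shows "W01 K L (jmult G k u) (\<lambda>s. jmult G (Suc k) u s + jmult G k du s)"
proof -
  \<comment> \<open>The derivatives from order \<open>k\<close> on form a jet again, to whose first
    entry \<open>W01_mult\<close> applies.\<close>
  have "jet K L (\<lambda>j. G (j + k))"
    using assms(1) by (simp add: jet_def)
  from W01_mult[OF this assms(2)] show ?thesis
    by (simp add: jmult_def[abs_def])
qed

context schroedinger
begin

lemma Vm_jmult: "Vm (jmult G k f) = jmult G k (Vm f)"
  by (auto simp: Vm_def jmult_def mult_ac)

text \<open>The derivative that membership in \<open>eigenspace\<close> provides agrees almost
  everywhere with the given \<open>du\<close>, so the weak equation holds for \<open>du\<close> as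
  well.\<close>

lemma eigenfunction_weak:
  assumes "u \<in> eigenspace K L V \<mu>" "W01 K L u du" "W01 K L v dv"
  shows "form u du v dv = \<mu> * ip L u v"
proof -
  obtain du' where du': "W01 K L u du'" "form u du' v dv = \<mu> * ip L u v"
    using assms(1,3) by (auto simp: eigenspace_iff)
  have "AE s in arc_measure L. du s = du' s"
    by (rule W01_derivative_unique[OF assms(2) du'(1)]) (use L in simp)
  then have "ip L du dv = ip L du' dv"
    using L2_D(1)[OF W01_L2(2)[OF assms(2)]] L2_D(1)[OF W01_L2(2)[OF du'(1)]]
      L2_D(1)[OF W01_L2(2)[OF assms(3)]]
    by (intro ip_cong_AE) auto
  then show ?thesis using du'(2) by (simp add: form_def)
qed

text \<open>The weak equation is tested with G^2 u, whose derivative is 2 G G' u + G^2 u'. In real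
  part this yields every term of |G' u + G u'|^2 except |G' u|^2, which is left over as the
  surplus.\<close>

lemma energy_commutator:
  assumes G: "jet K L G" and u: "u \<in> eigenspace K L V \<mu>" "W01 K L u du"
  shows "energy (jmult G 0 u) (\<lambda>s. jmult G 1 u s + jmult G 0 du s) =
    \<mu> * nsq L (jmult G 0 u) + nsq L (jmult G 1 u)"
proof -
  note L2 = W01_L2[OF u(2)]
  note M = jmult_L2[OF G]
  have W: "W01 K L (jmult G 0 u) (\<lambda>s. jmult G 1 u s + jmult G 0 du s)"
    using W01_jmult[OF G u(2), of 0] by simp
  have W2: "W01 K L (jmult G 0 (jmult G 0 u))
      (\<lambda>s. jmult G 1 (jmult G 0 u) s + jmult G 0 (\<lambda>s. jmult G 1 u s + jmult G 0 du s) s)"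
    using W01_jmult[OF G W, of 0] by simp
  have "ip L du (\<lambda>s. jmult G 1 (jmult G 0 u) s + jmult G 0 (\<lambda>s. jmult G 1 u s + jmult G 0 du s) s)
      = 2 * ip L (jmult G 0 du) (jmult G 1 u) + ip L (jmult G 0 du) (jmult G 0 du)"
    by (simp add: jmult_add ip_add_right L2 M L2_add jmult_commute[of G 1 0] jmult_swap[symmetric]
        del: One_nat_def)
  moreover have "ip L (Vm u) (jmult G 0 (jmult G 0 u)) = ip L (Vm (jmult G 0 u)) (jmult G 0 u)"
    by (simp add: Vm_jmult jmult_swap)
  moreover have "ip L u (jmult G 0 (jmult G 0 u)) = nsq L (jmult G 0 u)"
    by (simp add: jmult_swap[symmetric] ip_self)
  ultimately have "2 * ip L (jmult G 0 du) (jmult G 1 u) + nsq L (jmult G 0 du)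
      + ip L (Vm (jmult G 0 u)) (jmult G 0 u) = \<mu> * nsq L (jmult G 0 u)"
    using eigenfunction_weak[OF u W2] by (simp add: form_def ip_self)
  from arg_cong[OF this, of Re]
  have "2 * Re (ip L (jmult G 0 du) (jmult G 1 u)) + nsq L (jmult G 0 du)
      + Re (ip L (Vm (jmult G 0 u)) (jmult G 0 u)) = \<mu> * nsq L (jmult G 0 u)" by simp
  then show ?thesis
    unfolding energy_eq using nsq_add[OF M M, OF L2(1,2), of 1 0]
      Re_ip_sym[of L "jmult G 0 du" "jmult G 1 u"] by simp
qed

end

text \<open>The integral of the derivative of G G' |u|^2 is 0, written as \<open>W01_parts\<close>
  for G G' u against u. The two terms that contain u' have equal real parts, whence the factor 2;
  second derivatives fall only on G.\<close>

lemma jmult_parts: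
  assumes G: "jet K L G" and u: "W01 K L u du" and L: "0 \<le> L"
  shows "Re (ip L (jmult G 0 u) (\<lambda>s. jmult G 2 u s + 2 * jmult G 1 du s)) = - nsq L (jmult G 1 u)"
proof -
  note L2 = W01_L2[OF u]
  note M = jmult_L2[OF G]
  have W: "W01 K L (jmult G 1 u) (\<lambda>s. jmult G 2 u s + jmult G 1 du s)"
    using W01_jmult[OF G u, of 1] by (simp add: numeral_2_eq_2)
  have W2: "W01 K L (jmult G 0 (jmult G 1 u))
      (\<lambda>s. jmult G 1 (jmult G 1 u) s + jmult G 0 (\<lambda>s. jmult G 2 u s + jmult G 1 du s) s)"
    using W01_jmult[OF G W, of 0] by simp
  have "ip L (jmult G 1 (jmult G 1 u)) u = nsq L (jmult G 1 u)"
    by (simp add: jmult_swap ip_self flip: jmult_swap[of L G 1 "jmult G 1 u"])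
  moreover have "ip L (jmult G 0 (jmult G 1 u)) du = ip L (jmult G 0 u) (jmult G 1 du)"
    by (subst jmult_commute) (rule jmult_swap)
  moreover have "ip L (\<lambda>s. jmult G 1 (jmult G 1 u) s + jmult G 0 (\<lambda>s. jmult G 2 u s + jmult G 1 du s) s) u
      = ip L (jmult G 1 (jmult G 1 u)) u + ip L (jmult G 2 u) (jmult G 0 u) + ip L (jmult G 1 du) (jmult G 0 u)"
    by (simp add: jmult_add ip_add_left L2 M L2_add jmult_swap[of L G 0])
  ultimately have "nsq L (jmult G 1 u) + ip L (jmult G 2 u) (jmult G 0 u) + ip L (jmult G 1 du) (jmult G 0 u)
      = - ip L (jmult G 0 u) (jmult G 1 du)"
    using W01_parts[OF W2 u L] by simp
  from arg_cong[OF this, of Re]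
  have "nsq L (jmult G 1 u) + Re (ip L (jmult G 0 u) (jmult G 2 u)) + Re (ip L (jmult G 0 u) (jmult G 1 du))
      = - Re (ip L (jmult G 0 u) (jmult G 1 du))"
    using Re_ip_sym[of L "jmult G 2 u" "jmult G 0 u"] Re_ip_sym[of L "jmult G 1 du" "jmult G 0 u"] by simp
  moreover have "ip L (jmult G 0 u) (\<lambda>s. jmult G 2 u s + 2 * jmult G 1 du s) =
      ip L (jmult G 0 u) (jmult G 2 u) + 2 * ip L (jmult G 0 u) (jmult G 1 du)"
    using ip_add_right[of "jmult G 2 u" L "\<lambda>s. 2 * jmult G 1 du s" "jmult G 0 u"]
    by (simp add: M L2 L2_cmult del: One_nat_def)
  ultimately show ?thesis by simp
qed

lemma jet_sub_const:
  assumes "jet K L G"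
  shows "jet K L (\<lambda>k s. G k s - (if k = 0 then c else 0))"
  unfolding jet_def
proof (intro conjI allI ballI impI)
  fix k t assume t: "t \<in> curve_dom K L"
  have "((\<lambda>s. G k s - (if k = 0 then c else 0)) has_vector_derivative G (Suc k) t - 0)
      (at t within curve_dom K L)"
    by (intro has_vector_derivative_diff jet_deriv[OF assms t]) auto
  then show "((\<lambda>s. G k s - (if k = 0 then c else 0)) has_vector_derivative
      G (Suc k) t - (if Suc k = 0 then c else 0)) (at t within curve_dom K L)" by simp
qed (use assms in \<open>simp add: jet_def\<close>)

context schroedinger
begin

text \<open>Subtracting from \<open>G 0\<close> its mean with respect to \<open>|u|\<^sup>2\<close> changes neither side, and it makes
  \<open>G 0 * u\<close> orthogonal to \<open>u\<close>, so that the variational principle applies to it.\<close>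

lemma coordinate_gap:
  assumes list: "eigenvalue_list K L V lam" and G: "jet K L G"
    and u: "u \<in> eigenspace K L V (lam 1)" "nsq L u = 1" "W01 K L u du"
    and gap: "lam 1 \<le> lam 2"
  shows "(lam 2 - lam 1) * nsq L (jmult G 1 u) \<le> nsq L (\<lambda>s. jmult G 2 u s + 2 * jmult G 1 du s)"
proof -
  define c where "c = Re (ip L (jmult G 0 u) u)"
  define H where "H k s = G k s - (if k = 0 then c else 0)" for k s
  have H: "jet K L H" unfolding H_def[abs_def] by (rule jet_sub_const[OF G])
  have HG: "jmult H 1 f = jmult G 1 f" "jmult H 2 f = jmult G 2 f" for f
    by (auto simp: jmult_def H_def)
  note L2 = W01_L2[OF u(3)]
  note M = jmult_L2[OF H]
  \<comment> \<open>The mean is a real number because the multiplier is real, so the shifted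
    function is again a real jet.\<close>
  have "ip L (jmult G 0 u) u = cnj (ip L (jmult G 0 u) u)"
    by (subst (1) jmult_swap) (rule ip_cnj)
  then have "ip L (jmult G 0 u) u = of_real c"
    by (simp add: c_def complex_eq_iff)
  moreover have "jmult H 0 u = (\<lambda>s. jmult G 0 u s - of_real c * u s)"
    by (auto simp: jmult_def H_def algebra_simps)
  ultimately have orth: "ip L (jmult H 0 u) u = 0"
    using jmult_L2[OF G L2(1)] L2 u(2) by (simp add: ip_diff_left L2_cmult ip_self)
  define \<Gamma> where "\<Gamma> = lam 2 - lam 1"
  have W: "W01 K L (jmult H 0 u) (\<lambda>s. jmult H 1 u s + jmult H 0 du s)"
    using W01_jmult[OF H u(3), of 0] by simp
  have le: "\<Gamma> * nsq L (jmult H 0 u) \<le> nsq L (jmult H 1 u)"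
    using second_eigenvalue_le[OF list u(1,2) W orth] energy_commutator[OF H u(1,3)]
    by (simp add: \<Gamma>_def algebra_simps)
  let ?w = "\<lambda>s. jmult H 2 u s + 2 * jmult H 1 du s"
  have w: "?w \<in> L2 L" by (intro L2_add L2_cmult M L2)
  have "0 \<le> nsq L (\<lambda>s. of_real \<Gamma> * jmult H 0 u s + ?w s)" by simp
  also have "\<dots> = \<Gamma>\<^sup>2 * nsq L (jmult H 0 u) - 2 * \<Gamma> * nsq L (jmult H 1 u) + nsq L ?w"
    using jmult_parts[OF H u(3)] L nsq_add[OF L2_cmult[OF M[OF L2(1)]] w, of "of_real \<Gamma>" 0]
      ip_cmult_left[of L "of_real \<Gamma>" "jmult H 0 u" ?w] nsq_cmult[of L "of_real \<Gamma>" "jmult H 0 u"]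
    by simp
  \<comment> \<open>Multiplying \<open>le\<close> by \<open>\<Gamma>\<close>, nonnegative by
    \<open>gap\<close>, trades the unknown norm of \<open>jmult H 0 u\<close> for half of the mixed
    term.\<close>
  also have "\<Gamma>\<^sup>2 * nsq L (jmult H 0 u) \<le> \<Gamma> * nsq L (jmult H 1 u)"
    using mult_left_mono[OF le, of \<Gamma>] gap by (simp add: \<Gamma>_def power2_eq_square mult.assoc)
  finally have "\<Gamma> * nsq L (jmult H 1 u) \<le> nsq L ?w" by simp
  then show ?thesis by (simp only: HG \<Gamma>_def)
qed

end

section \<open>Summation over the coordinates of the curve\<close>

lemma cmod_real_combination:
  "(cmod (of_real a * z + of_real b * w))\<^sup>2 = a\<^sup>2 * (cmod z)\<^sup>2 + b\<^sup>2 * (cmod w)\<^sup>2 + 2 * a * b * Re (z * cnj w)"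
  unfolding cmod_power2 by (simp add: power2_eq_square algebra_simps)

definition curve_jet :: "curve_type \<Rightarrow> real \<Rightarrow> (real \<Rightarrow> real ^ 'n::finite) \<Rightarrow> (nat \<Rightarrow> real \<Rightarrow> real ^ 'n) \<Rightarrow> bool" where
  "curve_jet K L \<gamma> D \<longleftrightarrow> jet K L D \<and> D 0 = \<gamma> \<and>
     (\<forall>s\<in>curve_dom K L. norm (D 1 s) = 1 \<and> D 1 s \<bullet> D 2 s = 0 \<and> norm (D 2 s) = curvature K L \<gamma> s)"

text \<open>Orthogonality comes from differentiating the constant squared length of the tangent;
  uniqueness of derivatives within the domain links \<open>D 2\<close> to \<open>curvature\<close>.
  The jet is arbitrary, so that the circle can use its explicit one.\<close>

lemma curve_jetI:
  fixes \<gamma> :: "real \<Rightarrow> real ^ 'n::finite"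
  assumes \<gamma>: "smooth_curve K L \<gamma>" and jet: "jet K L D" and D0: "D 0 = \<gamma>"
  shows "curve_jet K L \<gamma> D"
proof -
  have L: "L > 0" and n1: "\<And>s. s \<in> curve_dom K L \<Longrightarrow> norm (vector_derivative \<gamma> (at s within curve_dom K L)) = 1"
    using \<gamma> by (auto simp: smooth_curve_def)
  note D = D0 jet_deriv[OF jet]
  have vd: "vector_derivative f (at s within curve_dom K L) = f'"
    if "(f has_vector_derivative f') (at s within curve_dom K L)" "s \<in> curve_dom K L"
    for f :: "real \<Rightarrow> real ^ 'n" and f' s
    by (rule vector_derivative_within[OF at_within_curve_dom[OF L that(2)] that(1)])
  have D1: "vector_derivative \<gamma> (at s within curve_dom K L) = D 1 s" if "s \<in> curve_dom K L" for s
    using vd[OF D(2)[OF that, of 0] that] D(1) by simp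
  have D2: "curvature K L \<gamma> s = norm (D 2 s)" if s: "s \<in> curve_dom K L" for s
  proof -
    have "((\<lambda>t. vector_derivative \<gamma> (at t within curve_dom K L)) has_vector_derivative D 2 s)
        (at s within curve_dom K L)"
      by (rule has_vector_derivative_transform[OF s D1 D(2)[OF s, of 1, unfolded Suc_1]])
    then show ?thesis unfolding curvature_def by (simp add: vd[OF _ s])
  qed
  have norm: "norm (D 1 s) = 1" if "s \<in> curve_dom K L" for s
    using n1[OF that] D1[OF that] by simp
  have "D 1 s \<bullet> D 2 s = 0" if s: "s \<in> curve_dom K L" for s
  proof -
    have "((\<lambda>t. D 1 t \<bullet> D 1 t) has_vector_derivative D 1 s \<bullet> D 2 s + D 2 s \<bullet> D 1 s) (at s within curve_dom K L)"
      by (intro bounded_bilinear.has_vector_derivative[OF bounded_bilinear_inner]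
          D(2)[OF s, of 1, unfolded Suc_1])
    moreover have "((\<lambda>t. D 1 t \<bullet> D 1 t) has_vector_derivative 0) (at s within curve_dom K L)"
      by (rule has_vector_derivative_transform[OF s, of _ "\<lambda>_. 1"])
        (use norm in \<open>auto simp: norm_eq_sqrt_inner\<close>)
    ultimately have "D 1 s \<bullet> D 2 s + D 2 s \<bullet> D 1 s = 0"
      using vector_derivative_unique_within[OF at_within_curve_dom[OF L s]] by blast
    then show ?thesis by (simp add: inner_commute)
  qed
  then show ?thesis using jet D(1) D2 norm unfolding curve_jet_def by simp
qed

lemma smooth_curve_jet:
  fixes \<gamma> :: "real \<Rightarrow> real ^ 'n::finite"
  assumes "smooth_curve K L \<gamma>"
  shows "\<exists>D. curve_jet K L \<gamma> D"
proof -
  have per: "\<And>s. K = Closed_Curve \<Longrightarrow> \<gamma> (s + L) = \<gamma> s"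
    using assms by (auto simp: smooth_curve_def)
  obtain D where D: "D 0 = \<gamma>"
    "\<And>k t. t \<in> curve_dom K L \<Longrightarrow> (D k has_vector_derivative D (Suc k) t) (at t within curve_dom K L)"
    using assms by (auto simp: smooth_curve_def smooth_on_def)
  have jet: "jet K L D"
    using D per by (intro jetI) auto
  then show ?thesis using curve_jetI[OF assms jet D(1)] by blast
qed

lemma jet_component: "jet K L D \<Longrightarrow> jet K L (\<lambda>k s. D k s $ i)"
  unfolding jet_def
  by (auto intro: bounded_linear.has_vector_derivative[OF bounded_linear_vec_nth])

lemma sum_components_square: "(\<Sum>i\<in>UNIV. (x $ i)\<^sup>2) = (norm x)\<^sup>2" for x :: "real ^ 'n::finite"
  unfolding power2_norm_eq_inner inner_vec_def by (simp add: power2_eq_square)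

lemma sum_nsq_tangent:
  fixes \<gamma> :: "real \<Rightarrow> real ^ 'n::finite"
  assumes D: "curve_jet K L \<gamma> D" and u: "u \<in> L2 L"
  shows "(\<Sum>i\<in>UNIV. nsq L (jmult (\<lambda>k s. D k s $ i) 1 u)) = nsq L u"
proof -
  have jet: "jet K L D" using D by (simp add: curve_jet_def)
  have "(\<Sum>i\<in>UNIV. nsq L (jmult (\<lambda>k s. D k s $ i) 1 u)) =
      (LINT s|arc_measure L. (\<Sum>i\<in>UNIV. (cmod (jmult (\<lambda>k s. D k s $ i) 1 u s))\<^sup>2))"
    unfolding nsq_def
    by (intro Bochner_Integration.integral_sum[symmetric] L2_D(2) jmult_L2[OF jet_component[OF jet]] u)
  also have "\<dots> = nsq L u"
    unfolding nsq_def
  proof (rule Bochner_Integration.integral_cong)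
    fix s assume "s \<in> space (arc_measure L)"
    then have "norm (D 1 s) = 1"
      using D Icc_subset_curve_dom[of L K] by (auto simp: curve_jet_def)
    then show "(\<Sum>i\<in>UNIV. (cmod (jmult (\<lambda>k s. D k s $ i) 1 u s))\<^sup>2) = (cmod (u s))\<^sup>2"
      by (simp add: jmult_def norm_mult power_mult_distrib sum_components_square
          flip: sum_distrib_right)
  qed simp
  finally show ?thesis .
qed

lemma sum_nsq_curvature:
  fixes \<gamma> :: "real \<Rightarrow> real ^ 'n::finite"
  assumes D: "curve_jet K L \<gamma> D" and u: "u \<in> L2 L" "du \<in> L2 L"
  shows "(\<Sum>i\<in>UNIV. nsq L (\<lambda>s. jmult (\<lambda>k s. D k s $ i) 2 u s + 2 * jmult (\<lambda>k s. D k s $ i) 1 du s)) =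
    (LINT s|arc_measure L. 4 * (cmod (du s))\<^sup>2 + (curvature K L \<gamma> s)\<^sup>2 * (cmod (u s))\<^sup>2)"
proof -
  have jet: "jet K L D" using D by (simp add: curve_jet_def)
  let ?w = "\<lambda>i s. jmult (\<lambda>k s. D k s $ i) 2 u s + 2 * jmult (\<lambda>k s. D k s $ i) 1 du s"
  have "(\<Sum>i\<in>UNIV. nsq L (?w i)) = (LINT s|arc_measure L. (\<Sum>i\<in>UNIV. (cmod (?w i s))\<^sup>2))"
    unfolding nsq_def
    by (intro Bochner_Integration.integral_sum[symmetric] L2_D(2) L2_add L2_cmult
        jmult_L2[OF jet_component[OF jet]] u)
  also have "\<dots> = (LINT s|arc_measure L. 4 * (cmod (du s))\<^sup>2 + (curvature K L \<gamma> s)\<^sup>2 * (cmod (u s))\<^sup>2)"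
  proof (rule Bochner_Integration.integral_cong)
    fix s assume "s \<in> space (arc_measure L)"
    then have s: "norm (D 1 s) = 1" "D 1 s \<bullet> D 2 s = 0" "norm (D 2 s) = curvature K L \<gamma> s"
      using D Icc_subset_curve_dom[of L K] by (auto simp: curve_jet_def)
    \<comment> \<open>The mixed term carries the factor \<open>D 1 s $ i * D 2 s $ i\<close>; its
      sum over \<open>i\<close> is the inner product \<open>D 1 s \<bullet> D 2 s\<close>, which is
      0.\<close>
    have "(cmod (?w i s))\<^sup>2 = (D 2 s $ i)\<^sup>2 * (cmod (u s))\<^sup>2 + (D 1 s $ i)\<^sup>2 * (4 * (cmod (du s))\<^sup>2)
        + (D 1 s $ i * D 2 s $ i) * (4 * Re (u s * cnj (du s)))" for i
      using cmod_real_combination[of "D 2 s $ i" "u s" "2 * D 1 s $ i" "du s"]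
      by (simp add: jmult_def power_mult_distrib mult_ac)
    then have "(\<Sum>i\<in>UNIV. (cmod (?w i s))\<^sup>2) = (\<Sum>i\<in>UNIV. (D 2 s $ i)\<^sup>2) * (cmod (u s))\<^sup>2
        + (\<Sum>i\<in>UNIV. (D 1 s $ i)\<^sup>2) * (4 * (cmod (du s))\<^sup>2)
        + (\<Sum>i\<in>UNIV. D 1 s $ i * D 2 s $ i) * (4 * Re (u s * cnj (du s)))"
      by (simp only: sum.distrib sum_distrib_right)
    also have "(\<Sum>i\<in>UNIV. D 1 s $ i * D 2 s $ i) = D 1 s \<bullet> D 2 s"
      by (simp add: inner_vec_def)
    also have "(\<Sum>i\<in>UNIV. (D 2 s $ i)\<^sup>2) * (cmod (u s))\<^sup>2
        + (\<Sum>i\<in>UNIV. (D 1 s $ i)\<^sup>2) * (4 * (cmod (du s))\<^sup>2)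
        + D 1 s \<bullet> D 2 s * (4 * Re (u s * cnj (du s)))
      = 4 * (cmod (du s))\<^sup>2 + (curvature K L \<gamma> s)\<^sup>2 * (cmod (u s))\<^sup>2"
      by (simp only: sum_components_square s) simp
    finally show "(\<Sum>i\<in>UNIV. (cmod (?w i s))\<^sup>2) = 4 * (cmod (du s))\<^sup>2 + (curvature K L \<gamma> s)\<^sup>2 * (cmod (u s))\<^sup>2" .
  qed simp
  finally show ?thesis .
qed

text \<open>The right side of the first bound with the factor 4 absorbed. Functions are complex here
  because the second bound uses an eigenfunction taken from a complex basis.\<close>

definition curvature_energy ::
  "curve_type \<Rightarrow> real \<Rightarrow> (real \<Rightarrow> real ^ 'n::finite) \<Rightarrow> (real \<Rightarrow> complex) \<Rightarrow> (real \<Rightarrow> complex) \<Rightarrow> real" where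
  "curvature_energy K L \<gamma> u du =
    (LINT s|arc_measure L. 4 * (cmod (du s))\<^sup>2 + (curvature K L \<gamma> s)\<^sup>2 * (cmod (u s))\<^sup>2)"

text \<open>Otherwise every w = G'' u + 2 G' u' is null, so \<open>jmult_parts\<close> gives G' u =
  0 for each coordinate, which contradicts the unit tangent. Geometrically, a nonzero constant on a
  straight curve is excluded: the curve would not close, and at end points the constant would
  violate the Dirichlet conditions.\<close>

lemma curvature_energy_pos:
  fixes \<gamma> :: "real \<Rightarrow> real ^ 'n::finite"
  assumes \<gamma>: "smooth_curve K L \<gamma>" and u: "W01 K L u du" "nsq L u = 1"
  shows "0 < curvature_energy K L \<gamma> u du"
proof (rule ccontr)
  obtain D where D: "curve_jet K L \<gamma> D" using smooth_curve_jet[OF \<gamma>] by blast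
  have jet: "jet K L D" using D by (simp add: curve_jet_def)
  have L: "0 \<le> L" using \<gamma> by (simp add: smooth_curve_def)
  note L2 = W01_L2[OF u(1)]
  let ?w = "\<lambda>i s. jmult (\<lambda>k s. D k s $ i) 2 u s + 2 * jmult (\<lambda>k s. D k s $ i) 1 du s"
  assume "\<not> 0 < curvature_energy K L \<gamma> u du"
  then have "(\<Sum>i\<in>UNIV. nsq L (?w i)) \<le> 0"
    using sum_nsq_curvature[OF D L2] by (simp add: curvature_energy_def)
  moreover have "0 \<le> (\<Sum>i\<in>UNIV. nsq L (?w i))" by (intro sum_nonneg) simp
  ultimately have "(\<Sum>i\<in>UNIV. nsq L (?w i)) = 0" by linarith
  then have w0: "nsq L (?w i) = 0" for i
    by (subst (asm) sum_nonneg_eq_0_iff) auto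
  have "nsq L (jmult (\<lambda>k s. D k s $ i) 1 u) = 0" for i
  proof -
    have "cmod (ip L (jmult (\<lambda>k s. D k s $ i) 0 u) (?w i)) \<le>
        sqrt (nsq L (jmult (\<lambda>k s. D k s $ i) 0 u)) * sqrt (nsq L (?w i))"
      by (intro ip_le L2_add L2_cmult jmult_L2[OF jet_component[OF jet]] L2)
    then have "ip L (jmult (\<lambda>k s. D k s $ i) 0 u) (?w i) = 0"
      unfolding w0 by simp
    then show ?thesis
      using jmult_parts[OF jet_component[OF jet] u(1) L, of i] by simp
  qed
  then show False using sum_nsq_tangent[OF D L2(1)] u(2) by simp
qed

theorem (in schroedinger) gap_le_curvature_energy:
  fixes \<gamma> :: "real \<Rightarrow> real ^ 'n::finite"
  assumes \<gamma>: "smooth_curve K L \<gamma>" and list: "eigenvalue_list K L V lam"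
    and u: "u \<in> eigenspace K L V (lam 1)" "nsq L u = 1" "W01 K L u du"
  shows "lam 2 - lam 1 \<le> curvature_energy K L \<gamma> u du"
proof -
  obtain D where D: "curve_jet K L \<gamma> D" using smooth_curve_jet[OF \<gamma>] by blast
  have jet: "jet K L D" using D by (simp add: curve_jet_def)
  note L2 = W01_L2[OF u(3)]
  have "mono_on {1..} lam" using list by (simp add: eigenvalue_list_def)
  then have gap: "lam 1 \<le> lam 2" by (auto simp: mono_on_def)
  have "lam 2 - lam 1 = (\<Sum>i\<in>UNIV. (lam 2 - lam 1) * nsq L (jmult (\<lambda>k s. D k s $ i) 1 u))"
    using sum_nsq_tangent[OF D L2(1)] u(2) by (simp flip: sum_distrib_left)
  also have "\<dots> \<le> (\<Sum>i\<in>UNIV. nsq L (\<lambda>s. jmult (\<lambda>k s. D k s $ i) 2 u s + 2 * jmult (\<lambda>k s. D k s $ i) 1 du s))"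
    by (intro sum_mono coordinate_gap[OF list jet_component[OF jet] u gap])
  also have "\<dots> = curvature_energy K L \<gamma> u du"
    using sum_nsq_curvature[OF D L2] by (simp add: curvature_energy_def)
  finally show ?thesis .
qed

section \<open>The bounds\<close>

text \<open>This makes \<open>g\<close> times the squared curvature a bounded measurable potential,
  to which the results for general \<open>V\<close> apply.\<close>

lemma smooth_curve_curvature_continuous:
  fixes \<gamma> :: "real \<Rightarrow> real ^ 'n::finite"
  assumes "smooth_curve K L \<gamma>"
  shows "continuous_on {0..L} (curvature K L \<gamma>)"
proof -
  obtain D where D: "curve_jet K L \<gamma> D" using smooth_curve_jet[OF assms] by blast
  then have "continuous_on {0..L} (\<lambda>s. norm (D 2 s))"
    by (intro continuous_on_norm jet_continuous[of K L D]) (simp add: curve_jet_def)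
  moreover have "norm (D 2 s) = curvature K L \<gamma> s" if "s \<in> {0..L}" for s
    using D that Icc_subset_curve_dom[of L K] by (auto simp: curve_jet_def)
  ultimately show ?thesis using continuous_on_cong[OF refl] by (metis (no_types, lifting))
qed

lemma gap_bound:
  fixes \<gamma> :: "real \<Rightarrow> real ^ 'n::finite"
  assumes \<gamma>: "smooth_curve K L \<gamma>"
    and V: "V \<in> borel_measurable (arc_measure L)" "bounded (V ` {0..L})"
    and list: "eigenvalue_list K L V lam"
    and u: "u \<in> eigenspace K L V (lam 1)" "nsq L u = 1" "W01 K L u du"
  shows "lam 2 - lam 1 \<le> curvature_energy K L \<gamma> u du"
proof -
  obtain B where "\<forall>s\<in>{0..L}. \<bar>V s\<bar> \<le> B"
    using V(2) by (auto simp: bounded_iff)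
  then interpret schroedinger K L V B
    using V(1) \<gamma> by unfold_locales (auto simp: smooth_curve_def)
  show ?thesis by (rule gap_le_curvature_energy[OF \<gamma> list u])
qed

text \<open>Index 1 itself shows that \<open>lam 1\<close> has positive multiplicity, and by
  independence a basis function is not null, so it can be normalized.\<close>

lemma first_eigenfunction_exists:
  assumes list: "eigenvalue_list K L V lam"
  shows "\<exists>u du. u \<in> eigenspace K L V (lam 1) \<and> W01 K L u du \<and> nsq L u = 1"
proof -
  have fin: "finite {k. 1 \<le> k \<and> lam k = lam 1}"
    and dim: "has_L2_dim L (eigenspace K L V (lam 1)) (card {k. 1 \<le> k \<and> lam k = lam 1})"
    using list unfolding eigenvalue_list_def by blast+
  have pos: "0 < card {k. 1 \<le> k \<and> lam k = lam 1}"
    using fin by (subst card_gt_0_iff) auto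
  define m where "m = card {k. 1 \<le> k \<and> lam k = lam 1}"
  obtain f where f: "\<And>i. i < m \<Longrightarrow> f i \<in> eigenspace K L V (lam 1)"
    "\<And>c. (AE s in arc_measure L. (\<Sum>i<m. c i * f i s) = 0) \<Longrightarrow> \<forall>i<m. c i = 0"
    using dim unfolding has_L2_dim_def m_def[symmetric] by blast
  have m: "0 < m" using pos by (simp add: m_def)
  have E: "f 0 \<in> eigenspace K L V (lam 1)" using f(1) m by blast
  then obtain df where W: "W01 K L (f 0) df"
    unfolding eigenspace_def schrodinger_graph_def by blast
  have "nsq L (f 0) \<noteq> 0"
  proof
    assume "nsq L (f 0) = 0"
    then have "AE s in arc_measure L. f 0 s = 0"
      using nsq_eq_0_iff[OF W01_L2(1)[OF W]] by simp
    \<comment> \<open>The coefficients 1, 0, ..., 0 would give a nontrivial relation among the basis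
      functions.\<close>
    moreover have "(\<Sum>i<m. (if i = 0 then 1 else 0) * f i s) = f 0 s" for s
      using m by (subst sum.remove[of _ 0]) auto
    ultimately have "AE s in arc_measure L. (\<Sum>i<m. (if i = 0 then 1 else 0) * f i s) = 0"
      by simp
    from f(2)[OF this] m show False by auto
  qed
  then have pos: "nsq L (f 0) > 0" using nsq_nonneg[of L "f 0"] by linarith
  define c where "c = complex_of_real (1 / sqrt (nsq L (f 0)))"
  have c: "(cmod c)\<^sup>2 = 1 / nsq L (f 0)"
    using pos by (simp add: c_def norm_divide power_divide)
  have "schrodinger_graph K L V (\<lambda>s. c * f 0 s) (\<lambda>s. complex_of_real (lam 1) * (c * f 0 s))"
    unfolding schrodinger_graph_def
  proof (intro conjI)
    show "(\<lambda>s. complex_of_real (lam 1) * (c * f 0 s)) \<in> L2 L"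
      by (intro L2_cmult W01_L2(1)[OF W])
    from E obtain dg where dg: "W01 K L (f 0) dg" "\<And>v dv. W01 K L v dv \<Longrightarrow>
        (LINT s|arc_measure L. dg s * cnj (dv s) + complex_of_real (V s) * f 0 s * cnj (v s))
          = (LINT s|arc_measure L. complex_of_real (lam 1) * f 0 s * cnj (v s))"
      unfolding eigenspace_def schrodinger_graph_def by blast
    have "(LINT s|arc_measure L. (c * dg s) * cnj (dv s) + complex_of_real (V s) * (c * f 0 s) * cnj (v s))
          = (LINT s|arc_measure L. complex_of_real (lam 1) * (c * f 0 s) * cnj (v s))"
      if "W01 K L v dv" for v dv
    proof -
      have "(LINT s|arc_measure L. (c * dg s) * cnj (dv s) + complex_of_real (V s) * (c * f 0 s) * cnj (v s))
        = (LINT s|arc_measure L. c * (dg s * cnj (dv s) + complex_of_real (V s) * f 0 s * cnj (v s)))"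
        by (intro Bochner_Integration.integral_cong) (auto simp: algebra_simps)
      also have "\<dots> = c * (LINT s|arc_measure L. complex_of_real (lam 1) * f 0 s * cnj (v s))"
        by (simp add: dg(2)[OF that])
      also have "\<dots> = (LINT s|arc_measure L. complex_of_real (lam 1) * (c * f 0 s) * cnj (v s))"
        by (subst integral_mult_right_zero[symmetric])
          (intro Bochner_Integration.integral_cong, auto simp: algebra_simps)
      finally show ?thesis .
    qed
    with W01_cmult[OF dg(1), of c] show "\<exists>du. W01 K L (\<lambda>s. c * f 0 s) du \<and> (\<forall>v dv. W01 K L v dv \<longrightarrow>
        (LINT s|arc_measure L. du s * cnj (dv s) + complex_of_real (V s) * (c * f 0 s) * cnj (v s))
          = (LINT s|arc_measure L. complex_of_real (lam 1) * (c * f 0 s) * cnj (v s)))"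
      by blast
  qed
  then have "(\<lambda>s. c * f 0 s) \<in> eigenspace K L V (lam 1)" by (simp add: eigenspace_def)
  moreover have "nsq L (\<lambda>s. c * f 0 s) = 1" using c pos by simp
  ultimately show ?thesis using W01_cmult[OF W, of c] by blast
qed

lemma gap_bound_real:
  fixes \<gamma> :: "real \<Rightarrow> real ^ 'n::finite"
  assumes \<gamma>: "smooth_curve K L \<gamma>"
    and V: "V \<in> borel_measurable (arc_measure L)" "bounded (V ` {0..L})"
    and list: "eigenvalue_list K L V lam"
    and u: "(\<lambda>s. complex_of_real (u1 s)) \<in> eigenspace K L V (lam 1)"
      "(LINT s|arc_measure L. (u1 s)\<^sup>2) = 1"
      "W01 K L (\<lambda>s. complex_of_real (u1 s)) (\<lambda>s. complex_of_real (du1 s))"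
  shows "lam 2 - lam 1
    \<le> 4 * (LINT s|arc_measure L. (du1 s)\<^sup>2 + (curvature K L \<gamma> s)\<^sup>2 / 4 * (u1 s)\<^sup>2)"
proof -
  have "lam 2 - lam 1 \<le> curvature_energy K L \<gamma> (\<lambda>s. complex_of_real (u1 s)) (\<lambda>s. complex_of_real (du1 s))"
    by (rule gap_bound[OF \<gamma> V list u(1) _ u(3)]) (use u(2) in \<open>simp add: nsq_def\<close>)
  also have "\<dots> = (LINT s|arc_measure L. 4 * ((du1 s)\<^sup>2 + (curvature K L \<gamma> s)\<^sup>2 / 4 * (u1 s)\<^sup>2))"
    unfolding curvature_energy_def
    by (intro Bochner_Integration.integral_cong) (auto simp: algebra_simps)
  finally show ?thesis by (simp only: integral_mult_right_zero)
qed

lemma curvature_potential_bound: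
  fixes \<gamma> :: "real \<Rightarrow> real ^ 'n::finite"
  assumes \<gamma>: "smooth_curve K L \<gamma>" and g: "0 < g"
    and list: "eigenvalue_list K L (\<lambda>s. g * (curvature K L \<gamma> s)\<^sup>2) lam"
  shows "lam 2 - lam 1 \<le> max 4 (1 / g) * lam 1" "lam 1 > 0" "lam 2 / lam 1 \<le> max 5 (1 + 1 / g)"
proof -
  define V where "V = (\<lambda>s. g * (curvature K L \<gamma> s)\<^sup>2)"
  note list = list[folded V_def]
  have cont: "continuous_on {0..L} V"
    unfolding V_def by (intro continuous_intros smooth_curve_curvature_continuous[OF \<gamma>])
  have Vm: "V \<in> borel_measurable (arc_measure L)"
    using cont by (intro continuous_imp_measurable_on_sets_lebesgue) auto
  have Vb: "bounded (V ` {0..L})"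
    using cont by (intro compact_imp_bounded compact_continuous_image) auto
  obtain B where "\<forall>s\<in>{0..L}. \<bar>V s\<bar> \<le> B"
    using Vb by (auto simp: bounded_iff)
  then interpret schroedinger K L V B
    using Vm \<gamma> by unfold_locales (auto simp: smooth_curve_def)
  obtain u du where u: "u \<in> eigenspace K L V (lam 1)" "W01 K L u du" "nsq L u = 1"
    using first_eigenfunction_exists[OF list] by blast
  note L2 = W01_L2[OF u(2)]
  have "form u du u du = lam 1 * ip L u u" by (rule eigenfunction_weak[OF u(1,2,2)])
  then have lam1: "lam 1 = nsq L du + Re (ip L (Vm u) u)"
    using energy_eq[of u du] u(3) by (simp add: energy_def ip_self)
  define k where "k = (LINT s|arc_measure L. (curvature K L \<gamma> s)\<^sup>2 * (cmod (u s))\<^sup>2)"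
  have "ip L (Vm u) u = (LINT s|arc_measure L. complex_of_real (V s * (cmod (u s))\<^sup>2))"
    unfolding ip_def Vm_def
    by (intro Bochner_Integration.integral_cong) (simp_all add: complex_norm_square mult.assoc del: of_real_power)
  also have "\<dots> = of_real (LINT s|arc_measure L. V s * (cmod (u s))\<^sup>2)"
    by (rule integral_complex_of_real)
  also have "(LINT s|arc_measure L. V s * (cmod (u s))\<^sup>2) = g * k"
    unfolding V_def k_def by (simp add: mult.assoc)
  finally have lam1: "lam 1 = nsq L du + g * k" using lam1 by simp
  have int: "integrable (arc_measure L) (\<lambda>s. V s * (cmod (u s))\<^sup>2)"
  proof -
    have "integrable (arc_measure L) (\<lambda>s. Re (Vm u s * cnj (u s)))"
      by (intro integrable_Re ip_integrable Vm_L2 L2)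
    moreover have "(\<lambda>s. Re (Vm u s * cnj (u s))) = (\<lambda>s. V s * (cmod (u s))\<^sup>2)"
      unfolding cmod_power2 by (auto simp: Vm_def power2_eq_square algebra_simps)
    ultimately show ?thesis by simp
  qed
  have int': "integrable (arc_measure L) (\<lambda>s. (curvature K L \<gamma> s)\<^sup>2 * (cmod (u s))\<^sup>2)"
    using integrable_mult_right[OF int, of "1 / g"] g by (simp add: V_def)
  have energy: "curvature_energy K L \<gamma> u du = 4 * nsq L du + k"
    unfolding curvature_energy_def k_def nsq_def using L2_D(2)[OF L2(2)] int' by simp
  have "0 \<le> k" unfolding k_def by simp
  \<comment> \<open>The least constant with \<open>4 \<le> M\<close> and
    \<open>1 \<le> M * g\<close>, so that both parts of \<open>lam 1 = nsq L du + g * k\<close>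
    dominate their counterparts in the curvature energy.\<close>
  define M where "M = max 4 (1 / g)"
  have "4 * nsq L du \<le> M * nsq L du" by (intro mult_right_mono) (auto simp: M_def)
  moreover have "k \<le> M * (g * k)"
  proof -
    have "1 \<le> M * g" using g by (simp add: M_def max_def field_simps)
    from mult_right_mono[OF this \<open>0 \<le> k\<close>] show ?thesis by (simp add: mult.assoc)
  qed
  ultimately have le: "curvature_energy K L \<gamma> u du \<le> M * lam 1"
    unfolding energy lam1 by (simp add: distrib_left)
  then show gap: "lam 2 - lam 1 \<le> max 4 (1 / g) * lam 1"
    using gap_bound[OF \<gamma> Vm Vb list u(1,3,2)] by (simp add: M_def)
  \<comment> \<open>Positivity of \<open>lam 1\<close> is read off from the estimate itself, whose
    left side is positive.\<close>
  have "0 < M * lam 1" using curvature_energy_pos[OF \<gamma> u(2,3)] le by linarith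
  moreover have "0 < M" by (simp add: M_def)
  ultimately show pos: "lam 1 > 0" by (simp add: zero_less_mult_iff)
  have "max 5 (1 + 1 / g) = 1 + max 4 (1 / g)" by (simp add: max_def)
  then show "lam 2 / lam 1 \<le> max 5 (1 + 1 / g)"
    using gap pos by (simp add: field_simps)
qed

section \<open>The circle\<close>

abbreviation (input) expi :: "int \<Rightarrow> real \<Rightarrow> complex" where
  "expi m \<equiv> (\<lambda>s. cis (of_int m * s))"

lemma expi_deriv: "(expi m has_vector_derivative \<i> * of_int m * expi m s) (at s within S)"
proof -
  have "((\<lambda>z. exp (\<i> * of_int m * z)) has_field_derivative \<i> * of_int m * exp (\<i> * of_int m * of_real s))
      (at (of_real s))"
    by (rule derivative_eq_intros refl | simp)+
  then have "((\<lambda>s. exp (\<i> * of_int m * of_real s)) has_vector_derivative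
      \<i> * of_int m * exp (\<i> * of_int m * of_real s)) (at s within S)"
    by (rule has_vector_derivative_real_field)
  then show ?thesis by (simp add: cis_conv_exp mult.assoc)
qed

lemma expi_test: "expi m \<in> test_functions Closed_Curve (2 * pi)"
proof -
  have "smooth_on UNIV (expi m)"
    unfolding smooth_on_def
  proof (intro exI[of _ "\<lambda>k s. (\<i> * of_int m) ^ k * expi m s"] conjI allI ballI)
    fix k t
    have "((\<lambda>s. (\<i> * of_int m) ^ k * expi m s) has_vector_derivative
        (\<i> * of_int m) ^ k * (\<i> * of_int m * expi m t)) (at t within UNIV)"
      by (intro has_vector_derivative_mult_right expi_deriv)
    then show "((\<lambda>s. (\<i> * of_int m) ^ k * expi m s) has_vector_derivative
        (\<i> * of_int m) ^ Suc k * expi m t) (at t within UNIV)"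
      by (simp add: mult_ac)
  qed simp
  moreover have "expi m (s + 2 * pi) = expi m s" for s
  proof -
    have "of_int m * (s + 2 * pi) = of_int m * s + 2 * pi * of_int m" by (simp add: algebra_simps)
    then show ?thesis by (simp flip: cis_mult)
  qed
  ultimately show ?thesis by (simp add: test_functions_def)
qed

lemma W01_expi: "W01 Closed_Curve (2 * pi) (expi m) (\<lambda>s. \<i> * of_int m * expi m s)"
proof -
  have "dt (expi m) = (\<lambda>s. \<i> * of_int m * expi m s)"
    by (intro ext vector_derivative_at expi_deriv)
  then show ?thesis using W01_test[OF expi_test[of m]] by simp
qed

lemmas expi_L2 [simp] = W01_L2(1)[OF W01_expi]

lemma nsq_expi: "nsq (2 * pi) (expi m) = 2 * pi"
  by (simp add: nsq_def measure_restrict_space)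

text \<open>Orthogonality needs no explicit integral: integration by parts shows that the inner
  product is unchanged when its factor \<open>m\<close> is replaced by \<open>n\<close>.\<close>

lemma ip_expi_expi: "ip (2 * pi) (expi m) (expi n) = (if m = n then 2 * pi else 0)"
proof (cases "m = n")
  case False
  have "\<i> * of_int m * ip (2 * pi) (expi m) (expi n) = \<i> * of_int n * ip (2 * pi) (expi m) (expi n)"
    using W01_parts[OF W01_expi[of m] W01_expi[of n]] by simp
  then have "\<i> * (of_int m - of_int n) * ip (2 * pi) (expi m) (expi n) = 0"
    by (simp add: algebra_simps)
  then show ?thesis using False by simp
qed (simp add: ip_self nsq_expi)

lemma ip_deriv_expi:
  assumes "W01 Closed_Curve (2 * pi) u du"
  shows "ip (2 * pi) du (\<lambda>s. \<i> * of_int m * expi m s) = (of_int m)\<^sup>2 * ip (2 * pi) u (expi m)"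
    and "ip (2 * pi) (\<lambda>s. \<i> * of_int m * expi m s) du = (of_int m)\<^sup>2 * ip (2 * pi) (expi m) u"
proof -
  have "ip (2 * pi) du (expi m) = \<i> * of_int m * ip (2 * pi) u (expi m)"
    using W01_parts[OF assms W01_expi[of m]] by simp
  then show *: "ip (2 * pi) du (\<lambda>s. \<i> * of_int m * expi m s) = (of_int m)\<^sup>2 * ip (2 * pi) u (expi m)"
    by (simp add: power2_eq_square algebra_simps)
  show "ip (2 * pi) (\<lambda>s. \<i> * of_int m * expi m s) du = (of_int m)\<^sup>2 * ip (2 * pi) (expi m) u"
    unfolding ip_cnj[of _ _ du] * ip_cnj[of _ _ u] by simp
qed

section \<open>Trigonometric polynomials and completeness of the exponentials\<close>

inductive_set trig :: "(real \<Rightarrow> complex) set" where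
  expi: "expi m \<in> trig"
| cmult: "p \<in> trig \<Longrightarrow> (\<lambda>s. c * p s) \<in> trig"
| add: "p \<in> trig \<Longrightarrow> q \<in> trig \<Longrightarrow> (\<lambda>s. p s + q s) \<in> trig"

lemma trig_const: "(\<lambda>s. c) \<in> trig"
  using trig.cmult[OF trig.expi[of 0], of c] by simp

lemma trig_expi_mult:
  assumes "q \<in> trig"
  shows "(\<lambda>s. expi m s * q s) \<in> trig"
  using assms
proof induction
  case (expi n)
  have "(\<lambda>s. expi m s * expi n s) = expi (m + n)"
    by (simp add: cis_mult algebra_simps)
  then show ?case using trig.expi[of "m + n"] by simp
next
  case (cmult q c)
  then show ?case using trig.cmult[OF cmult.IH, of c] by (simp add: mult_ac)
next
  case (add q r)
  then show ?case using trig.add[OF add.IH] by (simp add: distrib_left)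
qed

lemma trig_mult:
  assumes "p \<in> trig" "q \<in> trig"
  shows "(\<lambda>s. p s * q s) \<in> trig"
  using assms(1)
proof induction
  case (expi m)
  show ?case by (rule trig_expi_mult[OF assms(2)])
next
  case (cmult p c)
  then show ?case using trig.cmult[OF cmult.IH, of c] by (simp add: mult_ac)
next
  case (add p r)
  then show ?case using trig.add[OF add.IH] by (simp add: distrib_right)
qed

lemma trig_L2: "p \<in> trig \<Longrightarrow> p \<in> L2 (2 * pi)"
  by (induction rule: trig.induct) auto

lemma trig_orthogonal:
  assumes "u \<in> L2 (2 * pi)" "\<And>m. ip (2 * pi) u (expi m) = 0" "p \<in> trig"
  shows "ip (2 * pi) u p = 0"
  using assms(3)
proof induction
  case (add p q)
  then show ?case using assms(1) by (simp add: ip_add_right trig_L2)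
qed (simp_all add: assms(2))

lemma trig_real_polynomial:
  fixes p :: "complex \<Rightarrow> real"
  assumes "real_polynomial_function p"
  shows "(\<lambda>s. complex_of_real (p (cis s))) \<in> trig"
  using assms
proof induction
  case (linear f)
  interpret bounded_linear f by fact
  have f: "f (cis s) = cos s * f 1 + sin s * f \<i>" for s
  proof -
    have "cis s = cos s *\<^sub>R 1 + sin s *\<^sub>R \<i>" by (simp add: complex_eq_iff)
    then show ?thesis by (simp only: add scaleR real_scaleR_def)
  qed
  \<comment> \<open>Euler's formulas for the cosine and the sine.\<close>
  have "complex_of_real (f (cis s)) =
      ((f 1 - \<i> * f \<i>) / 2) * expi 1 s + ((f 1 + \<i> * f \<i>) / 2) * expi (-1) s" for s
    by (simp add: f complex_eq_iff field_simps)
  then show ?case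
    using trig.add[OF trig.cmult[OF trig.expi] trig.cmult[OF trig.expi],
        of "(f 1 - \<i> * f \<i>) / 2" 1 "(f 1 + \<i> * f \<i>) / 2" "-1"] by simp
next
  case (const c)
  show ?case by (rule trig_const)
next
  case (add f g)
  show ?case using trig.add[OF add.IH] by simp
next
  case (mult f g)
  show ?case using trig_mult[OF mult.IH] by simp
qed

lemma trig_polynomial_function:
  fixes p :: "complex \<Rightarrow> complex"
  assumes "polynomial_function p"
  shows "(\<lambda>s. p (cis s)) \<in> trig"
proof -
  have "real_polynomial_function (\<lambda>z. Re (p z))" "real_polynomial_function (\<lambda>z. Im (p z))"
    using assms bounded_linear_Re bounded_linear_Im unfolding polynomial_function_def o_def by blast+
  then have "(\<lambda>s. complex_of_real (Re (p (cis s)))) \<in> trig" "(\<lambda>s. complex_of_real (Im (p (cis s)))) \<in> trig"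
    by (auto intro: trig_real_polynomial)
  from trig.add[OF this(1) trig.cmult[OF this(2), of \<i>]]
  show ?thesis by (simp flip: complex_eq)
qed

text \<open>A continuous function on the line of period \<open>2 * pi\<close> is a continuous function on the unit
  circle, because the closed sets of the circle are the images of those of \<open>{0..2 * pi}\<close>.\<close>

lemma periodic_continuous_circle:
  fixes \<phi> :: "real \<Rightarrow> complex"
  assumes cont: "continuous_on {0..2 * pi} \<phi>" and per: "\<phi> (2 * pi) = \<phi> 0"
  shows "\<exists>F. continuous_on (sphere 0 1) F \<and> (\<forall>s\<in>{0..2 * pi}. F (cis s) = \<phi> s)"
proof -
  define F where "F z = \<phi> (Arg2pi z)" for z
  have F: "F (cis s) = \<phi> s" if "s \<in> {0..2 * pi}" for s
  proof (cases "s = 2 * pi")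
    case True
    have "Arg2pi 1 = 0" by (simp add: Arg2pi_eq_0)
    then show ?thesis using True per by (simp add: F_def)
  next
    case False
    then have "Arg2pi (cis s) = s"
      using that by (intro Arg2pi_unique[of 1]) (auto simp: cis_conv_exp)
    then show ?thesis by (simp add: F_def)
  qed
  have "continuous_on (sphere 0 1) F"
  proof (subst continuous_on_closed_vimage)
    show "\<forall>C. closed C \<longrightarrow> closed (F -` C \<inter> sphere 0 1)"
    proof (intro allI impI)
      fix C :: "complex set" assume "closed C"
      then have "closed (\<phi> -` C \<inter> {0..2 * pi})"
        using cont by (subst (asm) continuous_on_closed_vimage) auto
      then have "compact (\<phi> -` C \<inter> {0..2 * pi})"
        by (simp add: compact_eq_bounded_closed bounded_Int)
      then have "compact (cis ` (\<phi> -` C \<inter> {0..2 * pi}))"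
        by (rule compact_continuous_image[rotated]) (intro continuous_intros)
      moreover have "cis ` (\<phi> -` C \<inter> {0..2 * pi}) = F -` C \<inter> sphere 0 1"
      proof (intro equalityI subsetI)
        fix z assume z: "z \<in> F -` C \<inter> sphere 0 1"
        have "z = cis (Arg2pi z)"
          using Arg2pi[of z] z by (simp add: cis_conv_exp is_Arg_def)
        moreover have "Arg2pi z \<in> {0..2 * pi}"
          using Arg2pi[of z] by auto
        moreover have "\<phi> (Arg2pi z) \<in> C" using z by (simp add: F_def)
        ultimately show "z \<in> cis ` (\<phi> -` C \<inter> {0..2 * pi})" by blast
      next
        fix z assume "z \<in> cis ` (\<phi> -` C \<inter> {0..2 * pi})"
        then obtain s where "z = cis s" "s \<in> {0..2 * pi}" "\<phi> s \<in> C" by blast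
        then show "z \<in> F -` C \<inter> sphere 0 1" using F[of s] by simp
      qed
      ultimately show "closed (F -` C \<inter> sphere 0 1)" by (simp add: compact_imp_closed)
    qed
  qed simp
  then show ?thesis using F by blast
qed

text \<open>Stone-Weierstrass on the unit circle: a polynomial in the real and imaginary parts of
  \<open>cis s\<close> is a trigonometric polynomial in \<open>s\<close>.\<close>

lemma trig_dense:
  fixes \<phi> :: "real \<Rightarrow> complex"
  assumes cont: "continuous_on {0..2 * pi} \<phi>" and per: "\<phi> (2 * pi) = \<phi> 0" and e: "0 < e"
  shows "\<exists>p\<in>trig. \<forall>s\<in>{0..2 * pi}. cmod (\<phi> s - p s) < e"
proof -
  obtain F where F: "continuous_on (sphere 0 1) F" "\<And>s. s \<in> {0..2 * pi} \<Longrightarrow> F (cis s) = \<phi> s"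
    using periodic_continuous_circle[OF cont per] by blast
  obtain p where p: "polynomial_function p" "\<And>z. z \<in> sphere 0 1 \<Longrightarrow> norm (F z - p z) < e"
    using Stone_Weierstrass_polynomial_function[OF compact_sphere F(1) e] by blast
  have "cmod (\<phi> s - p (cis s)) < e" if "s \<in> {0..2 * pi}" for s
    using p(2)[of "cis s"] F(2)[OF that] by simp
  then show ?thesis using trig_polynomial_function[OF p(1)]
    by (intro bexI[of _ "\<lambda>s. p (cis s)"] ballI)
qed

text \<open>A function orthogonal to all exponentials is no farther from 0 than from any
  trigonometric polynomial. These come arbitrarily close: a test function approximates
  \<open>u\<close> in L2, and a trigonometric polynomial approximates the test function
  uniformly.\<close>

lemma expi_complete:
  assumes u: "W01 Closed_Curve (2 * pi) u du" and orth: "\<And>m. ip (2 * pi) u (expi m) = 0"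
  shows "nsq (2 * pi) u = 0"
proof -
  note uL2 = W01_L2(1)[OF u]
  have "nsq (2 * pi) u \<le> 0 + e" if e: "0 < e" for e
  proof -
    obtain \<phi> where \<phi>: "\<phi> \<in> test_functions Closed_Curve (2 * pi)" "nsq (2 * pi) (\<lambda>s. \<phi> s - u s) < e / 4"
      using W01_approx_within[OF u, of "e / 4"] e by auto
    have \<phi>L2: "\<phi> \<in> L2 (2 * pi)" by (rule test_L2[OF \<phi>(1)])
    have "\<exists>p. \<forall>n::nat. p n \<in> trig \<and> (\<forall>s\<in>{0..2 * pi}. cmod (\<phi> s - p n s) < 1 / Suc n)"
    proof (intro choice allI)
      fix n :: nat
      show "\<exists>p. p \<in> trig \<and> (\<forall>s\<in>{0..2 * pi}. cmod (\<phi> s - p s) < 1 / Suc n)"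
        using trig_dense[OF test_continuous[OF \<phi>(1)] test_boundary[OF \<phi>(1)], of "1 / Suc n"] by auto
    qed
    then obtain p where p: "\<And>n::nat. p n \<in> trig"
      "\<And>n s. s \<in> {0..2 * pi} \<Longrightarrow> cmod (\<phi> s - p n s) < 1 / Suc n" by blast
    have "L2_tendsto (2 * pi) p \<phi>"
    proof (rule L2_tendsto_uniform)
      fix d :: real assume "0 < d"
      then obtain N where N: "1 / Suc N < d" using nat_approx_posE by blast
      have "cmod (p n s - \<phi> s) < d" if "N \<le> n" "s \<in> {0..2 * pi}" for n s
      proof -
        have "1 / real (Suc n) \<le> 1 / Suc N" using that(1) by (intro divide_left_mono) auto
        then show ?thesis using p(2)[OF that(2), of n] N norm_minus_commute[of "p n s" "\<phi> s"] by linarith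
      qed
      then show "\<exists>N. \<forall>n s. N \<le> n \<and> s \<in> {0..2 * pi} \<longrightarrow> cmod (p n s - \<phi> s) < d" by blast
    qed (use trig_L2[OF p(1)] \<phi>L2 in auto)
    then have "\<forall>\<^sub>F n in sequentially. nsq (2 * pi) (\<lambda>s. p n s - \<phi> s) < e / 4"
      using e unfolding L2_tendsto_iff by (intro order_tendstoD) auto
    then obtain n where n: "nsq (2 * pi) (\<lambda>s. p n s - \<phi> s) < e / 4"
      by (auto simp: eventually_sequentially)
    have pL2: "p n \<in> L2 (2 * pi)" by (rule trig_L2[OF p(1)])
    \<comment> \<open>Pythagoras, as \<open>u\<close> is orthogonal to \<open>p n\<close>.\<close>
    have "nsq (2 * pi) u \<le> nsq (2 * pi) (\<lambda>s. u s - p n s)"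
      using nsq_diff[OF uL2 pL2] trig_orthogonal[OF uL2 orth p(1), of n] nsq_nonneg[of "2 * pi" "p n"]
      by simp
    also have "\<dots> \<le> 2 * nsq (2 * pi) (\<lambda>s. \<phi> s - u s) + 2 * nsq (2 * pi) (\<lambda>s. p n s - \<phi> s)"
      using nsq_triangle[OF uL2 \<phi>L2 pL2] nsq_minus_commute[of "2 * pi" u \<phi>]
        nsq_minus_commute[of "2 * pi" \<phi> "p n"] by simp
    finally show ?thesis using n \<phi>(2) by simp
  qed
  then have "nsq (2 * pi) u \<le> 0" by (rule field_le_epsilon)
  then show ?thesis using nsq_nonneg[of "2 * pi" u] by linarith
qed

section \<open>The eigenvalues of the circle\<close>

lemma L2_sum: "finite A \<Longrightarrow> (\<And>n. n \<in> A \<Longrightarrow> f n \<in> L2 L) \<Longrightarrow> (\<lambda>s. \<Sum>n\<in>A. f n s) \<in> L2 L"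
  by (induction rule: finite_induct) auto

lemma ip_sum_left:
  assumes "finite A" "\<And>n. n \<in> A \<Longrightarrow> f n \<in> L2 L" "h \<in> L2 L"
  shows "ip L (\<lambda>s. \<Sum>n\<in>A. f n s) h = (\<Sum>n\<in>A. ip L (f n) h)"
  using assms
proof (induction rule: finite_induct)
  case empty
  then show ?case by (simp add: ip_def)
next
  case (insert n A)
  then show ?case by (simp add: ip_add_left L2_sum)
qed

lemma W01_trig_sum:
  fixes c :: "int \<Rightarrow> complex"
  assumes "finite A"
  shows "\<exists>dp. W01 Closed_Curve (2 * pi) (\<lambda>s. \<Sum>n\<in>A. c n * expi n s) dp"
  using assms
proof (induction rule: finite_induct)
  case empty
  show ?case using W01_cmult[OF W01_expi, of 0] by auto
next
  case (insert n A)
  then obtain dp where "W01 Closed_Curve (2 * pi) (\<lambda>s. \<Sum>n\<in>A. c n * expi n s) dp" by blast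
  from W01_add[OF W01_cmult[OF W01_expi] this] show ?case using insert by auto
qed

lemma ip_trig_sum:
  fixes c :: "int \<Rightarrow> complex"
  assumes "finite A"
  shows "ip (2 * pi) (\<lambda>s. \<Sum>n\<in>A. c n * expi n s) (expi m) = (if m \<in> A then 2 * pi * c m else 0)"
proof -
  have "ip (2 * pi) (\<lambda>s. \<Sum>n\<in>A. c n * expi n s) (expi m) = (\<Sum>n\<in>A. c n * ip (2 * pi) (expi n) (expi m))"
    using assms by (subst ip_sum_left) auto
  also have "\<dots> = (\<Sum>n\<in>A. if n = m then 2 * pi * c m else 0)"
    by (intro sum.cong) (auto simp: ip_expi_expi)
  finally show ?thesis using assms by (simp add: sum.delta)
qed

lemma schroedinger_circle: "schroedinger (2 * pi) (\<lambda>_. g) \<bar>g\<bar>"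
  by unfold_locales auto

lemma form_circle:
  "schroedinger.form (2 * pi) (\<lambda>_. g) f df h dh = ip (2 * pi) df dh + of_real g * ip (2 * pi) f h"
  unfolding schroedinger.form_def[OF schroedinger_circle] schroedinger.Vm_def[OF schroedinger_circle]
  by simp

lemma expi_eigenfunction:
  "expi m \<in> eigenspace Closed_Curve (2 * pi) (\<lambda>_. g) ((of_int m)\<^sup>2 + g)"
  unfolding schroedinger.eigenspace_iff[OF schroedinger_circle] form_circle
  using W01_expi[of m] ip_deriv_expi(2)[of _ _ m] by (auto simp: distrib_right)

text \<open>The weak equation tested with \<open>expi m\<close> says that the coefficient times
  \<open>m^2 + g - \<mu>\<close> is 0.\<close>

lemma eigenfunction_coefficient:
  assumes "u \<in> eigenspace Closed_Curve (2 * pi) (\<lambda>_. g) \<mu>" "(of_int m)\<^sup>2 + g \<noteq> \<mu>"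
  shows "ip (2 * pi) u (expi m) = 0"
proof -
  obtain du where W: "W01 Closed_Curve (2 * pi) u du"
    and "ip (2 * pi) du (\<lambda>s. \<i> * of_int m * expi m s) + of_real g * ip (2 * pi) u (expi m)
      = \<mu> * ip (2 * pi) u (expi m)"
    using assms(1) W01_expi[of m]
    unfolding schroedinger.eigenspace_iff[OF schroedinger_circle] form_circle by blast
  then have "((of_int m)\<^sup>2 + of_real g - of_real \<mu>) * ip (2 * pi) u (expi m) = 0"
    unfolding ip_deriv_expi(1)[OF W] by (simp add: algebra_simps)
  moreover have "(of_int m)\<^sup>2 + of_real g - of_real \<mu> = complex_of_real ((of_int m)\<^sup>2 + g - \<mu>)" by simp
  moreover have "complex_of_real ((of_int m)\<^sup>2 + g - \<mu>) \<noteq> 0"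
    using assms(2) by (simp only: of_real_eq_0_iff)
  ultimately show ?thesis by (metis mult_eq_0_iff)
qed

text \<open>An eigenfunction minus its finite Fourier sum over \<open>A\<close> is orthogonal to
  every exponential: for frequencies in \<open>A\<close> by the choice of the coefficients, for the
  others by \<open>eigenfunction_coefficient\<close>. Completeness makes the difference null. If
  \<open>\<mu>\<close> is no eigenvalue, \<open>A\<close> is empty and the dimension is 0.\<close>

lemma eigenspace_circle_dim:
  fixes g \<mu> :: real
  defines "A \<equiv> {n::int. (of_int n)\<^sup>2 + g = \<mu>}"
  assumes fin: "finite A"
  shows "has_L2_dim (2 * pi) (eigenspace Closed_Curve (2 * pi) (\<lambda>_. g) \<mu>) (card A)"
proof -
  obtain h where h: "bij_betw h {..<card A} A"
    using ex_bij_betw_nat_finite[OF fin] by (auto simp: atLeast0LessThan)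
  have sum_h: "(\<Sum>i<card A. c (h i) * expi (h i) s) = (\<Sum>n\<in>A. c n * expi n s)" for c s
    by (rule sum.reindex_bij_betw[OF h])
  have mem: "h i \<in> A" if "i < card A" for i
    using h that by (auto simp: bij_betw_def)
  show ?thesis
    unfolding has_L2_dim_def
  proof (intro exI[of _ "\<lambda>i. expi (h i)"] conjI allI impI ballI)
    fix i assume "i < card A"
    then show "expi (h i) \<in> eigenspace Closed_Curve (2 * pi) (\<lambda>_. g) \<mu>"
      using mem[of i] expi_eigenfunction[of "h i" g] by (simp add: A_def)
  next
    fix c :: "nat \<Rightarrow> complex" and i
    assume z: "AE s in arc_measure (2 * pi). (\<Sum>i<card A. c i * expi (h i) s) = 0" and i: "i < card A"
    define d where "d n = c (inv_into {..<card A} h n)" for n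
    have d: "d (h i) = c i" if "i < card A" for i
      using h that by (simp add: d_def bij_betw_def)
    let ?p = "\<lambda>s. \<Sum>n\<in>A. d n * expi n s"
    have p: "?p s = (\<Sum>i<card A. c i * expi (h i) s)" for s
      unfolding sum_h[symmetric] by (intro sum.cong) (simp_all add: d)
    have pL2: "?p \<in> L2 (2 * pi)" by (intro L2_sum fin L2_cmult expi_L2)
    have "nsq (2 * pi) ?p = 0"
      using nsq_eq_0_iff[OF pL2] z by (simp only: p)
    \<comment> \<open>A null function has vanishing inner products, and the one with
      \<open>expi (h i)\<close> reads off \<open>2 * pi * c i\<close>.\<close>
    then have "cmod (ip (2 * pi) ?p (expi (h i))) \<le> 0"
      using ip_le[OF pL2 expi_L2, of "h i"] by simp
    then show "c i = 0"
      using ip_trig_sum[OF fin, of d "h i"] mem[OF i] d[OF i] by simp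
  next
    fix u assume u: "u \<in> eigenspace Closed_Curve (2 * pi) (\<lambda>_. g) \<mu>"
    then obtain du where W: "W01 Closed_Curve (2 * pi) u du"
      unfolding schroedinger.eigenspace_iff[OF schroedinger_circle] by blast
    define c where "c n = ip (2 * pi) u (expi n) / (2 * pi)" for n
    let ?p = "\<lambda>s. \<Sum>n\<in>A. c n * expi n s"
    obtain dp where dp: "W01 Closed_Curve (2 * pi) ?p dp" using W01_trig_sum[OF fin] by blast
    note Wr = W01_diff[OF W dp]
    have "ip (2 * pi) (\<lambda>s. u s - ?p s) (expi m) = 0" for m
    proof -
      have "ip (2 * pi) (\<lambda>s. u s - ?p s) (expi m) = ip (2 * pi) u (expi m) - (if m \<in> A then 2 * pi * c m else 0)"
        using ip_diff_left[OF W01_L2(1)[OF W] W01_L2(1)[OF dp] expi_L2] ip_trig_sum[OF fin] by simp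
      also have "\<dots> = 0"
      proof (cases "m \<in> A")
        case False
        then show ?thesis using eigenfunction_coefficient[OF u, of m] by (simp add: A_def)
      qed (simp add: c_def)
      finally show ?thesis .
    qed
    then have "nsq (2 * pi) (\<lambda>s. u s - ?p s) = 0" by (rule expi_complete[OF Wr])
    then have "AE s in arc_measure (2 * pi). u s - ?p s = 0"
      using nsq_eq_0_iff[OF W01_L2(1)[OF Wr]] by simp
    then have "AE s in arc_measure (2 * pi). u s = (\<Sum>i<card A. c (h i) * expi (h i) s)"
      unfolding sum_h by simp
    then show "\<exists>d. AE s in arc_measure (2 * pi). u s = (\<Sum>i<card A. d i * expi (h i) s)"
      by (rule exI[of _ "\<lambda>i. c (h i)"])
  qed
qed

text \<open>From index 1 on this runs through 0, 1, -1, 2, -2, ..., that is, through the frequencies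
  in the order of their squares, which are \<open>(k div 2)^2\<close>.\<close>

definition zigzag :: "nat \<Rightarrow> int" where
  "zigzag k = (if even k then int (k div 2) else - int (k div 2))"

lemma bij_zigzag: "bij_betw zigzag {1..} UNIV"
proof (rule bij_betwI')
  fix k l assume "k \<in> {1::nat..}" "l \<in> {1::nat..}"
  then show "zigzag k = zigzag l \<longleftrightarrow> k = l"
    by (auto simp: zigzag_def split: if_splits; presburger)
next
  fix n :: int
  show "\<exists>k\<in>{1..}. n = zigzag k"
  proof (cases "0 < n")
    case True
    then show ?thesis by (intro bexI[of _ "2 * nat n"]) (auto simp: zigzag_def)
  next
    case False
    then show ?thesis by (intro bexI[of _ "2 * nat (- n) + 1"]) (auto simp: zigzag_def)
  qed
qed simp

lemma zigzag_square: "(real_of_int (zigzag k))\<^sup>2 = (real (k div 2))\<^sup>2"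
  by (simp add: zigzag_def)

lemma finite_int_square_eq: "finite {n::int. (real_of_int n)\<^sup>2 + g = \<mu>}"
proof (rule finite_subset)
  show "{n::int. (real_of_int n)\<^sup>2 + g = \<mu>} \<subseteq> {- \<lceil>sqrt \<bar>\<mu> - g\<bar>\<rceil>..\<lceil>sqrt \<bar>\<mu> - g\<bar>\<rceil>}"
  proof
    fix n assume "n \<in> {n::int. (real_of_int n)\<^sup>2 + g = \<mu>}"
    then have "(real_of_int n)\<^sup>2 = \<mu> - g" by simp
    then have "\<bar>real_of_int n\<bar> = sqrt \<bar>\<mu> - g\<bar>"
      by (metis abs_of_nonneg real_sqrt_abs zero_le_power2)
    then show "n \<in> {- \<lceil>sqrt \<bar>\<mu> - g\<bar>\<rceil>..\<lceil>sqrt \<bar>\<mu> - g\<bar>\<rceil>}" by auto linarith+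
  qed
qed simp

text \<open>\<open>zigzag\<close> matches the indices that carry a value with the frequencies that
  produce it, so multiplicities in the list equal dimensions of eigenspaces.\<close>

lemma eigenvalue_list_circle:
  "eigenvalue_list Closed_Curve (2 * pi) (\<lambda>_. g) (\<lambda>k. (real (k div 2))\<^sup>2 + g)"
  unfolding eigenvalue_list_def
proof (intro conjI allI)
  show "mono_on {1..} (\<lambda>k. (real (k div 2))\<^sup>2 + g)"
    by (intro mono_onI) (auto intro!: power_mono div_le_mono)
  fix \<mu>
  let ?A = "{n::int. (of_int n)\<^sup>2 + g = \<mu>}" and ?N = "{k. 1 \<le> k \<and> (real (k div 2))\<^sup>2 + g = \<mu>}"
  have "zigzag ` ?N = ?A"
  proof (intro equalityI subsetI)
    fix n assume n: "n \<in> ?A"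
    have "n \<in> zigzag ` {1..}" using bij_zigzag by (simp add: bij_betw_def)
    then obtain k where "1 \<le> k" "n = zigzag k" by auto
    then show "n \<in> zigzag ` ?N" using n by (auto simp: zigzag_square)
  qed (auto simp: zigzag_square)
  then have "bij_betw zigzag ?N ?A"
    by (intro bij_betw_subset[OF bij_zigzag]) auto
  then show "finite ?N"
    "has_L2_dim (2 * pi) (eigenspace Closed_Curve (2 * pi) (\<lambda>_. g) \<mu>) (card ?N)"
    using eigenspace_circle_dim[of g \<mu>, OF finite_int_square_eq] finite_int_square_eq[of g \<mu>]
    by (auto simp: bij_betw_finite bij_betw_same_card)
qed

section \<open>The circle as an embedded curve, and sharpness\<close>

text \<open>Differentiation is a quarter turn, so \<open>k\<close> counts derivatives and the whole
  jet has one formula. The axes \<open>i\<close> and \<open>j\<close> select a coordinate plane,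
  which serves dimensions 2 and 3 alike.\<close>

definition circle :: "'n \<Rightarrow> 'n \<Rightarrow> nat \<Rightarrow> real \<Rightarrow> real ^ 'n::finite" where
  "circle i j k s = cos (s + k * (pi / 2)) *\<^sub>R axis i 1 + sin (s + k * (pi / 2)) *\<^sub>R axis j 1"

lemma circle_deriv: "(circle i j k has_vector_derivative circle i j (Suc k) s) (at s within S)"
proof -
  have eq: "s + real (Suc k) * (pi / 2) = (s + k * (pi / 2)) + pi / 2" by (simp add: algebra_simps)
  have "circle i j (Suc k) s = (- sin (s + k * (pi / 2))) *\<^sub>R axis i 1 + cos (s + k * (pi / 2)) *\<^sub>R axis j 1"
    unfolding circle_def eq by (simp add: cos_add sin_add)
  moreover have "((\<lambda>s. cos (s + k * (pi / 2))) has_real_derivative - sin (s + k * (pi / 2))) (at s within S)"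
    "((\<lambda>s. sin (s + k * (pi / 2))) has_real_derivative cos (s + k * (pi / 2))) (at s within S)"
    by (auto intro!: derivative_eq_intros)
  then have "((\<lambda>s. cos (s + k * (pi / 2)) *\<^sub>R axis i 1 + sin (s + k * (pi / 2)) *\<^sub>R axis j (1::real))
      has_vector_derivative (- sin (s + k * (pi / 2))) *\<^sub>R axis i 1 + cos (s + k * (pi / 2)) *\<^sub>R axis j 1)
      (at s within S)"
    unfolding has_real_derivative_iff_has_vector_derivative
    by (intro has_vector_derivative_add
        bounded_linear.has_vector_derivative[OF bounded_linear_scaleR_left])
  ultimately show ?thesis by (simp add: circle_def[abs_def])
qed

lemma norm_circle:
  assumes "i \<noteq> j"
  shows "norm (circle i j k s) = 1"
  using assms by (simp add: circle_def norm_eq_sqrt_inner inner_add_left inner_add_right inner_axis_axis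
      flip: power2_eq_square)

lemma jet_circle: "jet Closed_Curve (2 * pi) (circle i j)"
  by (rule jetI) (use circle_deriv in \<open>auto simp: circle_def\<close>)

text \<open>With an embedded example, sharpness already holds among curves without
  self-intersections. For injectivity, two coordinates of the point determine \<open>cis s\<close>,
  whose argument in \<open>{0..<2 * pi}\<close> is unique.\<close>

lemma embedded_circle:
  assumes "i \<noteq> j"
  shows "embedded_curve Closed_Curve (2 * pi) (circle i j 0)"
  unfolding embedded_curve_def
proof
  have "vector_derivative (circle i j 0) (at s) = circle i j 1 s" for s
    using circle_deriv[of i j 0 s UNIV] by (simp add: vector_derivative_at)
  moreover have "smooth_on UNIV (circle i j 0)"
    unfolding smooth_on_def using circle_deriv by (intro exI[of _ "circle i j"]) auto
  moreover have "circle i j 0 (s + 2 * pi) = circle i j 0 s" for s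
    by (simp add: circle_def)
  ultimately show "smooth_curve Closed_Curve (2 * pi) (circle i j 0)"
    using norm_circle[OF assms] by (simp add: smooth_curve_def curve_dom_def)
  show "inj_on (circle i j 0) (case Closed_Curve of Closed_Curve \<Rightarrow> {0..<2 * pi} | Arc \<Rightarrow> {0..2 * pi})"
  proof (rule inj_onI)
    fix s t assume st: "s \<in> (case Closed_Curve of Closed_Curve \<Rightarrow> {0..<2 * pi} | Arc \<Rightarrow> {0..2 * pi})"
      "t \<in> (case Closed_Curve of Closed_Curve \<Rightarrow> {0..<2 * pi} | Arc \<Rightarrow> {0..2 * pi})"
      and eq: "circle i j 0 s = circle i j 0 t"
    have "cis s = cis t"
      using arg_cong[OF eq, of "\<lambda>v. v $ i"] arg_cong[OF eq, of "\<lambda>v. v $ j"] assms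
      by (simp add: circle_def axis_def complex_eq_iff)
    moreover have "Arg2pi (cis s) = s" if "0 \<le> s" "s < 2 * pi" for s
      using that by (intro Arg2pi_unique[of 1]) (auto simp: cis_conv_exp)
    ultimately show "s = t" using st by (metis atLeastLessThan_iff curve_type.case(1))
  qed
qed

lemma curvature_circle:
  assumes "i \<noteq> j"
  shows "curvature Closed_Curve (2 * pi) (circle i j 0) = (\<lambda>_. 1)"
proof -
  have "smooth_curve Closed_Curve (2 * pi) (circle i j 0)"
    using embedded_circle[OF assms] by (simp add: embedded_curve_def)
  from curve_jetI[OF this jet_circle refl] show ?thesis
    using norm_circle[OF assms, of 2] by (auto simp: curve_jet_def curve_dom_def)
qed

lemma circle_sharp:
  fixes i j :: "'n::finite"
  assumes ij: "i \<noteq> j" and g: "0 < g" "g \<le> 1 / 4" and C: "C < max 5 (1 + 1 / g)"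
  shows "\<exists>K L (\<gamma> :: real \<Rightarrow> real ^ 'n) lam.
    embedded_curve K L \<gamma> \<and> eigenvalue_list K L (\<lambda>s. g * (curvature K L \<gamma> s)\<^sup>2) lam \<and> lam 2 / lam 1 > C"
proof (intro exI conjI)
  show "embedded_curve Closed_Curve (2 * pi) (circle i j 0)" by (rule embedded_circle[OF ij])
  show "eigenvalue_list Closed_Curve (2 * pi)
      (\<lambda>s. g * (curvature Closed_Curve (2 * pi) (circle i j 0) s)\<^sup>2) (\<lambda>k. (real (k div 2))\<^sup>2 + g)"
    using eigenvalue_list_circle[of g] by (simp add: curvature_circle[OF ij])
  \<comment> \<open>This is where \<open>g \<le> 1 / 4\<close> enters: the maximum is
    \<open>1 + 1 / g\<close>.\<close>
  have "4 \<le> 1 / g" using g by (simp add: field_simps)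
  then have "C < 1 + 1 / g" using C by simp
  \<comment> \<open>Since \<open>2 div 2 = 1\<close> and \<open>1 div 2 = 0\<close>, the ratio of
    the first two eigenvalues is \<open>(1 + g) / g\<close>, which equals the bound.\<close>
  also have "1 + 1 / g = ((real (2 div 2))\<^sup>2 + g) / ((real (1 div 2))\<^sup>2 + g)"
    using g by (simp add: field_simps)
  finally show "C < ((real (2 div 2))\<^sup>2 + g) / ((real (1 div 2))\<^sup>2 + g)" .
qed

theorem corollary2p2:
  assumes "CARD('n::finite) = 2 \<or> CARD('n) = 3"
  shows
    "(\<forall>K L (\<gamma> :: real \<Rightarrow> real ^ 'n) V lam u1 du1.
        smooth_curve K L \<gamma> \<and>
        V \<in> borel_measurable (lebesgue_on {0..L}) \<and> bounded (V ` {0..L}) \<and>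
        eigenvalue_list K L V lam \<and>
        (\<lambda>s. complex_of_real (u1 s)) \<in> eigenspace K L V (lam 1) \<and>
        (LINT s|lebesgue_on {0..L}. (u1 s)\<^sup>2) = 1 \<and>
        W01 K L (\<lambda>s. complex_of_real (u1 s)) (\<lambda>s. complex_of_real (du1 s)) \<longrightarrow>
        lam 2 - lam 1
          \<le> 4 * (LINT s|lebesgue_on {0..L}. (du1 s)\<^sup>2 + (curvature K L \<gamma> s)\<^sup>2 / 4 * (u1 s)\<^sup>2)) \<and>
     (\<forall>K L (\<gamma> :: real \<Rightarrow> real ^ 'n) g lam.
        smooth_curve K L \<gamma> \<and> g > 0 \<and>
        eigenvalue_list K L (\<lambda>s. g * (curvature K L \<gamma> s)\<^sup>2) lam \<longrightarrow>
        lam 2 - lam 1 \<le> max 4 (1 / g) * lam 1 \<and>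
        lam 1 > 0 \<and> lam 2 / lam 1 \<le> max 5 (1 + 1 / g)) \<and>
     (\<forall>g. 0 < g \<and> g \<le> 1 / 4 \<longrightarrow>
        (\<forall>C < max 5 (1 + 1 / g).
           \<exists>K L (\<gamma> :: real \<Rightarrow> real ^ 'n) lam.
             embedded_curve K L \<gamma> \<and>
             eigenvalue_list K L (\<lambda>s. g * (curvature K L \<gamma> s)\<^sup>2) lam \<and>
             lam 2 / lam 1 > C))"
proof (intro conjI allI impI)
  fix K L V lam u1 du1 and \<gamma> :: "real \<Rightarrow> real ^ 'n"
  assume "smooth_curve K L \<gamma> \<and>
        V \<in> borel_measurable (lebesgue_on {0..L}) \<and> bounded (V ` {0..L}) \<and>
        eigenvalue_list K L V lam \<and>
        (\<lambda>s. complex_of_real (u1 s)) \<in> eigenspace K L V (lam 1) \<and>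
        (LINT s|lebesgue_on {0..L}. (u1 s)\<^sup>2) = 1 \<and>
        W01 K L (\<lambda>s. complex_of_real (u1 s)) (\<lambda>s. complex_of_real (du1 s))"
  then show "lam 2 - lam 1
      \<le> 4 * (LINT s|lebesgue_on {0..L}. (du1 s)\<^sup>2 + (curvature K L \<gamma> s)\<^sup>2 / 4 * (u1 s)\<^sup>2)"
    using gap_bound_real[of K L \<gamma> V lam u1 du1] by blast
next
  fix K L g lam and \<gamma> :: "real \<Rightarrow> real ^ 'n"
  assume "smooth_curve K L \<gamma> \<and> g > 0 \<and> eigenvalue_list K L (\<lambda>s. g * (curvature K L \<gamma> s)\<^sup>2) lam"
  then show "lam 2 - lam 1 \<le> max 4 (1 / g) * lam 1" "lam 1 > 0" "lam 2 / lam 1 \<le> max 5 (1 + 1 / g)"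
    using curvature_potential_bound[of K L \<gamma> g lam] by blast+
next
  fix g C :: real
  assume "0 < g \<and> g \<le> 1 / 4" "C < max 5 (1 + 1 / g)"
  \<comment> \<open>Dimension 2 or 3 provides the two distinct axes that span the plane of the
    circle.\<close>
  moreover obtain i j :: 'n where "i \<noteq> j"
  proof -
    have "\<not> is_singleton (UNIV :: 'n set)" using assms by (auto simp: is_singleton_altdef)
    then show ?thesis using that by (metis UNIV_I UNIV_eq_I empty_not_UNIV is_singletonI insert_iff singletonI)
  qed
  ultimately show "\<exists>K L (\<gamma> :: real \<Rightarrow> real ^ 'n) lam.
             embedded_curve K L \<gamma> \<and>
             eigenvalue_list K L (\<lambda>s. g * (curvature K L \<gamma> s)\<^sup>2) lam \<and>
             lam 2 / lam 1 > C"
    using circle_sharp[of i j g C] by blast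
qed



end
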